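(* For $u\in\{0,\dots,t\}$ let $\tau_u=(t+u,t-u)$. Then, as $G$-modules, $$(J_t)_2\;\cong\;\bigoplus_{\substack{u,v\in\{0,\dots,t\}\\ u+v\text{ even},\ u\neq v}} L_{\tau_u}V\otimes L_{\tau_v}W^*,$$ where summands with $t+u>m$ or $t+v>n$ are zero. Moreover, for $u,v\in\{0,\dots,t\}$ with $u+v$ even, $u\ne v$, $t+u\le m$ and $t+v\le n$, the highest bi-weight vector of the unique submodule of $(J_t)_2$ isomorphic to $L_{\tau_u}V\otimes L_{\tau_v}W^*$ is (up to a scalar) $$\mathbf f_{u,v}=\sum_{(I,J)}\sum_{(H,K)}(-1)^{I,J}(-1)^{H,K}\,[1,\dots,t-u,I\,|\,1,\dots,t-v,H]\cdot[1,\dots,t-u,J\,|\,1,\dots,t-v,K],$$ where $(I,J)$ runs over the ordered partitions of the set $\{t-u+1,\dots,t+u\}$ into two subsets with $|I|=|J|=u$, and $(H,K)$ over the ordered partitions of $\{t-v+1,\dots,t+v\}$ into two subsets with $|H|=|K|=v$.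
   Context: $\Bbbk$ is a field of characteristic $0$, $1\le t\le m\le n$; $V,W$ are $\Bbbk$-vector spaces with bases $e_1,\dots,e_m$ and $f_1,\dots,f_n$, and $f_1^*,\dots,f_n^*$ is the dual basis of $W^*$. $G=\mathrm{GL}(V)\times\mathrm{GL}(W)$, $E=\bigwedge^tV$, $F=\bigwedge^tW$. $X=(x_{ij})$ is an $m\times n$ matrix of indeterminates; $\Bbbk[X]$ is identified with $\mathrm{Sym}(V\otimes W^* )$ via $x_{ij}=e_i\otimes f_j^*$, so $G$ acts on it. $A_t=A_t(m,n)\subseteq\Bbbk[X]$ is the subalgebra generated by the $t$-minors of $X$, graded so that $t$-minors have degree $1$. $S_t=\mathrm{Sym}(E\otimes F^* )$, and $\pi:S_t\to A_t$ is the graded $G$-equivariant surjection sending $(e_{i_1}\wedge\dots\wedge e_{i_t})\otimes(f_{j_1}^*\wedge\dots\wedge f_{j_t}^* )$ to the minor with rows $i_1,\dots,i_t$ and columns $j_1,\dots,j_t$; $J_t=\ker\pi$. The symbol $[i_1,\dots,i_t|j_1,\dots,j_t]$ in $S_t$ denotes the element $(e_{i_1}\wedge\dots\wedge e_{i_t})\otimes(f_{j_1}^*\wedge\dots\wedge f_{j_t}^* )$; a set inside the brackets is listed in increasing order. For a partition $A_1,A_2$ of a finite set of integers, $(-1)^{A_1,A_2}$ is the sign of the permutation that takes the increasing listing of $A_1\cup A_2$ to the listing of $A_1$ in increasing order followed by $A_2$ in increasing order. Schur modules are denoted $L_\lambda V$ with the convention $L_{(d)}V=\bigwedge^dV$,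 $L_{(1^d)}V=\mathrm{Sym}^dV$; $L_\lambda V=0$ iff $\lambda_1>\dim V$; $L_\lambda W^*=(L_\lambda W)^*$; trailing zeros of partitions are ignored. A highest bi-weight vector of an irreducible $G$-submodule is its (unique up to scalar) nonzero vector invariant under $U\times U'$, where $U\subseteq \mathrm{GL}(V)$ consists of the maps with $e_i\mapsto e_i+(\text{combination of }e_j,\ j<i)$, and $U'\subseteq \mathrm{GL}(W)$ of the maps acting on $W^*$ by $f_i^*\mapsto f_i^*+(\text{combination of }f_j^*,\ j<i)$. *)

theory Defs
  imports
    "HOL-Library.Poly_Mapping"
    "HOL-Combinatorics.Permutations"
    "HOL-Algebra.Group"
    "Jordan_Normal_Form.Determinant"
begin

section \<open>Vector spaces with a distinguished basis\<close>

text \<open>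
  All vector spaces occurring here are subspaces of free vector spaces \<open>'a \<Rightarrow>\<^sub>0 'k\<close> of finitely
  supported functions. Index sets are 0-based throughout: the basis \<open>e_1, \<dots>, e_m\<close> of \<open>V\<close> is
  \<open>bvec 0, \<dots>, bvec (m - 1)\<close> in \<open>nat \<Rightarrow>\<^sub>0 'k\<close>, and similarly for \<open>f_1^*, \<dots>, f_n^*\<close> in \<open>W^*\<close>.
\<close>

definition bvec :: "'a \<Rightarrow> ('a \<Rightarrow>\<^sub>0 'k::zero_neq_one)" where
  "bvec x = Poly_Mapping.single x 1"

definition pm_scale :: "'k::semiring_0 \<Rightarrow> ('a \<Rightarrow>\<^sub>0 'k) \<Rightarrow> ('a \<Rightarrow>\<^sub>0 'k)" where
  "pm_scale c = Poly_Mapping.map ((*) c)"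

lemma lookup_pm_scale [simp]:
  "Poly_Mapping.lookup (pm_scale c p) x = c * Poly_Mapping.lookup p x"
  by (simp add: pm_scale_def map.rep_eq when_def)

interpretation pm: vector_space "pm_scale :: 'k::field \<Rightarrow> ('a \<Rightarrow>\<^sub>0 'k) \<Rightarrow> ('a \<Rightarrow>\<^sub>0 'k)"
  by unfold_locales (auto intro!: poly_mapping_eqI simp: lookup_add algebra_simps)

text \<open>The linear map with prescribed values on the basis vectors.\<close>

definition lin_ext :: "('a \<Rightarrow> ('b \<Rightarrow>\<^sub>0 'k::semiring_0)) \<Rightarrow> ('a \<Rightarrow>\<^sub>0 'k) \<Rightarrow> ('b \<Rightarrow>\<^sub>0 'k)" where
  "lin_ext f p = (\<Sum>x\<in>Poly_Mapping.keys p. pm_scale (Poly_Mapping.lookup p x) (f x))"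

lemma lin_ext_bvec [simp]: "lin_ext f (bvec x :: 'a \<Rightarrow>\<^sub>0 'k::field) = f x"
  by (simp add: lin_ext_def bvec_def)


subsection \<open>Tensor products and direct sums\<close>

definition tensor ::
    "('a \<Rightarrow>\<^sub>0 'k::semiring_0) \<Rightarrow> ('b \<Rightarrow>\<^sub>0 'k) \<Rightarrow> ('a \<times> 'b \<Rightarrow>\<^sub>0 'k)" where
  "tensor p q = (\<Sum>x\<in>Poly_Mapping.keys p. \<Sum>y\<in>Poly_Mapping.keys q.
     Poly_Mapping.single (x, y) (Poly_Mapping.lookup p x * Poly_Mapping.lookup q y))"

definition tensor_space ::
    "('a \<Rightarrow>\<^sub>0 'k::field) set \<Rightarrow> ('b \<Rightarrow>\<^sub>0 'k) set \<Rightarrow> ('a \<times> 'b \<Rightarrow>\<^sub>0 'k) set" where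
  "tensor_space A B = pm.span {tensor p q |p q. p \<in> A \<and> q \<in> B}"

definition tensor_map ::
    "(('a \<Rightarrow>\<^sub>0 'k) \<Rightarrow> ('c \<Rightarrow>\<^sub>0 'k)) \<Rightarrow> (('b \<Rightarrow>\<^sub>0 'k) \<Rightarrow> ('d \<Rightarrow>\<^sub>0 'k)) \<Rightarrow>
      ('a \<times> 'b \<Rightarrow>\<^sub>0 'k::comm_ring_1) \<Rightarrow> ('c \<times> 'd \<Rightarrow>\<^sub>0 'k)" where
  "tensor_map S T = lin_ext (\<lambda>(x, y). tensor (S (bvec x)) (T (bvec y)))"

text \<open>
  The external direct sum of subspaces \<open>M i\<close> (\<open>i \<in> I\<close>) of one and the same free vector space:
  the slice \<open>Poly_Mapping.map_key (Pair i) p\<close> is the \<open>i\<close>-th component of \<open>p\<close>.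
\<close>

definition direct_sum :: "'i set \<Rightarrow> ('i \<Rightarrow> ('a \<Rightarrow>\<^sub>0 'k::field) set) \<Rightarrow> ('i \<times> 'a \<Rightarrow>\<^sub>0 'k) set" where
  "direct_sum I M = {p. \<forall>i. if i \<in> I then Poly_Mapping.map_key (Pair i) p \<in> M i
                             else Poly_Mapping.map_key (Pair i) p = 0}"

definition direct_sum_map ::
    "(('a \<Rightarrow>\<^sub>0 'k) \<Rightarrow> ('b \<Rightarrow>\<^sub>0 'k)) \<Rightarrow> ('i \<times> 'a \<Rightarrow>\<^sub>0 'k::comm_ring_1) \<Rightarrow> ('i \<times> 'b \<Rightarrow>\<^sub>0 'k)" where
  "direct_sum_map T = lin_ext (\<lambda>(i, x). tensor (bvec i) (T (bvec x)))"


subsection \<open>Exterior powers\<close>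

text \<open>
  The \<open>t\<close>-th exterior power of a space with ordered basis \<open>bvec i\<close> has the basis
  \<open>bvec I = bvec i_1 \<and> \<dots> \<and> bvec i_t\<close>, where \<open>I = {i_1 < \<dots> < i_t}\<close>. The coefficient of \<open>bvec K\<close> in
  \<open>v_1 \<and> \<dots> \<and> v_t\<close> is the minor with rows \<open>K\<close> of the matrix whose columns are the \<open>v_s\<close>.
\<close>

definition wedge :: "('a::linorder \<Rightarrow>\<^sub>0 'k::comm_ring_1) list \<Rightarrow> ('a set \<Rightarrow>\<^sub>0 'k)" where
  "wedge vs = (\<Sum>K | K \<subseteq> (\<Union>v\<in>set vs. Poly_Mapping.keys v) \<and> card K = length vs.
     Poly_Mapping.single K
       (det (mat (length vs) (length vs)
          (\<lambda>(r, s). Poly_Mapping.lookup (vs ! s) (sorted_list_of_set K ! r)))))"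

definition ext_map ::
    "(('a::linorder \<Rightarrow>\<^sub>0 'k::comm_ring_1) \<Rightarrow> ('b::linorder \<Rightarrow>\<^sub>0 'k)) \<Rightarrow>
      ('a set \<Rightarrow>\<^sub>0 'k) \<Rightarrow> ('b set \<Rightarrow>\<^sub>0 'k)" where
  "ext_map T = lin_ext (\<lambda>I. wedge (map (\<lambda>i. T (bvec i)) (sorted_list_of_set I)))"

definition subsets_of_size :: "nat \<Rightarrow> nat \<Rightarrow> nat set set" where
  "subsets_of_size d t = {I. I \<subseteq> {..<d} \<and> card I = t}"


subsection \<open>Polynomial rings, that is, symmetric algebras\<close>

type_synonym ('v, 'k) mpoly = "('v \<Rightarrow>\<^sub>0 nat) \<Rightarrow>\<^sub>0 'k"

definition Var :: "'v \<Rightarrow> ('v, 'k::zero_neq_one) mpoly" where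
  "Var x = bvec (Poly_Mapping.single x 1)"

text \<open>The polynomials that involve only variables from a given set.\<close>

definition polys_in :: "'v set \<Rightarrow> ('v, 'k::zero) mpoly set" where
  "polys_in A = {p. \<forall>mon\<in>Poly_Mapping.keys p. Poly_Mapping.keys mon \<subseteq> A}"

definition homogeneous :: "nat \<Rightarrow> ('v, 'k::zero) mpoly set" where
  "homogeneous d = {p. \<forall>mon\<in>Poly_Mapping.keys p.
     (\<Sum>x\<in>Poly_Mapping.keys mon. Poly_Mapping.lookup mon x) = d}"

text \<open>The algebra homomorphism with prescribed values on the variables.\<close>

definition alg_ext ::
    "('v \<Rightarrow> ('w, 'k) mpoly) \<Rightarrow> ('v, 'k::comm_ring_1) mpoly \<Rightarrow> ('w, 'k) mpoly" where
  "alg_ext h = lin_ext (\<lambda>mon. \<Prod>x\<in>Poly_Mapping.keys mon. h x ^ Poly_Mapping.lookup mon x)"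

text \<open>
  \<open>Sym\<close> of a linear map; \<open>lin_ext Var\<close> is the inclusion of the vector space into its symmetric
  algebra.
\<close>

definition sym_map ::
    "(('v \<Rightarrow>\<^sub>0 'k) \<Rightarrow> ('w \<Rightarrow>\<^sub>0 'k)) \<Rightarrow> ('v, 'k::comm_ring_1) mpoly \<Rightarrow> ('w, 'k) mpoly" where
  "sym_map T = alg_ext (\<lambda>x. lin_ext Var (T (bvec x)))"

lemma alg_ext_Var [simp]: "alg_ext h (Var x :: ('v, 'k::field) mpoly) = h x"
  by (simp add: alg_ext_def Var_def)


section \<open>Modules over a group\<close>

definition gmodule ::
    "('g, 'r) monoid_scheme \<Rightarrow> ('g \<Rightarrow> ('a \<Rightarrow>\<^sub>0 'k::field) \<Rightarrow> ('a \<Rightarrow>\<^sub>0 'k)) \<Rightarrow> ('a \<Rightarrow>\<^sub>0 'k) set \<Rightarrow> bool" where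
  "gmodule G \<rho> M \<longleftrightarrow> pm.subspace M \<and>
     (\<forall>g\<in>carrier G. \<forall>x\<in>M. \<rho> g x \<in> M) \<and>
     (\<forall>g\<in>carrier G. \<forall>x\<in>M. \<forall>y\<in>M. \<rho> g (x + y) = \<rho> g x + \<rho> g y) \<and>
     (\<forall>g\<in>carrier G. \<forall>c. \<forall>x\<in>M. \<rho> g (pm_scale c x) = pm_scale c (\<rho> g x)) \<and>
     (\<forall>x\<in>M. \<rho> \<one>\<^bsub>G\<^esub> x = x) \<and>
     (\<forall>g\<in>carrier G. \<forall>h\<in>carrier G. \<forall>x\<in>M. \<rho> (g \<otimes>\<^bsub>G\<^esub> h) x = \<rho> g (\<rho> h x))"

definition gmodule_iso ::
    "('g, 'r) monoid_scheme \<Rightarrow>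
      ('g \<Rightarrow> ('a \<Rightarrow>\<^sub>0 'k::field) \<Rightarrow> ('a \<Rightarrow>\<^sub>0 'k)) \<Rightarrow> ('a \<Rightarrow>\<^sub>0 'k) set \<Rightarrow>
      ('g \<Rightarrow> ('b \<Rightarrow>\<^sub>0 'k) \<Rightarrow> ('b \<Rightarrow>\<^sub>0 'k)) \<Rightarrow> ('b \<Rightarrow>\<^sub>0 'k) set \<Rightarrow> bool" where
  "gmodule_iso G \<rho> M \<sigma> N \<longleftrightarrow> gmodule G \<rho> M \<and> gmodule G \<sigma> N \<and>
     (\<exists>\<phi>. bij_betw \<phi> M N \<and>
        (\<forall>x\<in>M. \<forall>y\<in>M. \<phi> (x + y) = \<phi> x + \<phi> y) \<and>
        (\<forall>c. \<forall>x\<in>M. \<phi> (pm_scale c x) = pm_scale c (\<phi> x)) \<and>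
        (\<forall>g\<in>carrier G. \<forall>x\<in>M. \<phi> (\<rho> g x) = \<sigma> g (\<phi> x)))"

definition gsubmodule ::
    "('g, 'r) monoid_scheme \<Rightarrow> ('g \<Rightarrow> ('a \<Rightarrow>\<^sub>0 'k::field) \<Rightarrow> ('a \<Rightarrow>\<^sub>0 'k)) \<Rightarrow>
      ('a \<Rightarrow>\<^sub>0 'k) set \<Rightarrow> ('a \<Rightarrow>\<^sub>0 'k) set \<Rightarrow> bool" where
  "gsubmodule G \<rho> N M \<longleftrightarrow> N \<subseteq> M \<and> gmodule G \<rho> N"

definition irreducible_gmodule ::
    "('g, 'r) monoid_scheme \<Rightarrow> ('g \<Rightarrow> ('a \<Rightarrow>\<^sub>0 'k::field) \<Rightarrow> ('a \<Rightarrow>\<^sub>0 'k)) \<Rightarrow> ('a \<Rightarrow>\<^sub>0 'k) set \<Rightarrow> bool" where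
  "irreducible_gmodule G \<rho> M \<longleftrightarrow> gmodule G \<rho> M \<and> M \<noteq> {0} \<and>
     (\<forall>N. gsubmodule G \<rho> N M \<longrightarrow> N = {0} \<or> N = M)"


section \<open>The group \<open>GL(V) \<times> GL(W)\<close>\<close>

definition GL :: "nat \<Rightarrow> 'k::field mat monoid" where
  "GL d = units_of (ring_mat TYPE('k) d ())"

definition GG :: "nat \<Rightarrow> nat \<Rightarrow> ('k::field mat \<times> 'k mat) monoid" where
  "GG m n = GL m \<times>\<times> GL n"

definition std_act :: "'k::field mat \<Rightarrow> (nat \<Rightarrow>\<^sub>0 'k) \<Rightarrow> (nat \<Rightarrow>\<^sub>0 'k)" where
  "std_act a = lin_ext (\<lambda>i. \<Sum>k<dim_row a. Poly_Mapping.single k (a $$ (k, i)))"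

text \<open>
  The contragredient action of \<open>b \<in> GL(W)\<close> on \<open>W^*\<close>, that is, \<open>f_j^* \<mapsto> f_j^* \<circ> b\<^sup>-\<^sup>1\<close>; its matrix
  with respect to the dual basis is the transposed inverse of \<open>b\<close>.
\<close>

definition dual_act :: "nat \<Rightarrow> 'k::field mat \<Rightarrow> (nat \<Rightarrow>\<^sub>0 'k) \<Rightarrow> (nat \<Rightarrow>\<^sub>0 'k)" where
  "dual_act n b = std_act (transpose_mat (inv\<^bsub>GL n\<^esub> b))"

definition unip_V :: "nat \<Rightarrow> 'k::field mat set" where
  "unip_V m = {a \<in> carrier (GL m). \<forall>i<m. std_act a (bvec i) - bvec i \<in> pm.span (bvec ` {..<i})}"

definition unip_W :: "nat \<Rightarrow> 'k::field mat set" where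
  "unip_W n = {b \<in> carrier (GL n). \<forall>i<n. dual_act n b (bvec i) - bvec i \<in> pm.span (bvec ` {..<i})}"


section \<open>Schur modules\<close>

text \<open>
  The Schur module \<open>L_\<lambda>\<close> of a space \<open>Z\<close> with basis \<open>z_0, \<dots>, z_{d-1}\<close> is the image of the Schur map
  \<open>\<Lambda>^{\<lambda>_1} Z \<otimes> \<dots> \<otimes> \<Lambda>^{\<lambda>_s} Z \<longrightarrow> Sym^{\<lambda>'_1} Z \<otimes> Sym^{\<lambda>'_2} Z \<otimes> \<dots>\<close>
  of Akin, Buchsbaum and Weyman: each \<open>\<Lambda>^{\<lambda>_r} Z\<close> is antisymmetrised into \<open>Z^{\<otimes>\<lambda>_r}\<close>, the boxes of
  row \<open>r\<close>, and the boxes in each column \<open>c\<close> of the diagram are then multiplied in \<open>Sym Z\<close>. The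
  target lies in the polynomial ring in the variables \<open>Var (i, c)\<close>, which stand for \<open>z_i\<close> in the
  symmetric algebra of column \<open>c\<close>. There the image of \<open>z_{i_1} \<and> \<dots> \<and> z_{i_l}\<close> (\<open>l = \<lambda>_r\<close>) is the
  determinant \<open>schur_row {i_1 < \<dots> < i_l}\<close>. In particular \<open>L_{(d)} = \<Lambda>^d\<close> and \<open>L_{(1^d)} = Sym^d\<close>.
\<close>

definition schur_row :: "nat set \<Rightarrow> (nat \<times> nat, 'k::field) mpoly" where
  "schur_row I = det (mat (card I) (card I) (\<lambda>(a, c). Var (sorted_list_of_set I ! a, c)))"

definition schur_module :: "nat \<Rightarrow> nat list \<Rightarrow> (nat \<times> nat, 'k::field) mpoly set" where
  "schur_module d lam = pm.span {\<Prod>r<length lam. schur_row (R r) |R.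
     \<forall>r<length lam. R r \<in> subsets_of_size d (lam ! r)}"

definition schur_map ::
    "((nat \<Rightarrow>\<^sub>0 'k) \<Rightarrow> (nat \<Rightarrow>\<^sub>0 'k)) \<Rightarrow> (nat \<times> nat, 'k::field) mpoly \<Rightarrow> (nat \<times> nat, 'k) mpoly" where
  "schur_map T = sym_map (tensor_map T (\<lambda>y. y))"

text \<open>\<open>L_\<lambda> V \<otimes> L_\<mu> W^*\<close>, where \<open>L_\<mu>\<close> is applied to \<open>W^*\<close> with the basis \<open>f_1^*, \<dots>, f_n^*\<close>.\<close>

definition schur_tensor ::
    "nat \<Rightarrow> nat \<Rightarrow> nat list \<Rightarrow> nat list \<Rightarrow>
      (((nat \<times> nat) \<Rightarrow>\<^sub>0 nat) \<times> ((nat \<times> nat) \<Rightarrow>\<^sub>0 nat) \<Rightarrow>\<^sub>0 'k::field) set" where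
  "schur_tensor m n lam mu = tensor_space (schur_module m lam) (schur_module n mu)"

definition schur_tensor_act ::
    "nat \<Rightarrow> 'k::field mat \<times> 'k mat \<Rightarrow>
      (((nat \<times> nat) \<Rightarrow>\<^sub>0 nat) \<times> ((nat \<times> nat) \<Rightarrow>\<^sub>0 nat) \<Rightarrow>\<^sub>0 'k) \<Rightarrow>
      (((nat \<times> nat) \<Rightarrow>\<^sub>0 nat) \<times> ((nat \<times> nat) \<Rightarrow>\<^sub>0 nat) \<Rightarrow>\<^sub>0 'k)" where
  "schur_tensor_act n = (\<lambda>(a, b). tensor_map (schur_map (std_act a)) (schur_map (dual_act n b)))"

definition tau :: "nat \<Rightarrow> nat \<Rightarrow> nat list" where
  "tau t u = [t + u, t - u]"


section \<open>Relations between \<open>t\<close>-minors\<close>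

text \<open>
  \<open>S_t = Sym(E \<otimes> F^*)\<close> is the polynomial ring in the variables \<open>Var (I, J)\<close>, where \<open>I\<close> and \<open>J\<close> are
  \<open>t\<close>-element sets of row and column indices; \<open>Var (I, J)\<close> is \<open>e_I \<otimes> f_J^*\<close>, that is, the symbol
  \<open>[I | J]\<close> with both sets listed in increasing order. Here \<open>F^*\<close> is identified with the exterior
  power of \<open>W^*\<close>.
\<close>

type_synonym 'k minor_poly = "(nat set \<times> nat set, 'k) mpoly"

definition S_space :: "nat \<Rightarrow> nat \<Rightarrow> nat \<Rightarrow> 'k::field minor_poly set" where
  "S_space t m n = polys_in (subsets_of_size m t \<times> subsets_of_size n t)"

definition S_act :: "nat \<Rightarrow> 'k::field mat \<times> 'k mat \<Rightarrow> 'k minor_poly \<Rightarrow> 'k minor_poly" where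
  "S_act n = (\<lambda>(a, b). sym_map (tensor_map (ext_map (std_act a)) (ext_map (dual_act n b))))"

definition minor :: "nat set \<Rightarrow> nat set \<Rightarrow> (nat \<times> nat, 'k::field) mpoly" where
  "minor I J = det (mat (card I) (card J)
     (\<lambda>(r, s). Var (sorted_list_of_set I ! r, sorted_list_of_set J ! s)))"

text \<open>The map \<open>\<pi>\<close>, with the polynomial ring containing \<open>A_t = \<pi>(S_t)\<close> as its codomain.\<close>

definition pi_map :: "'k::field minor_poly \<Rightarrow> (nat \<times> nat, 'k) mpoly" where
  "pi_map = alg_ext (\<lambda>(I, J). minor I J)"

definition J_ideal :: "nat \<Rightarrow> nat \<Rightarrow> nat \<Rightarrow> 'k::field minor_poly set" where
  "J_ideal t m n = {p \<in> S_space t m n. pi_map p = 0}"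

definition J_deg2 :: "nat \<Rightarrow> nat \<Rightarrow> nat \<Rightarrow> 'k::field minor_poly set" where
  "J_deg2 t m n = J_ideal t m n \<inter> homogeneous 2"

definition highest_biweight_vector ::
    "nat \<Rightarrow> nat \<Rightarrow> 'k::field minor_poly set \<Rightarrow> 'k minor_poly \<Rightarrow> bool" where
  "highest_biweight_vector m n M x \<longleftrightarrow> irreducible_gmodule (GG m n) (S_act n) M \<and>
     x \<in> M \<and> x \<noteq> 0 \<and> (\<forall>a\<in>unip_V m. \<forall>b\<in>unip_W n. S_act n (a, b) x = x)"

definition partition_sign :: "nat set \<Rightarrow> nat set \<Rightarrow> int" where
  "partition_sign A B = sign (THE p. p permutes (A \<union> B) \<and>
     map p (sorted_list_of_set (A \<union> B)) = sorted_list_of_set A @ sorted_list_of_set B)"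

definition ordered_partitions :: "nat set \<Rightarrow> nat \<Rightarrow> (nat set \<times> nat set) set" where
  "ordered_partitions S u = {(I, J). I \<union> J = S \<and> I \<inter> J = {} \<and> card I = u \<and> card J = u}"

text \<open>
  With 0-based indices, \<open>{1, \<dots>, t-u}\<close> becomes \<open>{..<t-u}\<close> and \<open>{t-u+1, \<dots>, t+u}\<close> becomes
  \<open>{t-u..<t+u}\<close>.
\<close>

definition f_vec :: "nat \<Rightarrow> nat \<Rightarrow> nat \<Rightarrow> 'k::field minor_poly" where
  "f_vec t u v =
     (\<Sum>(I, J)\<in>ordered_partitions {t - u..<t + u} u.
        \<Sum>(H, K)\<in>ordered_partitions {t - v..<t + v} v.
          of_int (partition_sign I J) * of_int (partition_sign H K) *
          Var ({..<t - u} \<union> I, {..<t - v} \<union> H) * Var ({..<t - u} \<union> J, {..<t - v} \<union> K))"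

end

(* Write the second exterior tensor power as functions z on pairs (I, J) of index sets. It carries an
   sl2-action commuting with GL(V), whose raising and lowering operators Uop and Dop move one index
   from J to I or back. The vectors hvec for the different u are weight vectors of different
   sl2-types, so their pairing with the products of minors Phi vanishes unless the types agree.
   Two consequences: tensoring the values of Phi on the rows and on the columns of two brackets gives
   equivariant maps schur_proj from the quadratic forms to the tensor products of Schur modules,
   separating the f_vec; and the minor map sends f_vec t u v to a multiple of the pairing of the hvec
   of u with the Phi of v, which is zero iff u and v differ.

   Every nonzero submodule of the quadratic forms contains some f_vec: take a weight of least index
   sum; its weight vector is fixed by the unitriangular groups, and invariance under adjacent
   elementary matrices determines its coefficients. Complete reducibility comes from a contravariant
   symmetric form: f_vec pairs nontrivially with itself, so no nonzero submodule is isotropic, and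
   submodules split off. Hence a submodule is determined by the f_vec it contains. *)
theory Submission imports Defs begin

section \<open>Minors indexed by finite sets of natural numbers: Laplace expansion and the
  Cauchy-Binet formula\<close>

section \<open>Minors\<close>

text \<open>The parity condition has its origin in the sl2 picture. For fixed u the
  \<open>hvec\<close> with p = t-u, ..., t+u form a string of length 2u+1, and its middle member p =
  t changes by (-1)^u when I and J are exchanged. A product of two middle members of types u and v
  is therefore symmetric exactly when u + v is even, and it is antisymmetric otherwise.

  The obstacle to complete reducibility is that the ground field is an arbitrary field of
  characteristic 0: the contravariant form may have isotropic vectors, so no positivity argument is
  available. Integrality replaces it. The polarised coefficients of \<open>f_vec\<close> are 0, 2 or
  -2, hence its pairing with itself is a positive integer, and it is enough to know this for the
  \<open>f_vec\<close> because every nonzero submodule contains one of them.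

  Neither the irreducibility of the components nor the invariance of \<open>f_vec\<close> under the
  unipotent groups is calculated. Both are consequences of knowing which \<open>f_vec\<close> a
  submodule can contain.\<close>

definition mnr :: "(nat \<Rightarrow> nat \<Rightarrow> 'r::comm_ring_1) \<Rightarrow> nat set \<Rightarrow> nat set \<Rightarrow> 'r" where
  "mnr M I J = det (mat (card I) (card J)
     (\<lambda>(r, s). M (sorted_list_of_set I ! r) (sorted_list_of_set J ! s)))"

definition below :: "nat set \<Rightarrow> nat \<Rightarrow> nat" where
  "below S j = card {i \<in> S. i < j}"

definition above :: "nat set \<Rightarrow> nat \<Rightarrow> nat" where
  "above S j = card {i \<in> S. j < i}"

text \<open>\<open>det\<close> is 0 by convention on nonsquare matrices. This convention lets the
  sums below run over all pairs of index sets, with the wrong sizes contributing nothing.\<close>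

lemma mnr_nonsquare: "card I \<noteq> card J \<Longrightarrow> mnr M I J = 0"
  by (simp add: mnr_def det_def)

lemma mnr_empty [simp]: "mnr M {} {} = 1"
  by (simp add: mnr_def)

lemma mnr_transpose: "mnr (\<lambda>i j. M j i) J I = mnr M I J"
proof (cases "card I = card J")
  case True
  have "mat (card J) (card I) (\<lambda>(r, s). M (sorted_list_of_set I ! s) (sorted_list_of_set J ! r))
     = transpose_mat (mat (card I) (card J)
         (\<lambda>(r, s). M (sorted_list_of_set I ! r) (sorted_list_of_set J ! s)))"
    by (intro eq_matI) auto
  then show ?thesis
    unfolding mnr_def using True by (simp add: det_transpose[of _ "card J"])
next
  case False
  then show ?thesis by (simp add: mnr_nonsquare)
qed

lemma mnr_cong:
  assumes "\<And>i j. i \<in> I \<Longrightarrow> j \<in> J \<Longrightarrow> M i j = N i j"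
  shows "mnr M I J = mnr N I J"
proof -
  have "sorted_list_of_set I ! r \<in> I" if "r < card I" for r
    using that card_ge_0_finite[of I] nth_mem[of r "sorted_list_of_set I"] by auto
  moreover have "sorted_list_of_set J ! r \<in> J" if "r < card J" for r
    using that card_ge_0_finite[of J] nth_mem[of r "sorted_list_of_set J"] by auto
  ultimately show ?thesis
    unfolding mnr_def by (intro arg_cong[of _ _ det] eq_matI) (auto simp: assms)
qed

lemma mnr_hom:
  assumes "comm_ring_hom h"
  shows "h (mnr M I J) = mnr (\<lambda>i j. h (M i j)) I J"
proof -
  interpret comm_ring_hom h by fact
  have "map_mat h (mat (card I) (card J)
        (\<lambda>(r, s). M (sorted_list_of_set I ! r) (sorted_list_of_set J ! s)))
     = mat (card I) (card J) (\<lambda>(r, s). h (M (sorted_list_of_set I ! r) (sorted_list_of_set J ! s)))"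
    by (intro eq_matI) auto
  then show ?thesis unfolding mnr_def by (metis hom_det)
qed

lemma below_sorted_list_of_set:
  assumes "finite S" "k < card S"
  shows "below S (sorted_list_of_set S ! k) = k"
proof -
  let ?xs = "sorted_list_of_set S"
  have sm: "sorted_wrt (<) ?xs" by (rule strict_sorted_list_of_set)
  have "{i \<in> S. i < ?xs ! k} = (\<lambda>i. ?xs ! i) ` {..<k}"
  proof (intro Set.set_eqI iffI)
    fix x assume "x \<in> {i \<in> S. i < ?xs ! k}"
    then have "x \<in> set ?xs" "x < ?xs ! k" using assms by auto
    then obtain i where i: "i < length ?xs" "x = ?xs ! i" by (auto simp: in_set_conv_nth)
    have "i < k"
    proof (rule ccontr)
      assume "\<not> i < k"
      then have "?xs ! k \<le> ?xs ! i"
        using i assms sorted_nth_mono[of ?xs k i] by auto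
      then show False using i \<open>x < ?xs ! k\<close> by simp
    qed
    then show "x \<in> (\<lambda>i. ?xs ! i) ` {..<k}" using i by auto
  next
    fix x assume "x \<in> (\<lambda>i. ?xs ! i) ` {..<k}"
    then obtain i where i: "i < k" "x = ?xs ! i" by auto
    then have "?xs ! i < ?xs ! k"
      using sm assms sorted_wrt_nth_less[of "(<)" ?xs i k] by simp
    moreover have "?xs ! i \<in> S" using i assms nth_mem[of i ?xs] by simp
    ultimately show "x \<in> {i \<in> S. i < ?xs ! k}" using i by simp
  qed
  moreover have "inj_on (\<lambda>i. ?xs ! i) {..<k}"
    using assms by (intro inj_on_nth) auto
  ultimately show ?thesis by (simp add: below_def card_image)
qed

lemma bij_betw_sorted_list_of_set:
  "finite S \<Longrightarrow> bij_betw (\<lambda>k. sorted_list_of_set S ! k) {..<card S} S"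
  by (metis bij_betw_nth distinct_sorted_list_of_set length_sorted_list_of_set set_sorted_list_of_set)

lemma insort_split:
  "sorted xs \<Longrightarrow> insort j xs = takeWhile (\<lambda>x. x < j) xs @ j # dropWhile (\<lambda>x. x < j) xs"
  for j :: nat
  by (induction xs) auto

text \<open>\<open>insort\<close> keeps a second copy of j when j already lies in I; this copy is
  the source of the equal rows in \<open>row_expansion\<close>.\<close>

lemma insort_sorted_list_of_set:
  assumes "finite I"
  shows "insort j (sorted_list_of_set I) =
    take (below I j) (sorted_list_of_set I) @ j # drop (below I j) (sorted_list_of_set I)"
proof -
  let ?xs = "sorted_list_of_set I"
  have tw: "takeWhile (\<lambda>x. x < j) xs = filter (\<lambda>x. x < j) xs" if "sorted xs" for xs :: "nat list"
    using that by (induction xs) (auto simp: empty_filter_conv)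
  have "length (takeWhile (\<lambda>x. x < j) ?xs) = card (set (filter (\<lambda>x. x < j) ?xs))"
    by (subst distinct_card) (auto simp: tw)
  also have "\<dots> = below I j" using assms by (simp add: below_def)
  finally have "takeWhile (\<lambda>x. x < j) ?xs = take (below I j) ?xs"
    "dropWhile (\<lambda>x. x < j) ?xs = drop (below I j) ?xs"
    by (metis takeWhile_eq_take, metis dropWhile_eq_drop)
  then show ?thesis by (simp add: insort_split)
qed

lemma below_le: "finite I \<Longrightarrow> below I j \<le> card I"
  by (auto simp: below_def intro: card_mono)

lemma insort_nth_delete:
  assumes "finite I" "k < card I"
  shows "insort j (sorted_list_of_set I) ! (if k < below I j then k else Suc k)
    = sorted_list_of_set I ! k"
  using assms below_le[OF assms(1), of j]
  by (auto simp: insort_sorted_list_of_set nth_append)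

lemma insort_nth_below:
  assumes "finite I"
  shows "insort j (sorted_list_of_set I) ! below I j = j"
  using assms below_le[OF assms(1), of j]
  by (auto simp: insort_sorted_list_of_set nth_append)

lemma det_identical_rows':
  fixes f :: "nat \<Rightarrow> nat \<Rightarrow> 'r::comm_ring_1"
  assumes "a < n" "b < n" "a \<noteq> b" "\<And>s. s < n \<Longrightarrow> f a s = f b s"
  shows "det (mat n n (\<lambda>(r, s). f r s)) = 0"
  using assms by (intro det_identical_rows[of _ n a b]) auto

text \<open>Laplace expansion, along the row of j, of the square matrix whose rows are listed by
  \<open>insort j (sorted_list_of_set I)\<close>. For j in I two rows coincide and the sum is 0.
  This vanishing case is what allows sums over J - I to be extended to sums over J later on.\<close>

theorem row_expansion:
  fixes M :: "nat \<Rightarrow> nat \<Rightarrow> 'r::comm_ring_1"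
  assumes I: "finite I" and H: "finite H" and c: "card H = Suc (card I)"
  shows "(\<Sum>h\<in>H. (-1) ^ below H h * M j h * mnr M I (H - {h}))
    = (if j \<in> I then 0 else (-1) ^ below I j * mnr M (insert j I) H)"
proof -
  let ?p = "card I" and ?r = "below I j"
  let ?L = "insort j (sorted_list_of_set I)" and ?H = "sorted_list_of_set H"
  define A where "A = mat (Suc ?p) (Suc ?p) (\<lambda>(r, s). M (?L ! r) (?H ! s))"
  have r: "?r < Suc ?p" using below_le[OF I] by (simp add: less_Suc_eq_le)
  have A: "A \<in> carrier_mat (Suc ?p) (Suc ?p)" by (simp add: A_def)
  have del: "mat_delete A ?r s = mat ?p (card (H - {?H ! s}))
      (\<lambda>(a, b). M (sorted_list_of_set I ! a) (sorted_list_of_set (H - {?H ! s}) ! b))"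
    if s: "s < Suc ?p" for s
  proof (rule eq_matI)
    let ?h = "?H ! s"
    have hH: "?h \<in> H" using s c H nth_mem[of s ?H] by simp
    have pos: "below (H - {?h}) ?h = s"
    proof -
      have "below (H - {?h}) ?h = below H ?h"
        unfolding below_def by (rule arg_cong[of _ _ card]) auto
      then show ?thesis using below_sorted_list_of_set[OF H, of s] s c by simp
    qed
    have cd: "card (H - {?h}) = ?p" using hH H c by simp
    have ins: "?H = insort ?h (sorted_list_of_set (H - {?h}))"
      using hH H sorted_list_of_set_insert_remove[of H ?h] by (simp add: insert_absorb)
    have Hb: "?H ! (if b < s then b else Suc b) = sorted_list_of_set (H - {?h}) ! b"
      if "b < ?p" for b
    proof -
      have "finite (H - {?h})" "b < card (H - {?h})" using that H cd by auto
      from insort_nth_delete[OF this, of ?h] show ?thesis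
        by (simp only: pos ins[symmetric])
    qed
    fix a b
    assume "a < dim_row (mat ?p (card (H - {?h})) (\<lambda>(a, b). M (sorted_list_of_set I ! a)
        (sorted_list_of_set (H - {?h}) ! b)))"
      and "b < dim_col (mat ?p (card (H - {?h})) (\<lambda>(a, b). M (sorted_list_of_set I ! a)
        (sorted_list_of_set (H - {?h}) ! b)))"
    then have ab: "a < ?p" "b < ?p" using cd by auto
    have "mat_delete A ?r s $$ (a, b)
        = M (?L ! (if a < ?r then a else Suc a)) (?H ! (if b < s then b else Suc b))"
      using ab by (simp add: mat_delete_def A_def)
    then show "mat_delete A ?r s $$ (a, b) = mat ?p (card (H - {?h}))
        (\<lambda>(a, b). M (sorted_list_of_set I ! a) (sorted_list_of_set (H - {?h}) ! b)) $$ (a, b)"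
      using ab cd Hb insort_nth_delete[OF I, of a j] by simp
  next
    have "?H ! s \<in> H" using s c H nth_mem[of s ?H] by simp
    then show "dim_col (mat_delete A ?r s) = dim_col (mat ?p (card (H - {?H ! s}))
      (\<lambda>(a, b). M (sorted_list_of_set I ! a) (sorted_list_of_set (H - {?H ! s}) ! b)))"
      using A H c by simp
  qed (use A in simp)
  have "det A = (\<Sum>s<Suc ?p. A $$ (?r, s) * cofactor A ?r s)"
    by (rule laplace_expansion_row[OF A r])
  also have "\<dots> = (\<Sum>s<Suc ?p. (-1) ^ ?r *
      ((-1) ^ below H (?H ! s) * M j (?H ! s) * mnr M I (H - {?H ! s})))"
  proof (rule sum.cong[OF refl])
    fix s assume "s \<in> {..<Suc ?p}"
    then have s: "s < Suc ?p" by simp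
    have "A $$ (?r, s) = M j (?H ! s)" using s r insort_nth_below[OF I, of j] by (simp add: A_def)
    then show "A $$ (?r, s) * cofactor A ?r s = (-1) ^ ?r *
      ((-1) ^ below H (?H ! s) * M j (?H ! s) * mnr M I (H - {?H ! s}))"
      using s c H by (simp add: cofactor_def del mnr_def below_sorted_list_of_set power_add)
  qed
  also have "\<dots> = (-1) ^ ?r * (\<Sum>s<Suc ?p. (\<lambda>h. (-1) ^ below H h * M j h * mnr M I (H - {h})) (?H ! s))"
    by (simp only: sum_distrib_left)
  also have "(\<Sum>s<Suc ?p. (\<lambda>h. (-1) ^ below H h * M j h * mnr M I (H - {h})) (?H ! s))
      = (\<Sum>h\<in>H. (-1) ^ below H h * M j h * mnr M I (H - {h}))"
    by (rule sum.reindex_bij_betw) (use bij_betw_sorted_list_of_set[OF H] c in simp)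
  finally have "(\<Sum>h\<in>H. (-1) ^ below H h * M j h * mnr M I (H - {h})) = (-1) ^ ?r * det A"
    by (simp add: mult.assoc[symmetric] power_add[symmetric])
  moreover have "det A = (if j \<in> I then 0 else mnr M (insert j I) H)"
  proof (cases "j \<in> I")
    case True
    then obtain k where k: "k < card I" "sorted_list_of_set I ! k = j"
      using I by (metis in_set_conv_nth length_sorted_list_of_set set_sorted_list_of_set)
    then have "?L ! (if k < ?r then k else Suc k) = j" using insort_nth_delete[OF I k(1), of j] by simp
    then have "det A = 0" unfolding A_def
      using k r insort_nth_below[OF I, of j]
      by (intro det_identical_rows'[of ?r _ "if k < ?r then k else Suc k"]) auto
    then show ?thesis using True by simp
  next
    case False
    then show ?thesis using I c
      by (simp add: A_def mnr_def)
  qed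
  ultimately show ?thesis by simp
qed

lemma column_expansion:
  fixes M :: "nat \<Rightarrow> nat \<Rightarrow> 'r::comm_ring_1"
  assumes "finite I" "finite H" "card I = Suc (card H)"
  shows "(\<Sum>i\<in>I. (-1) ^ below I i * M i j * mnr M (I - {i}) H)
    = (if j \<in> H then 0 else (-1) ^ below H j * mnr M I (insert j H))"
proof -
  have "(\<Sum>i\<in>I. (-1) ^ below I i * M i j * mnr M (I - {i}) H)
    = (\<Sum>i\<in>I. (-1) ^ below I i * M i j * mnr (\<lambda>i j. M j i) H (I - {i}))"
    by (simp add: mnr_transpose[of "\<lambda>i j. M i j"])
  also have "\<dots> = (if j \<in> H then 0 else (-1) ^ below H j * mnr (\<lambda>i j. M j i) (insert j H) I)"
    using row_expansion[OF assms(2,1,3), of "\<lambda>i j. M j i" j] by simp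
  finally show ?thesis by (simp add: mnr_transpose[of "\<lambda>i j. M i j"])
qed

lemma below_Diff: "below (S - {j}) j = below S j"
  unfolding below_def by (rule arg_cong[of _ _ card]) auto

lemma mnr_row_expand:
  fixes M :: "nat \<Rightarrow> nat \<Rightarrow> 'r::comm_ring_1"
  assumes "finite I" "finite H" "card H = card I" "j \<in> I"
  shows "mnr M I H = (-1) ^ below I j * (\<Sum>h\<in>H. (-1) ^ below H h * M j h * mnr M (I - {j}) (H - {h}))"
proof -
  have "card H = Suc (card (I - {j}))" using assms by (metis card.remove)
  from row_expansion[OF _ assms(2) this, of M j] assms
  have "(\<Sum>h\<in>H. (-1) ^ below H h * M j h * mnr M (I - {j}) (H - {h})) = (-1) ^ below I j * mnr M I H"
    by (simp add: below_Diff insert_absorb)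
  then show ?thesis by (simp add: mult.assoc[symmetric] power_add[symmetric])
qed

lemma finite_subsets_of_size [simp]: "finite (subsets_of_size d t)"
  by (rule finite_subset[of _ "Pow {..<d}"]) (auto simp: subsets_of_size_def)

lemma subsets_of_size_finite: "I \<in> subsets_of_size d t \<Longrightarrow> finite I"
  unfolding subsets_of_size_def using finite_subset by blast

lemma subsets_of_size_card: "I \<in> subsets_of_size d t \<Longrightarrow> card I = t"
  by (simp add: subsets_of_size_def)

text \<open>A set with a point outside it is the same as a set with one more element and a marked
  point in it.\<close>

lemma sum_subsets_of_size_Suc:
  "(\<Sum>K\<in>subsets_of_size d p. \<Sum>k\<in>{..<d} - K. f K k)
    = (\<Sum>K\<in>subsets_of_size d (Suc p). \<Sum>k\<in>K. f (K - {k}) k :: 'r::comm_monoid_add)"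
proof -
  have "(\<Sum>K\<in>subsets_of_size d p. \<Sum>k\<in>{..<d} - K. f K k)
    = (\<Sum>(K, k)\<in>(SIGMA K:subsets_of_size d p. {..<d} - K). f K k)"
    by (intro sum.Sigma) auto
  also have "\<dots> = (\<Sum>(K, k)\<in>(SIGMA K:subsets_of_size d (Suc p). K). f (K - {k}) k)"
  proof (rule sum.reindex_bij_witness[of _ "\<lambda>(K, k). (K - {k}, k)" "\<lambda>(K, k). (insert k K, k)"])
    fix a assume "a \<in> (SIGMA K:subsets_of_size d (Suc p). K)"
    then obtain K k where a: "a = (K, k)" "K \<subseteq> {..<d}" "card K = Suc p" "k \<in> K"
      by (auto simp: subsets_of_size_def)
    then have "finite K" using finite_subset by blast
    with a show "(case a of (K, k) \<Rightarrow> (K - {k}, k)) \<in> (SIGMA K:subsets_of_size d p. {..<d} - K)"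
      by (auto simp: subsets_of_size_def)
  next
    fix a assume "a \<in> (SIGMA K:subsets_of_size d p. {..<d} - K)"
    then obtain K k where a: "a = (K, k)" "K \<subseteq> {..<d}" "card K = p" "k < d" "k \<notin> K"
      by (auto simp: subsets_of_size_def)
    then have "finite K" using finite_subset by blast
    with a show "(case a of (K, k) \<Rightarrow> (insert k K, k)) \<in> (SIGMA K:subsets_of_size d (Suc p). K)"
      by (auto simp: subsets_of_size_def)
  qed auto
  also have "\<dots> = (\<Sum>K\<in>subsets_of_size d (Suc p). \<Sum>k\<in>K. f (K - {k}) k)"
    by (intro sum.Sigma[symmetric]) (auto dest: subsets_of_size_finite)
  finally show ?thesis .
qed

text \<open>Induction on the size of the minor: one row i of I is expanded, the smaller minors are
  treated by the induction hypothesis, and two further Laplace expansions, one for X and one for A,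
  reassemble the result.\<close>

theorem Cauchy_Binet:
  fixes A X :: "nat \<Rightarrow> nat \<Rightarrow> 'r::comm_ring_1"
  assumes "finite I" "finite C" "card I = p" "card C = p"
  shows "mnr (\<lambda>i c. \<Sum>k<d. A i k * X k c) I C
    = (\<Sum>K\<in>subsets_of_size d p. mnr A I K * mnr X K C)"
  using assms
proof (induction p arbitrary: I C)
  case 0
  have "subsets_of_size d 0 = {{}}"
    by (auto simp: subsets_of_size_def finite_subset[OF _ finite_lessThan])
  with 0 show ?case by simp
next
  case (Suc p)
  let ?Y = "\<lambda>i c. \<Sum>k<d. A i k * X k c"
  obtain i where i: "i \<in> I" using Suc.prems by fastforce
  let ?I = "I - {i}" and ?s = "(-1) ^ below I i :: 'r"
  have cI: "card ?I = p" using i Suc.prems by simp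
  have "mnr ?Y I C = ?s * (\<Sum>h\<in>C. (-1) ^ below C h * ?Y i h * mnr ?Y ?I (C - {h}))"
    using Suc.prems i by (intro mnr_row_expand) auto
  also have "(\<Sum>h\<in>C. (-1) ^ below C h * ?Y i h * mnr ?Y ?I (C - {h}))
    = (\<Sum>h\<in>C. (-1) ^ below C h * ?Y i h * (\<Sum>K\<in>subsets_of_size d p. mnr A ?I K * mnr X K (C - {h})))"
    using Suc.prems cI by (intro sum.cong refl arg_cong2[of _ _ _ _ "(*)"] Suc.IH) auto
  also have "\<dots> = (\<Sum>h\<in>C. \<Sum>K\<in>subsets_of_size d p. \<Sum>k<d. A i k * mnr A ?I K *
      ((-1) ^ below C h * X k h * mnr X K (C - {h})))"
    unfolding sum_distrib_left sum_distrib_right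
    by (intro sum.cong refl) (simp only: mult_ac)
  also have "\<dots> = (\<Sum>K\<in>subsets_of_size d p. \<Sum>k<d. \<Sum>h\<in>C. A i k * mnr A ?I K *
      ((-1) ^ below C h * X k h * mnr X K (C - {h})))"
    by (subst sum.swap) (intro sum.cong refl sum.swap)
  \<comment> \<open>Summing over h first turns the X-part into the expansion of a minor along row k,
    which is 0 when k already lies in K.\<close>
  also have "\<dots> = (\<Sum>K\<in>subsets_of_size d p. \<Sum>k<d. A i k * mnr A ?I K *
      (if k \<in> K then 0 else (-1) ^ below K k * mnr X (insert k K) C))"
  proof (intro sum.cong refl)
    fix K k assume "K \<in> subsets_of_size d p"
    then have "finite K" "card C = Suc (card K)" using Suc.prems
      by (auto dest: subsets_of_size_finite subsets_of_size_card)
    from row_expansion[OF this(1) Suc.prems(2) this(2), of X k]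
    show "(\<Sum>h\<in>C. A i k * mnr A ?I K * ((-1) ^ below C h * X k h * mnr X K (C - {h})))
       = A i k * mnr A ?I K * (if k \<in> K then 0 else (-1) ^ below K k * mnr X (insert k K) C)"
      by (simp only: sum_distrib_left[symmetric])
  qed
  also have "\<dots> = (\<Sum>K\<in>subsets_of_size d p. \<Sum>k\<in>{..<d} - K. A i k * mnr A ?I K *
      ((-1) ^ below K k * mnr X (insert k K) C))"
    by (rule sum.cong[OF refl]) (rule sum.mono_neutral_cong_right, auto)
  also have "\<dots> = (\<Sum>K\<in>subsets_of_size d (Suc p). \<Sum>k\<in>K. A i k * mnr A ?I (K - {k}) *
      ((-1) ^ below K k * mnr X K C))"
    unfolding sum_subsets_of_size_Suc
    by (intro sum.cong refl) (simp add: below_Diff insert_absorb)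
  finally have "mnr ?Y I C = ?s * \<dots>" .
  also have "\<dots> = (\<Sum>K\<in>subsets_of_size d (Suc p).
      (?s * (\<Sum>k\<in>K. (-1) ^ below K k * A i k * mnr A ?I (K - {k}))) * mnr X K C)"
    unfolding sum_distrib_left sum_distrib_right
    by (intro sum.cong refl) (simp only: mult_ac)
  \<comment> \<open>After regrouping by the enlarged set, the sum over the marked point is the
    expansion of a minor of A along row i.\<close>
  also have "\<dots> = (\<Sum>K\<in>subsets_of_size d (Suc p). mnr A I K * mnr X K C)"
  proof (intro sum.cong refl arg_cong2[of _ _ _ _ "(*)"])
    fix K assume "K \<in> subsets_of_size d (Suc p)"
    then have "finite K" "card K = card I" using Suc.prems
      by (auto dest: subsets_of_size_finite subsets_of_size_card)
    then show "?s * (\<Sum>k\<in>K. (-1) ^ below K k * A i k * mnr A ?I (K - {k})) = mnr A I K"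
      using mnr_row_expand[OF Suc.prems(1) _ _ i, of K A] by simp
  qed
  finally show ?case .
qed

section \<open>The sl2 of index moves and its interplay with products of two minors\<close>

section \<open>Moving one index between two sets\<close>

lemma below_insert: "finite I \<Longrightarrow> i \<notin> I \<Longrightarrow> below (insert i I) j = below I j + (if i < j then 1 else 0)"
proof -
  assume a: "finite I" "i \<notin> I"
  have "{x \<in> insert i I. x < j} = (if i < j then insert i {x \<in> I. x < j} else {x \<in> I. x < j})" by auto
  then show ?thesis using a by (simp add: below_def)
qed

lemma above_Diff: "above (S - {j}) j = above S j"
  unfolding above_def by (rule arg_cong[of _ _ card]) auto

lemma below_add_above: "finite I \<Longrightarrow> j \<notin> I \<Longrightarrow> below I j + above I j = card I"
proof -
  assume a: "finite I" "j \<notin> I"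
  have "x < j \<or> j < x" if "x \<in> I" for x using that a(2) by (cases x j rule: linorder_cases) auto
  then have "I = {x \<in> I. x < j} \<union> {x \<in> I. j < x}" by blast
  then have "card I = card ({x \<in> I. x < j} \<union> {x \<in> I. j < x})" by (rule arg_cong[of _ _ card])
  also have "\<dots> = below I j + above I j"
    unfolding below_def above_def using a by (intro card_Un_disjoint) auto
  finally show ?thesis by simp
qed

lemma minus_one_power_parity: "even m = even n \<Longrightarrow> (-1) ^ m = ((-1) ^ n :: 'r::comm_ring_1)"
  by (simp add: minus_one_power_iff)

lemma below_Un: "finite A \<Longrightarrow> finite B \<Longrightarrow> A \<inter> B = {} \<Longrightarrow> below (A \<union> B) j = below A j + below B j"
  unfolding below_def by (subst card_Un_disjoint[symmetric]) (auto intro!: arg_cong[of _ _ card])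

lemma above_Un: "finite A \<Longrightarrow> finite B \<Longrightarrow> A \<inter> B = {} \<Longrightarrow> above (A \<union> B) j = above A j + above B j"
  unfolding above_def by (subst card_Un_disjoint[symmetric]) (auto intro!: arg_cong[of _ _ card])

text \<open>\<open>Uop\<close> and \<open>Dop\<close> are the raising and lowering operators of the \<open>sl\<^sub>2\<close> that acts on
  \<open>\<Lambda>V \<otimes> \<Lambda>V = \<Lambda>(V \<otimes> k\<^sup>2)\<close>, written on coefficient functions; the sign is that of appending \<open>j\<close> to
  the increasing list \<open>I\<close> and of taking it out of the front of the increasing list \<open>J\<close>.\<close>

definition msign :: "nat set \<Rightarrow> nat set \<Rightarrow> nat \<Rightarrow> 'r::comm_ring_1" where
  "msign I J j = (-1) ^ (above I j + below J j)"

definition Uop :: "(nat set \<Rightarrow> nat set \<Rightarrow> 'r::comm_ring_1) \<Rightarrow> nat set \<Rightarrow> nat set \<Rightarrow> 'r" where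
  "Uop z I J = (\<Sum>j\<in>J - I. msign I J j * z (insert j I) (J - {j}))"

definition Dop :: "(nat set \<Rightarrow> nat set \<Rightarrow> 'r::comm_ring_1) \<Rightarrow> nat set \<Rightarrow> nat set \<Rightarrow> 'r" where
  "Dop z I J = (\<Sum>i\<in>I - J. msign I J i * z (I - {i}) (insert i J))"

definition pairing :: "nat \<Rightarrow> (nat set \<Rightarrow> nat set \<Rightarrow> 'r::comm_ring_1) \<Rightarrow> (nat set \<Rightarrow> nat set \<Rightarrow> 'r) \<Rightarrow> 'r" where
  "pairing d z y = (\<Sum>I\<in>Pow {..<d}. \<Sum>J\<in>Pow {..<d}. z I J * y I J)"

lemma pairing_cong:
  assumes "\<And>I J. finite I \<Longrightarrow> finite J \<Longrightarrow> z I J = z' I J"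
    and "\<And>I J. finite I \<Longrightarrow> finite J \<Longrightarrow> y I J = y' I J"
  shows "pairing d z y = pairing d z' y'"
  unfolding pairing_def
proof (intro sum.cong refl)
  fix I J assume "I \<in> Pow {..<d}" "J \<in> Pow {..<d}"
  then have "finite I" "finite J" by (auto intro: finite_subset[OF _ finite_lessThan])
  then show "z I J * y I J = z' I J * y' I J" by (simp add: assms)
qed

lemma pairing_commute: "pairing d z y = pairing d y z"
  by (simp add: pairing_def mult.commute)

lemma pairing_scale_left: "pairing d (\<lambda>I J. c * z I J) y = c * pairing d z y"
  by (simp add: pairing_def sum_distrib_left mult.assoc)

lemma pairing_scale_right: "pairing d z (\<lambda>I J. c * y I J) = c * pairing d z y"
  by (simp add: pairing_def sum_distrib_left mult.left_commute)

text \<open>Neither \<open>above\<close> nor \<open>below\<close> counts j itself, so the sign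
  agrees before and after the move. This makes the matrices of \<open>Uop\<close> and
  \<open>Dop\<close> transposes of each other.\<close>

lemma msign_move: "msign (I - {j}) (insert j J) j = msign I J j"
proof -
  have "below (insert j J) j = below J j"
    unfolding below_def by (rule arg_cong[of _ _ card]) auto
  then show ?thesis by (simp add: msign_def above_Diff)
qed

text \<open>The triples (I, J, j) on the two sides correspond under moving j from J to I and back,
  and the signs agree by \<open>msign_move\<close>.\<close>

lemma pairing_Uop: "pairing d (Uop z) y = pairing d z (Dop y)"
proof -
  let ?P = "Pow {..<d} \<times> Pow {..<d}"
  have fin: "finite (J - I)" if "(I, J) \<in> ?P" for I J using that finite_subset by blast
  have "pairing d (Uop z) y
      = (\<Sum>(I, J)\<in>?P. \<Sum>j\<in>J - I. msign I J j * z (insert j I) (J - {j}) * y I J)"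
    by (simp add: pairing_def Uop_def sum_distrib_right sum.cartesian_product)
  also have "\<dots> = (\<Sum>(p, j)\<in>(SIGMA p:?P. snd p - fst p).
      msign (fst p) (snd p) j * z (insert j (fst p)) (snd p - {j}) * y (fst p) (snd p))"
    by (subst sum.Sigma[symmetric]) (auto simp: case_prod_unfold dest: finite_subset)
  also have "\<dots> = (\<Sum>(p, i)\<in>(SIGMA p:?P. fst p - snd p).
      z (fst p) (snd p) * (msign (fst p) (snd p) i * y (fst p - {i}) (insert i (snd p))))"
    by (rule sum.reindex_bij_witness[of _ "\<lambda>((I, J), i). ((I - {i}, insert i J), i)"
          "\<lambda>((I, J), i). ((insert i I, J - {i}), i)"])
       (auto simp: insert_absorb, auto simp: msign_move[of "insert _ _", symmetric] insert_absorb
         Diff_insert_absorb mult_ac)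
  also have "\<dots> = (\<Sum>(I, J)\<in>?P. \<Sum>i\<in>I - J. z I J * (msign I J i * y (I - {i}) (insert i J)))"
    by (subst sum.Sigma[symmetric]) (auto simp: case_prod_unfold dest: finite_subset)
  also have "\<dots> = pairing d z (Dop y)"
    by (simp add: pairing_def Dop_def sum_distrib_left sum.cartesian_product)
  finally show ?thesis .
qed

text \<open>Skew duality between row and column indices: raising in the rows equals lowering in the
  columns. Both sides are the same double sum over a row j of J and a column c of C, obtained by
  expanding the enlarged minor of the first factor along the row j, respectively that of the second
  factor along the column c.\<close>

lemma Uop_mnr_mnr:
  fixes M :: "nat \<Rightarrow> nat \<Rightarrow> 'r::comm_ring_1"
  assumes "finite I" "finite J" "finite C" "finite D"
  shows "Uop (\<lambda>I J. mnr M I C * mnr M J D) I J = Dop (\<lambda>C D. mnr M I C * mnr M J D) C D"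
proof (cases "card C = Suc (card I) \<and> card J = Suc (card D)")
  case True
  \<comment> \<open>The common summand. The exponent \<open>card I\<close> is shared by both
    expansions and turns \<open>below I j\<close> into \<open>above I j\<close>, as
    \<open>msign\<close> requires.\<close>
  let ?f = "\<lambda>j c. (-1) ^ (card I + below J j + below C c) * M j c * mnr M I (C - {c}) * mnr M (J - {j}) D"
  have "Uop (\<lambda>I J. mnr M I C * mnr M J D) I J = (\<Sum>j\<in>J. \<Sum>c\<in>C. ?f j c)"
    unfolding Uop_def
  proof (rule sum.mono_neutral_cong_left)
    \<comment> \<open>The indices j in both I and J are added for free: they produce a repeated
      row.\<close>
    show "\<forall>j\<in>J - (J - I). (\<Sum>c\<in>C. ?f j c) = 0"
    proof
      fix j assume j: "j \<in> J - (J - I)"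
      have "(\<Sum>c\<in>C. ?f j c) = (\<Sum>c\<in>C. (-1) ^ below C c * M j c * mnr M I (C - {c}))
          * ((-1) ^ (card I + below J j) * mnr M (J - {j}) D)"
        unfolding sum_distrib_right by (intro sum.cong refl) (simp add: power_add mult_ac)
      then show "(\<Sum>c\<in>C. ?f j c) = 0"
        using row_expansion[of I C M j] True assms j by simp
    qed
    fix j assume j: "j \<in> J - I"
    have "(\<Sum>c\<in>C. ?f j c) = (\<Sum>c\<in>C. (-1) ^ below C c * M j c * mnr M I (C - {c}))
        * ((-1) ^ (card I + below J j) * mnr M (J - {j}) D)"
      unfolding sum_distrib_right by (intro sum.cong refl) (simp add: power_add mult_ac)
    also have "\<dots> = (-1) ^ (below I j + card I + below J j) * (mnr M (insert j I) C * mnr M (J - {j}) D)"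
      using row_expansion[of I C M j] True assms j by (simp add: power_add mult_ac)
    also have "(-1) ^ (below I j + card I + below J j) = (msign I J j :: 'r)"
    proof -
      have "card I = below I j + above I j" using below_add_above[OF assms(1), of j] j by simp
      then show ?thesis unfolding msign_def by (intro minus_one_power_parity) presburger
    qed
    finally show "msign I J j * (mnr M (insert j I) C * mnr M (J - {j}) D) = (\<Sum>c\<in>C. ?f j c)" by simp
  qed (use assms in auto)
  also have "\<dots> = (\<Sum>c\<in>C. \<Sum>j\<in>J. ?f j c)" by (rule sum.swap)
  also have "\<dots> = Dop (\<lambda>C D. mnr M I C * mnr M J D) C D"
    unfolding Dop_def
  proof (rule sum.mono_neutral_cong_right)
    show "\<forall>c\<in>C - (C - D). (\<Sum>j\<in>J. ?f j c) = 0"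
    proof
      fix c assume c: "c \<in> C - (C - D)"
      have "(\<Sum>j\<in>J. ?f j c) = (\<Sum>j\<in>J. (-1) ^ below J j * M j c * mnr M (J - {j}) D)
          * ((-1) ^ (card I + below C c) * mnr M I (C - {c}))"
        unfolding sum_distrib_right by (intro sum.cong refl) (simp add: power_add mult_ac)
      then show "(\<Sum>j\<in>J. ?f j c) = 0"
        using column_expansion[of J D M c] True assms c by simp
    qed
    fix c assume c: "c \<in> C - D"
    have "(\<Sum>j\<in>J. ?f j c) = (\<Sum>j\<in>J. (-1) ^ below J j * M j c * mnr M (J - {j}) D)
        * ((-1) ^ (card I + below C c) * mnr M I (C - {c}))"
      unfolding sum_distrib_right by (intro sum.cong refl) (simp add: power_add mult_ac)
    also have "\<dots> = (-1) ^ (below D c + card I + below C c) * (mnr M I (C - {c}) * mnr M J (insert c D))"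
      using column_expansion[of J D M c] True assms c by (simp add: power_add mult_ac)
    also have "(-1) ^ (below D c + card I + below C c) = (msign C D c :: 'r)"
    proof -
      have "card (C - {c}) = card I" using c True assms by simp
      then have "card I = below C c + above C c"
        using below_add_above[of "C - {c}" c] assms by (simp add: below_Diff above_Diff)
      then show ?thesis unfolding msign_def by (intro minus_one_power_parity) presburger
    qed
    finally show "(\<Sum>j\<in>J. ?f j c) = msign C D c * (mnr M I (C - {c}) * mnr M J (insert c D))" by simp
  qed (use assms in auto)
  finally show ?thesis .
next
  \<comment> \<open>For all other sizes every term on either side contains a nonsquare
    minor.\<close>
  case False
  have "mnr M (insert j I) C * mnr M (J - {j}) D = 0" if "j \<in> J - I" for j
  proof -
    have "card (insert j I) = Suc (card I)" "card J = Suc (card (J - {j}))"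
      using that assms by (auto simp: card.remove simp del: card_Diff_insert)
    with False have "card (insert j I) \<noteq> card C \<or> card (J - {j}) \<noteq> card D" by auto
    then show ?thesis by (auto simp: mnr_nonsquare simp del: card_Diff_insert)
  qed
  moreover have "mnr M I (C - {c}) * mnr M J (insert c D) = 0" if "c \<in> C - D" for c
  proof -
    have "card (insert c D) = Suc (card D)" "card C = Suc (card (C - {c}))"
      using that assms by (auto simp: card.remove simp del: card_Diff_insert)
    with False have "card I \<noteq> card (C - {c}) \<or> card J \<noteq> card (insert c D)" by auto
    then show ?thesis by (auto simp: mnr_nonsquare simp del: card_Diff_insert)
  qed
  ultimately show ?thesis by (simp add: Uop_def Dop_def)
qed

lemma Dop_mnr_mnr:
  fixes M :: "nat \<Rightarrow> nat \<Rightarrow> 'r::comm_ring_1"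
  assumes "finite I" "finite J" "finite C" "finite D"
  shows "Dop (\<lambda>I J. mnr M I C * mnr M J D) I J = Uop (\<lambda>C D. mnr M I C * mnr M J D) C D"
  using Uop_mnr_mnr[OF assms(3,4,1,2), of "\<lambda>i j. M j i"]
  by (simp add: mnr_transpose[of "\<lambda>i j. M i j"])

text \<open>A coefficient function on pairs of column sets is turned into one on pairs of row sets.
  For p = t and generic entries it is the projection of the second exterior tensor power to a Schur
  module.\<close>

definition bi_minor :: "(nat \<Rightarrow> nat \<Rightarrow> 'r::comm_ring_1) \<Rightarrow> nat \<Rightarrow> (nat set \<Rightarrow> nat set \<Rightarrow> 'r) \<Rightarrow>
    nat set \<Rightarrow> nat set \<Rightarrow> 'r" where
  "bi_minor M d z I J = pairing d z (\<lambda>C D. mnr M I C * mnr M J D)"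

text \<open>\<open>Uop\<close> in the rows is \<open>Dop\<close> in the columns by
  \<open>Uop_mnr_mnr\<close>, and passing it across the pairing turns it into \<open>Uop\<close> on
  \<open>z\<close>. Hence \<open>bi_minor\<close> commutes with the sl2-action.\<close>

lemma Uop_bi_minor:
  assumes "finite I" "finite J"
  shows "Uop (bi_minor M d z) I J = bi_minor M d (Uop z) I J"
proof -
  have "Uop (bi_minor M d z) I J
     = (\<Sum>j\<in>J - I. \<Sum>C\<in>Pow {..<d}. \<Sum>D\<in>Pow {..<d}. z C D * (msign I J j *
         (mnr M (insert j I) C * mnr M (J - {j}) D)))"
    unfolding Uop_def bi_minor_def pairing_def sum_distrib_left
    by (simp only: mult_ac)
  also have "\<dots> = pairing d z (\<lambda>C D. Uop (\<lambda>I J. mnr M I C * mnr M J D) I J)"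
    unfolding pairing_def Uop_def sum_distrib_left
    by (subst sum.swap, rule sum.cong[OF refl], rule sum.swap)
  also have "\<dots> = pairing d z (Dop (\<lambda>C D. mnr M I C * mnr M J D))"
    by (rule pairing_cong) (use assms Uop_mnr_mnr in auto)
  finally show ?thesis by (simp add: bi_minor_def pairing_Uop)
qed

lemma Dop_bi_minor:
  assumes "finite I" "finite J"
  shows "Dop (bi_minor M d z) I J = bi_minor M d (Dop z) I J"
proof -
  have "Dop (bi_minor M d z) I J
     = (\<Sum>j\<in>I - J. \<Sum>C\<in>Pow {..<d}. \<Sum>D\<in>Pow {..<d}. z C D * (msign I J j *
         (mnr M (I - {j}) C * mnr M (insert j J) D)))"
    unfolding Dop_def bi_minor_def pairing_def sum_distrib_left
    by (simp only: mult_ac)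
  also have "\<dots> = pairing d z (\<lambda>C D. Dop (\<lambda>I J. mnr M I C * mnr M J D) I J)"
    unfolding pairing_def Dop_def sum_distrib_left
    by (subst sum.swap, rule sum.cong[OF refl], rule sum.swap)
  also have "\<dots> = pairing d z (Uop (\<lambda>C D. mnr M I C * mnr M J D))"
    by (rule pairing_cong) (use assms Dop_mnr_mnr in auto)
  also have "\<dots> = pairing d (Dop z) (\<lambda>C D. mnr M I C * mnr M J D)"
    by (metis pairing_Uop pairing_commute)
  finally show ?thesis by (simp add: bi_minor_def)
qed

lemma bi_minor_cong:
  "(\<And>C D. finite C \<Longrightarrow> finite D \<Longrightarrow> z C D = z' C D) \<Longrightarrow> bi_minor M d z I J = bi_minor M d z' I J"
  unfolding bi_minor_def by (rule pairing_cong) auto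

lemma bi_minor_scale: "bi_minor M d (\<lambda>C D. c * z C D) I J = c * bi_minor M d z I J"
  by (simp add: bi_minor_def pairing_scale_left)


section \<open>Strings of coefficient functions, their signs and their structure constants\<close>

section \<open>The vectors of highest weight\<close>

text \<open>For disjoint sets this is the number of inversions of the increasing list of A followed
  by that of B.\<close>

definition inv_count :: "nat set \<Rightarrow> nat set \<Rightarrow> nat" where
  "inv_count A B = (\<Sum>x\<in>A. below B x)"

text \<open>In A the point j creates \<open>below B j\<close> inversions; leaving B it destroys one
  for each element of A above it.\<close>

lemma inv_count_move:
  assumes "finite A" "finite B" "j \<in> B" "j \<notin> A"
  shows "inv_count (insert j A) (B - {j}) + above A j = inv_count A B + below B j"
proof -
  have b: "below B x = below (B - {j}) x + (if j < x then 1 else 0)" for x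
    using below_insert[of "B - {j}" j x] assms by (simp add: insert_absorb)
  have "inv_count A B = inv_count A (B - {j}) + (\<Sum>x\<in>A. if j < x then 1 else 0)"
    by (simp add: inv_count_def b sum.distrib)
  also have "(\<Sum>x\<in>A. if j < x then 1 else 0) = above A j"
    unfolding above_def using assms by (simp add: sum.If_cases Int_def)
  finally show ?thesis using assms by (simp add: inv_count_def below_Diff)
qed

text \<open>Each pair with one element in A and one in B is an inversion in exactly one of the two
  orders.\<close>

lemma inv_count_commute:
  assumes "finite A" "finite B" "A \<inter> B = {}"
  shows "inv_count A B + inv_count B A = card A * card B"
proof -
  have 1: "inv_count A B = (\<Sum>x\<in>A. \<Sum>y\<in>B. if y < x then 1 else 0)" if "finite B" for A B
    unfolding inv_count_def below_def using that by (simp add: sum.If_cases Int_def)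
  have "inv_count A B + inv_count B A = (\<Sum>x\<in>A. \<Sum>y\<in>B. (if y < x then 1 else 0) + (if x < y then 1 else 0))"
    unfolding 1[OF assms(1)] 1[OF assms(2)] by (subst (2) sum.swap) (simp add: sum.distrib)
  also have "\<dots> = (\<Sum>x\<in>A. \<Sum>y\<in>B. 1)"
    using assms by (intro sum.cong refl) auto
  finally show ?thesis by simp
qed

text \<open>For \<open>a = t - u\<close>, \<open>b = t + u\<close> and \<open>p = t\<close> this is one tensor factor of \<open>f_vec\<close>. The other values
  of \<open>p\<close> are the images of \<open>p = t\<close> under the two operators above.\<close>

definition hvec :: "nat \<Rightarrow> nat \<Rightarrow> nat \<Rightarrow> nat set \<Rightarrow> nat set \<Rightarrow> 'r::comm_ring_1" where
  "hvec a b p I J = (if card I = p \<and> I \<inter> J = {..<a} \<and> I \<union> J = {..<b}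
     then (-1) ^ inv_count (I - J) (J - I) else 0)"

lemma hvec_sign_move:
  assumes "I \<inter> J = {..<a}" "I \<union> J = {..<b}" "j \<in> J - I"
  shows "msign I J j * (-1) ^ inv_count (insert j I - (J - {j})) (J - {j} - insert j I)
    = (-1) ^ a * ((-1) ^ inv_count (I - J) (J - I) :: 'r::comm_ring_1)"
proof -
  let ?A = "I - J" and ?B = "J - I"
  have fin: "finite I" "finite J" using assms(2) by (metis finite_Un finite_lessThan)+
  have ja: "a \<le> j" using assms by (metis DiffD1 DiffD2 IntD1 lessThan_iff not_le)
  have eq: "insert j I - (J - {j}) = insert j ?A" "J - {j} - insert j I = ?B - {j}"
    using assms by auto
  have "{x \<in> {..<a}. j < x} = {}" "{x \<in> {..<a}. x < j} = {..<a}" using ja by auto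
  then have 0: "above {..<a} j = 0" "below {..<a} j = a" by (simp_all add: above_def below_def)
  have "above I j = above (?A \<union> {..<a}) j"
    by (rule arg_cong[of _ _ "\<lambda>S. above S j"]) (use assms in auto)
  also have "\<dots> = above ?A j" by (subst above_Un) (use fin assms 0 in auto)
  finally have ab: "above I j = above ?A j" .
  have "below J j = below (?B \<union> {..<a}) j"
    by (rule arg_cong[of _ _ "\<lambda>S. below S j"]) (use assms in auto)
  also have "\<dots> = below ?B j + a" by (subst below_Un) (use fin assms 0 in auto)
  finally have be: "below J j = below ?B j + a" .
  have "inv_count (insert j ?A) (?B - {j}) + above ?A j = inv_count ?A ?B + below ?B j"
    using fin assms by (intro inv_count_move) auto
  then have "even (above I j + below J j + inv_count (insert j ?A) (?B - {j})) = even (a + inv_count ?A ?B)"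
    unfolding ab be by presburger
  then show ?thesis
    unfolding msign_def eq power_add[symmetric] by (rule minus_one_power_parity)
qed

text \<open>The factor b - p is the size of J - I. The operator acts on coefficient functions, so it
  lowers p by one; the factor is a nonzero integer as long as p < b.\<close>

lemma Uop_hvec:
  assumes fin: "finite I" "finite J"
  shows "Uop (hvec a b (Suc p)) I J = (-1) ^ a * of_nat (b - p) * (hvec a b p I J :: 'r::comm_ring_1)"
proof -
  have iff: "(insert j I \<inter> (J - {j}) = {..<a} \<and> insert j I \<union> (J - {j}) = {..<b}) \<longleftrightarrow>
     (I \<inter> J = {..<a} \<and> I \<union> J = {..<b})" if "j \<in> J - I" for j
  proof -
    have "insert j I \<inter> (J - {j}) = I \<inter> J" "insert j I \<union> (J - {j}) = I \<union> J" using that by auto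
    then show ?thesis by simp
  qed
  have card: "card (insert j I) = Suc (card I)" if "j \<in> J - I" for j using that fin by simp
  show ?thesis
  proof (cases "card I = p \<and> I \<inter> J = {..<a} \<and> I \<union> J = {..<b}")
    case True
    have "Uop (hvec a b (Suc p)) I J
       = (\<Sum>j\<in>J - I. (-1) ^ a * (-1) ^ inv_count (I - J) (J - I) :: 'r)"
      unfolding Uop_def
    proof (rule sum.cong[OF refl])
      fix j assume j: "j \<in> J - I"
      have "hvec a b (Suc p) (insert j I) (J - {j})
          = ((-1) ^ inv_count (insert j I - (J - {j})) (J - {j} - insert j I) :: 'r)"
        using iff[OF j] card[OF j] True unfolding hvec_def by simp
      then show "msign I J j * hvec a b (Suc p) (insert j I) (J - {j})
          = ((-1) ^ a * (-1) ^ inv_count (I - J) (J - I) :: 'r)"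
        using hvec_sign_move[of I J a b j] True j by simp
    qed
    moreover have "card (J - I) = b - p"
    proof -
      have "card (I \<union> (J - I)) = card I + card (J - I)" using fin by (subst card_Un_disjoint) auto
      then show ?thesis using True by simp
    qed
    ultimately show ?thesis using True by (simp add: hvec_def mult_ac)
  next
    case False
    have "hvec a b (Suc p) (insert j I) (J - {j}) = (0::'r)" if "j \<in> J - I" for j
      using iff[OF that] card[OF that] False unfolding hvec_def by (simp only: if_False) auto
    then have "Uop (hvec a b (Suc p)) I J = (0::'r)" by (simp add: Uop_def)
    moreover have "hvec a b p I J = (0::'r)" using False by (simp only: hvec_def if_False)
    ultimately show ?thesis by simp
  qed
qed

text \<open>The converse move along the string; here the factor is the size of I - J, which is
  positive for a \<le> p.\<close>

lemma Dop_hvec: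
  assumes fin: "finite I" "finite J"
  shows "Dop (hvec a b p) I J = (-1) ^ a * of_nat (Suc p - a) * (hvec a b (Suc p) I J :: 'r::comm_ring_1)"
proof -
  have iff: "((I - {i}) \<inter> insert i J = {..<a} \<and> (I - {i}) \<union> insert i J = {..<b}) \<longleftrightarrow>
     (I \<inter> J = {..<a} \<and> I \<union> J = {..<b})" if "i \<in> I - J" for i
  proof -
    have "(I - {i}) \<inter> insert i J = I \<inter> J" "(I - {i}) \<union> insert i J = I \<union> J" using that by auto
    then show ?thesis by simp
  qed
  have card: "card I = Suc (card (I - {i}))" if "i \<in> I - J" for i
    using that fin by (auto simp: card.remove simp del: card_Diff_insert)
  show ?thesis
  proof (cases "card I = Suc p \<and> I \<inter> J = {..<a} \<and> I \<union> J = {..<b}")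
    case True
    have "Dop (hvec a b p) I J
       = (\<Sum>j\<in>I - J. (-1) ^ a * (-1) ^ inv_count (I - J) (J - I) :: 'r)"
      unfolding Dop_def
    proof (rule sum.cong[OF refl])
      fix i assume i: "i \<in> I - J"
      have h: "hvec a b p (I - {i}) (insert i J)
          = ((-1) ^ inv_count (I - {i} - insert i J) (insert i J - (I - {i})) :: 'r)"
        using iff[OF i] card[OF i] True unfolding hvec_def by simp
      have "(-1) ^ a * ((-1) ^ inv_count (I - {i} - insert i J) (insert i J - (I - {i})) :: 'r)
          = msign (I - {i}) (insert i J) i * (-1) ^ inv_count (I - J) (J - I)"
      proof -
        have e: "insert i (I - {i}) = I" "insert i J - {i} = J" using i by auto
        have "(I - {i}) \<inter> insert i J = {..<a}" "(I - {i}) \<union> insert i J = {..<b}"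
          "i \<in> insert i J - (I - {i})" using iff[OF i] True by auto
        from hvec_sign_move[OF this] show ?thesis unfolding e by (rule sym)
      qed
      then have "(-1) ^ a * ((-1) ^ inv_count (I - {i} - insert i J) (insert i J - (I - {i})) :: 'r)
          = msign I J i * (-1) ^ inv_count (I - J) (J - I)" by (simp only: msign_move)
      then show "msign I J i * hvec a b p (I - {i}) (insert i J)
          = ((-1) ^ a * (-1) ^ inv_count (I - J) (J - I) :: 'r)"
        unfolding h msign_def by (auto simp: minus_one_power_iff split: if_splits)
    qed
    moreover have "card (I - J) = Suc p - a"
      using True fin by (simp add: card_Diff_subset_Int)
    ultimately show ?thesis using True by (simp add: hvec_def mult_ac)
  next
    case False
    have "hvec a b p (I - {i}) (insert i J) = (0::'r)" if "i \<in> I - J" for i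
      using iff[OF that] card[OF that] False unfolding hvec_def by (simp only: if_False) auto
    then have "Dop (hvec a b p) I J = (0::'r)" by (simp add: Dop_def)
    moreover have "hvec a b (Suc p) I J = (0::'r)" using False by (simp only: hvec_def if_False)
    ultimately show ?thesis by simp
  qed
qed

lemma hvec_top: "a \<le> b \<Longrightarrow> hvec a b b I J = (if I = {..<b} \<and> J = {..<a} then 1 else 0)"
proof -
  assume ab: "a \<le> b"
  have "I = {..<b} \<and> J = {..<a}" if "card I = b" "I \<inter> J = {..<a}" "I \<union> J = {..<b}"
  proof -
    have "I = {..<b}" using that by (intro card_subset_eq) auto
    then show ?thesis using that ab by auto
  qed
  moreover have "{..<b} \<inter> {..<a} = {..<a}" "{..<b} \<union> {..<a} = {..<b}" "{..<a} - {..<b} = {}"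
    using ab by auto
  ultimately show ?thesis by (auto simp: hvec_def inv_count_def below_def)
qed

lemma hvec_beyond: "b < p \<Longrightarrow> hvec a b p I J = 0"
proof -
  assume "b < p"
  have "card I \<le> b" if "I \<union> J = {..<b}"
  proof -
    have "I \<subseteq> {..<b}" using that by blast
    then show ?thesis using card_mono[of "{..<b}" I] by simp
  qed
  with \<open>b < p\<close> have "\<not> (card I = p \<and> I \<union> J = {..<b})" by linarith
  then show ?thesis unfolding hvec_def by argo
qed

text \<open>I - J and J - I both have u elements, so the two inversion numbers add up to u * u,
  which has the parity of u. This is where the condition that u + v be even originates.\<close>

lemma hvec_swap:
  assumes "a = t - u" "b = t + u" "u \<le> t"
  shows "hvec a b t J I = (-1) ^ u * (hvec a b t I J :: 'r::comm_ring_1)"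
proof (cases "I \<inter> J = {..<a} \<and> I \<union> J = {..<b}")
  case True
  then have fin: "finite I" "finite J" by (metis finite_Un finite_lessThan)+
  have sum: "card I + card J = 2 * t" using card_Un_Int[of I J] fin True assms by simp
  show ?thesis
  proof (cases "card I = t")
    case True': True
    have c: "card (I - J) = u" "card (J - I) = u" using True True' sum fin assms
      by (simp_all add: card_Diff_subset_Int Int_commute)
    have "inv_count (I - J) (J - I) + inv_count (J - I) (I - J) = u * u"
      using inv_count_commute[of "I - J" "J - I"] fin c by auto
    then have "even (inv_count (J - I) (I - J)) = even (u + inv_count (I - J) (J - I))"
      by (metis even_add even_mult_iff)
    then show ?thesis using True True' sum
      by (auto simp: hvec_def Int_commute Un_commute minus_one_power_iff)
  qed (use sum in \<open>auto simp: hvec_def\<close>)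
qed (auto simp: hvec_def Int_commute Un_commute)

text \<open>At the end p = b of the string only one pair of column sets is left, and the result is a
  product of two initial minors, that is, of two rows of the Schur map.\<close>

lemma bi_minor_hvec_top:
  assumes "a \<le> b" "b \<le> d"
  shows "bi_minor M d (hvec a b b) I J = mnr M I {..<b} * mnr M J {..<a}"
proof -
  have sub: "{..<b} \<in> Pow {..<d}" "{..<a} \<in> Pow {..<d}" using assms by auto
  have "bi_minor M d (hvec a b b) I J = (\<Sum>C\<in>Pow {..<d}. if C = {..<b} then \<Sum>D\<in>Pow {..<d}.
      if D = {..<a} then mnr M I C * mnr M J D else 0 else 0)"
    unfolding bi_minor_def pairing_def hvec_top[OF assms(1)]
    by (rule sum.cong[OF refl]) (auto intro!: sum.cong simp del: sum.delta sum.delta')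
  also have "\<dots> = (\<Sum>D\<in>Pow {..<d}. if D = {..<a} then mnr M I {..<b} * mnr M J D else 0)"
    by (subst sum.delta[where a = "{..<b}"]) (use sub in auto)
  also have "\<dots> = mnr M I {..<b} * mnr M J {..<a}"
    by (subst sum.delta[where a = "{..<a}"]) (use sub in auto)
  finally show ?thesis .
qed

lemma bi_minor_hvec_swap:
  assumes "a = t - u" "b = t + u" "u \<le> t"
  shows "bi_minor M d (hvec a b t) J I = (-1) ^ u * bi_minor M d (hvec a b t) I J"
proof -
  have "bi_minor M d (hvec a b t) J I
      = (\<Sum>C\<in>Pow {..<d}. \<Sum>D\<in>Pow {..<d}. hvec a b t D C * (mnr M J D * mnr M I C))"
    unfolding bi_minor_def pairing_def by (rule sum.swap)
  also have "\<dots> = (\<Sum>C\<in>Pow {..<d}. \<Sum>D\<in>Pow {..<d}. (-1) ^ u * (hvec a b t C D * (mnr M I C * mnr M J D)))"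
    by (intro sum.cong refl, subst hvec_swap[OF assms]) (simp only: mult_ac)
  finally show ?thesis by (simp only: bi_minor_def pairing_def sum_distrib_left)
qed

lemma Uop_bi_minor_hvec:
  assumes "finite I" "finite J"
  shows "Uop (bi_minor M d (hvec a b (Suc p))) I J
    = (-1) ^ a * of_nat (b - p) * bi_minor M d (hvec a b p) I J"
proof -
  have "bi_minor M d (Uop (hvec a b (Suc p))) I J
     = bi_minor M d (\<lambda>C D. ((-1) ^ a * of_nat (b - p)) * hvec a b p C D) I J"
    by (rule bi_minor_cong) (simp add: Uop_hvec)
  then show ?thesis by (simp add: Uop_bi_minor assms bi_minor_scale)
qed

lemma Dop_bi_minor_hvec:
  assumes "finite I" "finite J"
  shows "Dop (bi_minor M d (hvec a b p)) I J
    = (-1) ^ a * of_nat (Suc p - a) * bi_minor M d (hvec a b (Suc p)) I J"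
proof -
  have "bi_minor M d (Dop (hvec a b p)) I J
     = bi_minor M d (\<lambda>C D. ((-1) ^ a * of_nat (Suc p - a)) * hvec a b (Suc p) C D) I J"
    by (rule bi_minor_cong) (simp add: Dop_hvec)
  then show ?thesis by (simp add: Dop_bi_minor assms bi_minor_scale)
qed

section \<open>The raising equations determine a weight vector up to a scalar\<close>

lemma downward_closed_nat:
  assumes "finite S" "\<And>i. Suc i \<in> S \<Longrightarrow> i \<in> S"
  shows "S = {..<card S}"
proof -
  have "x \<in> S" if "y \<in> S" "x \<le> y" for x y
    using that(2,1) by (induction rule: inc_induct) (auto intro: assms(2))
  then have "\<exists>k. S = {..<k}"
  proof (cases "S = {}")
    case False
    have "S = {..<Suc (Max S)}"
    proof (intro equalityI subsetI)
      fix x assume "x \<in> {..<Suc (Max S)}"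
      then show "x \<in> S" using \<open>\<And>y x. y \<in> S \<Longrightarrow> x \<le> y \<Longrightarrow> x \<in> S\<close>[of "Max S" x] False assms(1) by simp
    next
      fix x assume "x \<in> S"
      then show "x \<in> {..<Suc (Max S)}" using Max_ge[OF assms(1)] by (simp add: less_Suc_eq_le)
    qed
    then show ?thesis by blast
  qed (auto intro: exI[of _ 0])
  then obtain k where k: "S = {..<k}" by blast
  show ?thesis unfolding k by simp
qed

text \<open>\<open>up i I\<close> is the set whose basis vector acquires a component at I under the
  elementary matrix with entry s in position (i, i+1).\<close>

definition up :: "nat \<Rightarrow> nat set \<Rightarrow> nat set" where "up i I = insert (Suc i) (I - {i})"
definition dn :: "nat \<Rightarrow> nat set \<Rightarrow> nat set" where "dn i I = insert i (I - {Suc i})"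

lemma dn_in_subsets_of_size:
  assumes "I \<in> subsets_of_size d t" "Suc i \<in> I" "i \<notin> I"
  shows "dn i I \<in> subsets_of_size d t"
proof -
  have "finite I" "I \<subseteq> {..<d}" "card I = t" using subsets_of_size_finite[OF assms(1)] assms(1)
    by (auto simp: subsets_of_size_def)
  moreover from this have "card (I - {Suc i}) = t - 1" "t > 0"
    using assms by (auto simp: card_gt_0_iff)
  moreover have "i < d" using assms(2) \<open>I \<subseteq> {..<d}\<close> by auto
  ultimately show ?thesis using assms by (auto simp: dn_def subsets_of_size_def)
qed

lemma up_dn: "Suc i \<in> I \<Longrightarrow> i \<notin> I \<Longrightarrow> up i (dn i I) = I"
  by (auto simp: up_def dn_def)

text \<open>Exchanging the neighbours i in B and i+1 in A removes the inversion between them and no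
  other.\<close>

lemma inv_count_swap:
  assumes "finite A" "finite B" "A \<inter> B = {}" "i \<in> B" "Suc i \<in> A"
  shows "inv_count A B = Suc (inv_count (dn i A) (up i B))"
proof -
  let ?A = "A - {Suc i}" and ?B = "B - {i}"
  have AB: "A = insert (Suc i) ?A" "B = insert i ?B" using assms by auto
  have n: "i \<notin> ?A" "Suc i \<notin> ?B" "finite ?A" "finite ?B" "i \<notin> ?B" "Suc i \<notin> ?A" using assms by auto
  have bB: "below B x = below ?B x + (if i < x then 1 else 0)" for x
    using below_insert[OF n(4,5), of x] AB(2) by simp
  have bB': "below (up i B) x = below ?B x + (if Suc i < x then 1 else 0)" for x
    unfolding up_def using below_insert[OF n(4,2), of x] by simp
  have b: "below ?B (Suc i) = below ?B i"
    unfolding below_def by (rule arg_cong[of _ _ card]) (auto simp: less_Suc_eq)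
  have "inv_count A B = below B (Suc i) + (\<Sum>x\<in>?A. below B x)"
    unfolding inv_count_def using assms by (intro sum.remove) auto
  also have "(\<Sum>x\<in>?A. below B x) = (\<Sum>x\<in>?A. below (up i B) x)"
  proof (rule sum.cong[OF refl])
    fix x assume "x \<in> ?A"
    then have "i < x \<longleftrightarrow> Suc i < x" using Suc_lessI by auto
    then show "below B x = below (up i B) x" by (simp only: bB bB')
  qed
  also have "below B (Suc i) = Suc (below (up i B) i)" by (simp add: bB bB' b)
  also have "below (up i B) i + (\<Sum>x\<in>?A. below (up i B) x) = inv_count (dn i A) (up i B)"
    unfolding dn_def inv_count_def using n by simp
  then have "Suc (below (up i B) i) + (\<Sum>x\<in>?A. below (up i B) x) = Suc (inv_count (dn i A) (up i B))"
    by simp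
  finally show ?thesis .
qed

text \<open>Each raising equation with both terms present expresses a coefficient as minus a
  coefficient with one inversion less. Induction on inversions leads to the unique pair without
  inversions, whose value is the scalar.\<close>

lemma hvec_unique:
  fixes z :: "nat set \<Rightarrow> nat set \<Rightarrow> 'k::field"
  assumes ab: "a \<le> t" "a + b = 2 * t" and bd: "b \<le> d"
    and supp: "\<And>I J. z I J \<noteq> 0 \<Longrightarrow> card I = t \<and> I \<inter> J = {..<a} \<and> I \<union> J = {..<b}"
    and raise: "\<And>i I J. Suc i < d \<Longrightarrow> I \<in> subsets_of_size d t \<Longrightarrow> J \<in> subsets_of_size d t \<Longrightarrow>
      (if i \<in> I \<and> Suc i \<notin> I then z (up i I) J else 0) + (if i \<in> J \<and> Suc i \<notin> J then z I (up i J) else 0) = 0"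
  shows "z I J = z {..<t} ({..<a} \<union> {t..<b}) * hvec a b t I J"
proof -
  have main: "z I J = (-1) ^ n * z {..<t} ({..<a} \<union> {t..<b})"
    if "card I = t" "I \<inter> J = {..<a}" "I \<union> J = {..<b}" "inv_count (I - J) (J - I) = n" for n I J
    using that
  proof (induction n arbitrary: I J rule: less_induct)
    case (less n)
    have fin: "finite I" "finite J" using less.prems(3) by (metis finite_Un finite_lessThan)+
    have cJ: "card J = t" using card_Un_Int[OF fin] less.prems ab by simp
    have bas: "I \<in> subsets_of_size d t" "J \<in> subsets_of_size d t"
    proof -
      have "I \<subseteq> {..<b}" "J \<subseteq> {..<b}" using less.prems(3) by blast+
      then show "I \<in> subsets_of_size d t" "J \<in> subsets_of_size d t"
        using less.prems(1) cJ bd by (auto simp: subsets_of_size_def)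
    qed
    show ?case
    proof (cases "\<exists>i. i \<in> J - I \<and> Suc i \<in> I - J")
      case True
      then obtain i where i: "i \<in> J - I" "Suc i \<in> I - J" by blast
      \<comment> \<open>The raising equation is taken at the pair (\<open>dn i I\<close>, J), where
        i can be raised in both sets.\<close>
      have "z (up i (dn i I)) J + z (dn i I) (up i J) = 0"
        using raise[of i "dn i I" J] dn_in_subsets_of_size[OF bas(1), of i] bas i
        by (auto simp: dn_def subsets_of_size_def)
      moreover have "up i (dn i I) = I" using i by (intro up_dn) auto
      ultimately have 1: "z I J = - z (dn i I) (up i J)" by (simp add: eq_neg_iff_add_eq_0)
      have d: "dn i I - up i J = dn i (I - J)" "up i J - dn i I = up i (J - I)"
        using i by (auto simp: dn_def up_def)
      have inv: "n = Suc (inv_count (dn i I - up i J) (up i J - dn i I))"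
        unfolding d less.prems(4)[symmetric] using fin i by (intro inv_count_swap) auto
      have c: "card (dn i I) = t" using dn_in_subsets_of_size[OF bas(1), of i] i
        by (auto simp: subsets_of_size_def)
      have "dn i I \<inter> up i J = I \<inter> J" "dn i I \<union> up i J = I \<union> J"
        using i by (auto simp: dn_def up_def)
      then have "z (dn i I) (up i J) = (-1) ^ (n - 1) * z {..<t} ({..<a} \<union> {t..<b})"
        using less.prems c inv by (intro less.IH) auto
      then show ?thesis using 1 inv by simp
    next
      case False
      \<comment> \<open>Without a neighbouring inversion I is an initial segment: a gap i below an
        element i+1 of I would have to be filled by J, and i+1 cannot be in J because the
        intersection is an initial segment.\<close>
      have "I = {..<card I}"
      proof (rule downward_closed_nat[OF fin(1)], rule ccontr)
        fix i assume i: "Suc i \<in> I" "i \<notin> I"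
        then have "Suc i < b" using less.prems(3) by blast
        then have "i \<in> J" using less.prems(3) i by (metis Suc_lessD UnE lessThan_iff)
        moreover have "Suc i \<notin> J"
        proof
          assume "Suc i \<in> J"
          then have "Suc i < a" using less.prems(2) i by blast
          then have "i \<in> I \<inter> J" unfolding less.prems(2) by simp
          then show False using i by simp
        qed
        ultimately show False using i False by blast
      qed
      then have I: "I = {..<t}" using less.prems by simp
      have J: "J = {..<a} \<union> {t..<b}"
      proof -
        have "J = (I \<inter> J) \<union> ((I \<union> J) - I)" by blast
        also have "\<dots> = {..<a} \<union> ({..<b} - I)" by (simp only: less.prems(2,3))
        also have "{..<b} - I = {t..<b}" unfolding I by auto
        finally show ?thesis .
      qed
      have "inv_count (I - J) (J - I) = 0"
        unfolding inv_count_def below_def I J using fin(2) J by (auto simp: card_eq_0_iff)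
      then show ?thesis using less.prems(4) I J by simp
    qed
  qed
  show ?thesis
  proof (cases "card I = t \<and> I \<inter> J = {..<a} \<and> I \<union> J = {..<b}")
    case True
    then show ?thesis using main[of I J] by (simp add: hvec_def)
  next
    case False
    then have "z I J = 0" using supp by blast
    moreover have "hvec a b t I J = (0::'k)" using False by (simp only: hvec_def if_False)
    ultimately show ?thesis by simp
  qed
qed

definition wt :: "nat set \<Rightarrow> nat set \<Rightarrow> nat \<Rightarrow> nat" where
  "wt I J i = of_bool (i \<in> I) + of_bool (i \<in> J)"

text \<open>The weight takes the value 2 exactly on the intersection and a positive value exactly on
  the union.\<close>

lemma wt_Int_Un:
  assumes "wt I J = wt I' J'"
  shows "I \<inter> J = I' \<inter> J'" "I \<union> J = I' \<union> J'"
proof -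
  have "wt I J i = wt I' J' i" for i using assms by simp
  then have *: "of_bool (i \<in> I) + of_bool (i \<in> J) = (of_bool (i \<in> I') + of_bool (i \<in> J') :: nat)" for i
    by (simp add: wt_def)
  have "i \<in> I \<inter> J \<longleftrightarrow> i \<in> I' \<inter> J'" "i \<in> I \<union> J \<longleftrightarrow> i \<in> I' \<union> J'" for i
    using *[of i] by (auto simp: of_bool_def split: if_splits)
  then show "I \<inter> J = I' \<inter> J'" "I \<union> J = I' \<union> J'" by blast+
qed

text \<open>The raising equations force intersection and union to be initial segments, of sizes t -
  u and t + u for a common u because both sets have t elements. Then \<open>hvec_unique\<close>
  applies.\<close>

theorem highest_weight_one_sided:
  fixes z :: "nat set \<Rightarrow> nat set \<Rightarrow> 'k::field"
  assumes supp: "\<And>I J. z I J \<noteq> 0 \<Longrightarrow> I \<in> subsets_of_size d t \<and> J \<in> subsets_of_size d t"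
    and wt: "\<And>I J. z I J \<noteq> 0 \<Longrightarrow> wt I J = wt I0 J0"
    and raise: "\<And>i I J. Suc i < d \<Longrightarrow> I \<in> subsets_of_size d t \<Longrightarrow> J \<in> subsets_of_size d t \<Longrightarrow>
      (if i \<in> I \<and> Suc i \<notin> I then z (up i I) J else 0) + (if i \<in> J \<and> Suc i \<notin> J then z I (up i J) else 0) = 0"
    and nz: "z I0 J0 \<noteq> 0"
  shows "\<exists>u\<le>t. t + u \<le> d \<and> I0 \<inter> J0 = {..<t - u} \<and> I0 \<union> J0 = {..<t + u} \<and>
     (\<forall>I J. z I J = z {..<t} ({..<t - u} \<union> {t..<t + u}) * hvec (t - u) (t + u) t I J)"
proof -
  have bas: "I0 \<in> subsets_of_size d t" "J0 \<in> subsets_of_size d t" using supp[OF nz] by auto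
  have fin: "finite I0" "finite J0" using bas[THEN subsets_of_size_finite] by auto
  have d: "I0 \<subseteq> {..<d}" "J0 \<subseteq> {..<d}" "card I0 = t" "card J0 = t" using bas by (auto simp: subsets_of_size_def)
  \<comment> \<open>Otherwise the raising equation at (\<open>dn i I0\<close>, \<open>J0\<close>)
    has the single term \<open>z I0 J0\<close>, which is nonzero.\<close>
  have stepI: "i \<in> J0 \<and> Suc i \<notin> J0" if "Suc i \<in> I0" "i \<notin> I0" for i
  proof (rule ccontr)
    assume "\<not> ?thesis"
    moreover have "i \<in> dn i I0" "Suc i \<notin> dn i I0" "Suc i < d" using that d by (auto simp: dn_def)
    ultimately have "z (up i (dn i I0)) J0 = 0"
      using raise[of i "dn i I0" J0] dn_in_subsets_of_size[OF bas(1) that] bas(2) by auto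
    then show False using nz up_dn[OF that] by simp
  qed
  have stepJ: "i \<in> I0 \<and> Suc i \<notin> I0" if "Suc i \<in> J0" "i \<notin> J0" for i
  proof (rule ccontr)
    assume "\<not> ?thesis"
    moreover have "i \<in> dn i J0" "Suc i \<notin> dn i J0" "Suc i < d" using that d by (auto simp: dn_def)
    ultimately have "z I0 (up i (dn i J0)) = 0"
      using raise[of i I0 "dn i J0"] dn_in_subsets_of_size[OF bas(2) that] bas(1) by auto
    then show False using nz up_dn[OF that] by simp
  qed
  have Int: "I0 \<inter> J0 = {..<card (I0 \<inter> J0)}"
    using fin stepI stepJ by (intro downward_closed_nat) blast+
  have Un: "I0 \<union> J0 = {..<card (I0 \<union> J0)}"
    using fin stepI stepJ by (intro downward_closed_nat) blast+
  define u where "u = t - card (I0 \<inter> J0)"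
  have le: "card (I0 \<inter> J0) \<le> t" using card_mono[of I0 "I0 \<inter> J0"] fin d by simp
  have cc: "card (I0 \<inter> J0) = t - u" "card (I0 \<union> J0) = t + u" "u \<le> t"
    using card_Un_Int[OF fin] d le by (auto simp: u_def)
  have IU: "I0 \<inter> J0 = {..<t - u}" "I0 \<union> J0 = {..<t + u}" using Int Un cc by auto
  have tu: "t + u \<le> d"
  proof -
    have "card (I0 \<union> J0) \<le> card {..<d}" by (intro card_mono) (use d in auto)
    then show ?thesis using cc by simp
  qed
  have "z I J = z {..<t} ({..<t - u} \<union> {t..<t + u}) * hvec (t - u) (t + u) t I J" for I J
  proof (rule hvec_unique[where d = d])
    fix I J assume "z I J \<noteq> 0"
    then show "card I = t \<and> I \<inter> J = {..<t - u} \<and> I \<union> J = {..<t + u}"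
      using supp[of I J] wt_Int_Un[OF wt[of I J]] IU by (auto simp: subsets_of_size_def)
  qed (use tu raise cc in auto)
  then show ?thesis using tu cc IU by blast
qed

text \<open>For fixed column sets the function is a one-sided highest weight vector in the rows.
  This splits off the row factor, and what remains is a one-sided highest weight vector in the
  columns.\<close>

theorem highest_weight_two_sided:
  fixes y :: "nat set \<times> nat set \<Rightarrow> nat set \<times> nat set \<Rightarrow> 'k::field"
  assumes supp: "\<And>I H J K. y (I, H) (J, K) \<noteq> 0 \<Longrightarrow>
      {I, J} \<subseteq> subsets_of_size m t \<and> {H, K} \<subseteq> subsets_of_size n t"
    and wt: "\<And>I H J K. y (I, H) (J, K) \<noteq> 0 \<Longrightarrow> wt I J = wt I0 J0 \<and> wt H K = wt H0 K0"
    and raiseV: "\<And>i I H J K. Suc i < m \<Longrightarrow> I \<in> subsets_of_size m t \<Longrightarrow> J \<in> subsets_of_size m t \<Longrightarrow>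
      H \<in> subsets_of_size n t \<Longrightarrow> K \<in> subsets_of_size n t \<Longrightarrow>
      (if i \<in> I \<and> Suc i \<notin> I then y (up i I, H) (J, K) else 0) +
      (if i \<in> J \<and> Suc i \<notin> J then y (I, H) (up i J, K) else 0) = 0"
    and raiseW: "\<And>i I H J K. Suc i < n \<Longrightarrow> I \<in> subsets_of_size m t \<Longrightarrow> J \<in> subsets_of_size m t \<Longrightarrow>
      H \<in> subsets_of_size n t \<Longrightarrow> K \<in> subsets_of_size n t \<Longrightarrow>
      (if i \<in> H \<and> Suc i \<notin> H then y (I, up i H) (J, K) else 0) +
      (if i \<in> K \<and> Suc i \<notin> K then y (I, H) (J, up i K) else 0) = 0"
    and nz: "y (I0, H0) (J0, K0) \<noteq> 0"
  shows "\<exists>u v c. u \<le> t \<and> v \<le> t \<and> t + u \<le> m \<and> t + v \<le> n \<and> c \<noteq> 0 \<and>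
     (\<forall>I H J K. y (I, H) (J, K) = c * (hvec (t - u) (t + u) t I J * hvec (t - v) (t + v) t H K))"
proof -
  have slice: "\<exists>u\<le>t. t + u \<le> m \<and> I0 \<inter> J0 = {..<t - u} \<and>
      (\<forall>I J. y (I, H) (J, K) = y ({..<t}, H) ({..<t - u} \<union> {t..<t + u}, K) * hvec (t - u) (t + u) t I J)"
    if ex: "y (I1, H) (J1, K) \<noteq> 0" for I1 J1 H K
  proof -
    have HK: "H \<in> subsets_of_size n t" "K \<in> subsets_of_size n t" using supp[OF ex] by auto
    have w: "wt I1 J1 = wt I0 J0" using wt[OF ex] by simp
    have "\<exists>u\<le>t. t + u \<le> m \<and> I1 \<inter> J1 = {..<t - u} \<and> I1 \<union> J1 = {..<t + u} \<and>
      (\<forall>I J. y (I, H) (J, K) = y ({..<t}, H) ({..<t - u} \<union> {t..<t + u}, K) * hvec (t - u) (t + u) t I J)"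
    proof (rule highest_weight_one_sided)
      show "I \<in> subsets_of_size m t \<and> J \<in> subsets_of_size m t" if "y (I, H) (J, K) \<noteq> 0" for I J
        using supp[OF that] by auto
      show "wt I J = wt I1 J1" if "y (I, H) (J, K) \<noteq> 0" for I J using wt[OF that] w by simp
      show "(if i \<in> I \<and> Suc i \<notin> I then y (up i I, H) (J, K) else 0) +
      (if i \<in> J \<and> Suc i \<notin> J then y (I, H) (up i J, K) else 0) = 0" if "Suc i < m"
        "I \<in> subsets_of_size m t" "J \<in> subsets_of_size m t" for i I J
        using raiseV[OF that HK] .
    qed (rule ex)
    then show ?thesis using wt_Int_Un(1)[OF w] by auto
  qed
  obtain u where u: "u \<le> t" "t + u \<le> m" "I0 \<inter> J0 = {..<t - u}"
    using slice[OF nz] by blast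
  let ?a = "{..<t}" and ?b = "{..<t - u} \<union> {t..<t + u}"
  \<comment> \<open>All nonzero slices have the same row weight and therefore the same u; for a zero
    slice both sides vanish.\<close>
  have y1: "y (I, H) (J, K) = y (?a, H) (?b, K) * hvec (t - u) (t + u) t I J" for I H J K
  proof (cases "\<exists>I1 J1. y (I1, H) (J1, K) \<noteq> 0")
    case True
    then obtain u' where u': "u' \<le> t" "I0 \<inter> J0 = {..<t - u'}" "\<forall>I J. y (I, H) (J, K) =
        y ({..<t}, H) ({..<t - u'} \<union> {t..<t + u'}, K) * hvec (t - u') (t + u') t I J"
      using slice[of _ H _ K] by metis
    have "t - u' = t - u" using u'(2) u(3) by simp
    then have "u' = u" using u' u by linarith
    then show ?thesis using u'(3) by blast
  next
    case False
    then show ?thesis by simp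
  qed
  have ab: "?a \<in> subsets_of_size m t" "?b \<in> subsets_of_size m t" if "y (?a, H) (?b, K) \<noteq> 0" for H K
    using supp[OF that] by auto
  have nz': "y (?a, H0) (?b, K0) \<noteq> 0" using nz y1[of I0 H0 J0 K0] by auto
  have "\<exists>v\<le>t. t + v \<le> n \<and> H0 \<inter> K0 = {..<t - v} \<and> H0 \<union> K0 = {..<t + v} \<and>
      (\<forall>H K. y (?a, H) (?b, K) = y (?a, {..<t}) (?b, {..<t - v} \<union> {t..<t + v}) * hvec (t - v) (t + v) t H K)"
  proof (rule highest_weight_one_sided)
    show "I \<in> subsets_of_size n t \<and> J \<in> subsets_of_size n t" if "y (?a, I) (?b, J) \<noteq> 0" for I J
      using supp[OF that] by auto
    show "wt I J = wt H0 K0" if "y (?a, I) (?b, J) \<noteq> 0" for I J using wt[OF that] by simp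
    show "(if i \<in> I \<and> Suc i \<notin> I then y (?a, up i I) (?b, J) else 0) +
    (if i \<in> J \<and> Suc i \<notin> J then y (?a, I) (?b, up i J) else 0) = 0" if "Suc i < n"
      "I \<in> subsets_of_size n t" "J \<in> subsets_of_size n t" for i I J
      using raiseW[OF that(1) ab[OF nz'] that(2,3)] .
  qed (rule nz')
  then obtain v where v: "v \<le> t" "t + v \<le> n"
    "\<And>H K. y (?a, H) (?b, K) = y (?a, {..<t}) (?b, {..<t - v} \<union> {t..<t + v}) * hvec (t - v) (t + v) t H K"
    by blast
  let ?c = "y (?a, {..<t}) (?b, {..<t - v} \<union> {t..<t + v})"
  have "?c \<noteq> 0" using nz' v(3)[of H0 K0] by auto
  moreover have "y (I, H) (J, K) = ?c * (hvec (t - u) (t + u) t I J * hvec (t - v) (t + v) t H K)" for I H J K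
    by (subst y1, subst v(3)) (simp only: mult_ac)
  ultimately show ?thesis using u v by blast
qed


subsection \<open>The sign of an ordered partition\<close>

lemma permutes_map_unique:
  assumes "p permutes set xs" "q permutes set xs" "map p xs = map q xs"
  shows "p = q"
proof
  fix x
  show "p x = q x"
  proof (cases "x \<in> set xs")
    case True
    then show ?thesis using assms(3) by simp
  next
    case False
    then show ?thesis using assms permutes_not_in by metis
  qed
qed

lemma map_transpose_sorted_list_of_set:
  assumes "finite A" "\<not> (i \<in> A \<and> Suc i \<in> A)"
  shows "map (Transposition.transpose i (Suc i)) (sorted_list_of_set A)
    = sorted_list_of_set (Transposition.transpose i (Suc i) ` A)"
proof -
  have "sorted_wrt (<) (map (Transposition.transpose i (Suc i)) (sorted_list_of_set A))"
    unfolding sorted_wrt_map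
  proof (rule sorted_wrt_mono_rel[OF _ strict_sorted_list_of_set])
    fix x y assume "x \<in> set (sorted_list_of_set A)" "y \<in> set (sorted_list_of_set A)" "x < y"
    then show "Transposition.transpose i (Suc i) x < Transposition.transpose i (Suc i) y"
      using assms by (auto simp: Transposition.transpose_def)
  qed
  then show ?thesis
    using assms(1) by (intro strict_sorted_equal) (auto simp: strict_sorted_list_of_set)
qed

text \<open>Induction on inversions. Composing with a transposition of neighbours changes both the
  sign and the parity of the inversion number, and it respects the increasing order inside A and
  inside B.\<close>

lemma partition_perm:
  assumes "A \<union> B = {l..<h}" "A \<inter> B = {}"
  shows "\<exists>p. p permutes {l..<h} \<and>
     map p [l..<h] = sorted_list_of_set A @ sorted_list_of_set B \<and> sign p = (-1) ^ inv_count A B"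
  using assms
proof (induction "inv_count A B" arbitrary: A B rule: less_induct)
  case less
  have fin: "finite A" "finite B" using less.prems(1) by (metis finite_Un finite_atLeastLessThan)+
  show ?case
  proof (cases "\<exists>i. i \<in> B \<and> Suc i \<in> A")
    case True
    then obtain i where i: "i \<in> B" "Suc i \<in> A" by blast
    then have ni: "i \<notin> A" "Suc i \<notin> B" using less.prems by auto
    let ?t = "Transposition.transpose i (Suc i)"
    have im: "?t ` A = dn i A" "?t ` B = up i B"
      using i ni by (auto simp: dn_def up_def Transposition.transpose_def image_iff)
    have inv: "inv_count A B = Suc (inv_count (dn i A) (up i B))"
      using inv_count_swap[OF fin less.prems(2) i] .
    have "dn i A \<union> up i B = {l..<h}" "dn i A \<inter> up i B = {}"
      using less.prems i ni by (auto simp: dn_def up_def)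
    then obtain p where p: "p permutes {l..<h}"
      "map p [l..<h] = sorted_list_of_set (dn i A) @ sorted_list_of_set (up i B)"
      "sign p = (-1) ^ inv_count (dn i A) (up i B)"
      using less.hyps[of "dn i A" "up i B"] inv by auto
    have tp: "?t permutes {l..<h}" using less.prems(1) i by (intro permutes_swap_id) auto
    have "?t ` dn i A = A" "?t ` up i B = B" unfolding im[symmetric] by (auto simp: image_image)
    then have mt: "map ?t (sorted_list_of_set (dn i A)) = sorted_list_of_set A"
      "map ?t (sorted_list_of_set (up i B)) = sorted_list_of_set B"
      using map_transpose_sorted_list_of_set[of "dn i A" i] map_transpose_sorted_list_of_set[of "up i B" i]
        fin ni by (auto simp: dn_def up_def)
    have "map (?t \<circ> p) [l..<h] = sorted_list_of_set A @ sorted_list_of_set B"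
      unfolding map_map[symmetric] p(2) by (simp add: mt)
    moreover have "sign (?t \<circ> p) = (-1) ^ inv_count A B"
      using p(1,3) tp inv by (subst sign_compose)
        (auto simp: permutes_imp_permutation[OF finite_atLeastLessThan] sign_swap_id permutation_swap_id)
    moreover have "(?t \<circ> p) permutes {l..<h}" using p(1) tp by (rule permutes_compose)
    ultimately show ?thesis by blast
  next
    case False
    \<comment> \<open>Without a neighbouring inversion A precedes B: on the way from y in B up to a
      larger x in A, membership would have to change from B to A somewhere.\<close>
    have sep: "x < y" if x: "x \<in> A" and y: "y \<in> B" for x y
    proof (rule ccontr)
      assume "\<not> x < y"
      then have "y \<le> x" by simp
      have "\<exists>i. y \<le> i \<and> i < x \<and> i \<in> B \<and> Suc i \<in> A"
        using \<open>y \<le> x\<close> y x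
      proof (induction rule: inc_induct)
        case base
        then show ?case using less.prems(2) by blast
      next
        case (step k)
        have "Suc k \<in> A \<union> B" unfolding less.prems(1) using step x less.prems(1)
          by (metis Un_iff atLeastLessThan_iff le_SucI order_le_less_trans Suc_leI)
        then show ?case
        proof
          assume "Suc k \<in> A" then show ?thesis using step by blast
        next
          assume "Suc k \<in> B" then show ?thesis using step.IH step.prems by (meson Suc_leD)
        qed
      qed
      then show False using False by blast
    qed
    have "sorted_list_of_set {l..<h} = sorted_list_of_set A @ sorted_list_of_set B"
    proof (rule strict_sorted_equal)
      show "sorted_wrt (<) (sorted_list_of_set A @ sorted_list_of_set B)"
        using sep fin by (auto simp: sorted_wrt_append strict_sorted_list_of_set)
    qed (use fin less.prems in \<open>auto simp: strict_sorted_list_of_set\<close>)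
    moreover have "inv_count A B = 0"
    proof -
      have "{i \<in> B. i < x} = {}" if "x \<in> A" for x using sep[OF that] by fastforce
      then show ?thesis unfolding inv_count_def below_def by (intro sum.neutral ballI) (metis card.empty)
    qed
    ultimately show ?thesis by (intro exI[of _ id]) (auto simp: permutes_id sign_id)
  qed
qed

lemma partition_sign_eq:
  assumes "A \<union> B = {l..<h}" "A \<inter> B = {}"
  shows "partition_sign A B = (-1) ^ inv_count A B"
proof -
  obtain p where p: "p permutes {l..<h}" "map p [l..<h] = sorted_list_of_set A @ sorted_list_of_set B"
    "sign p = (-1) ^ inv_count A B"
    using partition_perm[OF assms] by blast
  have "(THE q. q permutes {l..<h} \<and> map q [l..<h] = sorted_list_of_set A @ sorted_list_of_set B) = p"
    using p by (intro the_equality) (auto intro!: permutes_map_unique[of _ "[l..<h]"])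
  then show ?thesis using p(3) by (simp add: partition_sign_def assms(1))
qed

section \<open>Linear maps between free vector spaces\<close>

abbreviation "lookup \<equiv> Poly_Mapping.lookup"
abbreviation "keys \<equiv> Poly_Mapping.keys"
abbreviation "single \<equiv> Poly_Mapping.single"

text \<open>Linearity on the whole free space, which is stronger than the linearity on a submodule
  in \<open>gmodule_iso\<close> and can be tested on basis vectors through
  \<open>plin_eqI\<close>.\<close>

definition plin :: "(('a \<Rightarrow>\<^sub>0 'k::field) \<Rightarrow> ('b \<Rightarrow>\<^sub>0 'k)) \<Rightarrow> bool" where
  "plin F \<longleftrightarrow> (\<forall>p q. F (p + q) = F p + F q) \<and> (\<forall>c p. F (pm_scale c p) = pm_scale c (F p))"

lemma plinI: "(\<And>p q. F (p + q) = F p + F q) \<Longrightarrow> (\<And>c p. F (pm_scale c p) = pm_scale c (F p)) \<Longrightarrow> plin F"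
  by (simp add: plin_def)

lemma plin_add: "plin F \<Longrightarrow> F (p + q) = F p + F q"
  and plin_scale: "plin F \<Longrightarrow> F (pm_scale c p) = pm_scale c (F p)"
  by (simp_all add: plin_def)

lemma plin_0: "plin F \<Longrightarrow> F 0 = 0"
  using plin_scale[of F 0 0] by simp

lemma plin_sum: "plin F \<Longrightarrow> F (\<Sum>i\<in>A. f i) = (\<Sum>i\<in>A. F (f i))"
  by (induction A rule: infinite_finite_induct) (simp_all add: plin_0 plin_add)

lemma plin_diff: "plin F \<Longrightarrow> F (p - q) = F p - F q"
proof -
  assume F: "plin F"
  have "F p = F (p - q + q)" by simp
  also have "\<dots> = F (p - q) + F q" by (rule plin_add[OF F])
  finally show ?thesis by simp
qed

lemma plin_id: "plin (\<lambda>x. x)"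
  by (simp add: plin_def)

lemma plin_zero: "plin (\<lambda>x. 0)"
  by (simp add: plin_def)

lemma plin_comp: "plin F \<Longrightarrow> plin G \<Longrightarrow> plin (\<lambda>x. F (G x))"
  by (simp add: plin_def)

lemma plin_plus: "plin F \<Longrightarrow> plin G \<Longrightarrow> plin (\<lambda>x. F x + G x)"
  by (simp add: plin_def pm.scale_right_distrib add_ac)

lemma plin_sum_fun: "(\<And>i. i \<in> A \<Longrightarrow> plin (F i)) \<Longrightarrow> plin (\<lambda>x. \<Sum>i\<in>A. F i x)"
  by (induction A rule: infinite_finite_induct) (auto intro!: plin_plus plin_zero)

lemma single_eq_scale: "single x c = pm_scale c (bvec x :: _ \<Rightarrow>\<^sub>0 'k::field)"
  by (rule poly_mapping_eqI) (simp add: bvec_def lookup_single when_def)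

lemma pm_expand: "(p :: _ \<Rightarrow>\<^sub>0 'k::field) = (\<Sum>x\<in>keys p. pm_scale (lookup p x) (bvec x))"
proof (rule poly_mapping_eqI)
  fix y
  show "lookup p y = lookup (\<Sum>x\<in>keys p. pm_scale (lookup p x) (bvec x)) y"
    by (simp add: lookup_sum bvec_def lookup_single when_def if_distrib in_keys_iff cong: if_cong)
qed

lemma plin_expand: "plin F \<Longrightarrow> F p = (\<Sum>x\<in>keys p. pm_scale (lookup p x) (F (bvec x)))"
  by (subst (1) pm_expand) (simp add: plin_sum plin_scale)

lemma plin_eqI:
  assumes "plin F" "plin G" "\<And>x. x \<in> keys p \<Longrightarrow> F (bvec x) = G (bvec x)"
  shows "F p = G p"
  unfolding plin_expand[OF assms(1), of p] plin_expand[OF assms(2), of p]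
  by (intro sum.cong refl) (simp add: assms(3))

lemma lin_ext_superset:
  "finite A \<Longrightarrow> keys p \<subseteq> A \<Longrightarrow> lin_ext f (p :: _ \<Rightarrow>\<^sub>0 'k::field) = (\<Sum>x\<in>A. pm_scale (lookup p x) (f x))"
  unfolding lin_ext_def by (rule sum.mono_neutral_left) (auto simp: in_keys_iff)

lemma plin_lin_ext: "plin (lin_ext (f :: 'a \<Rightarrow> 'b \<Rightarrow>\<^sub>0 'k::field))"
proof (rule plinI)
  fix p q :: "'a \<Rightarrow>\<^sub>0 'k"
  let ?A = "keys p \<union> keys q"
  have "keys (p + q) \<subseteq> ?A" by (rule keys_add)
  then show "lin_ext f (p + q) = lin_ext f p + lin_ext f q"
    by (simp add: lin_ext_superset[of ?A] lookup_add pm.scale_left_distrib sum.distrib)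
next
  fix c and p :: "'a \<Rightarrow>\<^sub>0 'k"
  have "keys (pm_scale c p) \<subseteq> keys p" by (auto simp: in_keys_iff)
  then show "lin_ext f (pm_scale c p) = pm_scale c (lin_ext f p)"
    by (simp add: lin_ext_superset[of "keys p"] pm.scale_sum_right)
qed

lemma pm_scale_mult: "pm_scale c (p * q) = pm_scale c p * (q :: ('a::comm_monoid_add \<Rightarrow>\<^sub>0 'k::field))"
  by (simp add: pm_scale_def mult_map_scale_conv_mult mult.assoc)

lemma pm_scale_mult_right: "p * pm_scale c q = pm_scale c (p * (q :: ('a::comm_monoid_add \<Rightarrow>\<^sub>0 'k::field)))"
  by (metis pm_scale_mult mult.commute)

lemma bvec_mult: "bvec a * bvec b = (bvec (a + b) :: ('a::comm_monoid_add \<Rightarrow>\<^sub>0 'k::field))"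
  by (simp add: bvec_def mult_single)

definition mono_val :: "('v \<Rightarrow> ('w, 'k::field) mpoly) \<Rightarrow> ('v \<Rightarrow>\<^sub>0 nat) \<Rightarrow> ('w, 'k) mpoly" where
  "mono_val h mm = (\<Prod>x\<in>keys mm. h x ^ lookup mm x)"

lemma mono_val_superset:
  "finite A \<Longrightarrow> keys mm \<subseteq> A \<Longrightarrow> mono_val h mm = (\<Prod>x\<in>A. h x ^ lookup mm x)"
  unfolding mono_val_def by (rule prod.mono_neutral_left) (auto simp: in_keys_iff)

lemma mono_val_add: "mono_val h (a + b) = mono_val h a * mono_val h b"
proof -
  have "keys (a + b) \<subseteq> keys a \<union> keys b" by (rule keys_add)
  then show ?thesis
    by (simp add: mono_val_superset[of "keys a \<union> keys b"] lookup_add power_add prod.distrib)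
qed

lemma alg_ext_bvec: "alg_ext h (bvec mm) = mono_val h mm"
  unfolding alg_ext_def by (simp add: mono_val_def)

lemma plin_alg_ext: "plin (alg_ext h)"
  unfolding alg_ext_def by (rule plin_lin_ext)

lemma plin_mult_left: "plin (\<lambda>q. p * (q :: ('a::comm_monoid_add \<Rightarrow>\<^sub>0 'k::field)))"
  by (rule plinI) (simp_all add: distrib_left pm_scale_mult_right)

lemma plin_mult_right: "plin (\<lambda>p. p * (q :: ('a::comm_monoid_add \<Rightarrow>\<^sub>0 'k::field)))"
  by (rule plinI) (simp_all add: distrib_right pm_scale_mult)

text \<open>Both sides are linear in each argument, so monomials suffice, and there exponents
  add.\<close>

lemma alg_ext_mult: "alg_ext h (p * q) = alg_ext h p * (alg_ext h q :: ('w, 'k::field) mpoly)"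
proof (rule plin_eqI[of "\<lambda>p. alg_ext h (p * q)" "\<lambda>p. alg_ext h p * alg_ext h q"])
  fix a
  show "alg_ext h (bvec a * q) = alg_ext h (bvec a) * alg_ext h q"
  proof (rule plin_eqI[of "\<lambda>q. alg_ext h (bvec a * q)" "\<lambda>q. alg_ext h (bvec a) * alg_ext h q"])
    fix b
    show "alg_ext h (bvec a * bvec b) = alg_ext h (bvec a) * alg_ext h (bvec b)"
      by (simp add: bvec_mult alg_ext_bvec mono_val_add)
  qed (intro plin_comp[OF plin_alg_ext] plin_comp[OF plin_mult_left] plin_mult_left plin_alg_ext)+
qed (intro plin_comp[OF plin_alg_ext] plin_comp[OF plin_mult_right] plin_mult_right plin_alg_ext)+

lemma alg_ext_hom: "comm_ring_hom (alg_ext h :: ('v, 'k::field) mpoly \<Rightarrow> ('w, 'k) mpoly)"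
proof unfold_locales
  have "alg_ext h (bvec 0) = 1" by (simp add: alg_ext_bvec mono_val_def)
  then show "alg_ext h (1 :: ('v, 'k) mpoly) = 1" by (simp add: bvec_def)
qed (simp_all add: alg_ext_mult plin_add[OF plin_alg_ext] plin_0[OF plin_alg_ext])

lemma lookup_tensor: "lookup (tensor p q) (x, y) = lookup p x * lookup (q :: _ \<Rightarrow>\<^sub>0 'k::field) y"
proof -
  have "lookup (tensor p q) (x, y) = (\<Sum>a\<in>keys p. \<Sum>b\<in>keys q.
      if a = x then if b = y then lookup p x * lookup q y else 0 else 0)"
    unfolding tensor_def lookup_sum by (intro sum.cong refl) (auto simp: lookup_single when_def)
  also have "\<dots> = (\<Sum>a\<in>keys p. if a = x then \<Sum>b\<in>keys q. if b = y then lookup p x * lookup q y else 0 else 0)"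
    by (intro sum.cong refl) auto
  also have "\<dots> = lookup p x * lookup q y"
    by (auto simp: in_keys_iff)
  finally show ?thesis .
qed

lemma tensor_eqI: "(\<And>x y. lookup p (x, y) = lookup q (x, y)) \<Longrightarrow> p = q"
  by (rule poly_mapping_eqI) auto

lemma plin_tensor_left: "plin (\<lambda>p. tensor p q)"
  by (rule plinI) (auto intro!: tensor_eqI simp: lookup_tensor lookup_add algebra_simps)

lemma plin_tensor_right: "plin (\<lambda>q. tensor p q)"
  by (rule plinI) (auto intro!: tensor_eqI simp: lookup_tensor lookup_add algebra_simps)

lemma tensor_0_left [simp]: "tensor 0 (q :: _ \<Rightarrow>\<^sub>0 'k::field) = 0"
  by (rule plin_0[OF plin_tensor_left])

lemma tensor_0_right [simp]: "tensor (p :: _ \<Rightarrow>\<^sub>0 'k::field) 0 = 0"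
  by (rule plin_0[OF plin_tensor_right])

lemma tensor_bvec: "tensor (bvec x) (bvec y) = (bvec (x, y) :: _ \<Rightarrow>\<^sub>0 'k::field)"
  by (rule tensor_eqI) (simp add: lookup_tensor, simp add: bvec_def lookup_single when_def)

lemma tensor_eq_0_iff: "tensor p q = 0 \<longleftrightarrow> p = 0 \<or> (q :: _ \<Rightarrow>\<^sub>0 'k::field) = 0"
proof
  assume t: "tensor p q = 0"
  show "p = 0 \<or> q = 0"
  proof (rule ccontr)
    assume "\<not> ?thesis"
    then obtain x y where "lookup p x \<noteq> 0" "lookup q y \<noteq> 0"
      by (metis lookup_zero poly_mapping_eqI)
    then have "lookup (tensor p q) (x, y) \<noteq> 0" by (simp add: lookup_tensor)
    then show False by (simp add: t)
  qed
qed auto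

lemma tensor_map_tensor:
  assumes "plin S" "plin T"
  shows "tensor_map S T (tensor p q) = tensor (S p) (T q)"
proof (rule plin_eqI[of "\<lambda>p. tensor_map S T (tensor p q)" "\<lambda>p. tensor (S p) (T q)"])
  fix x
  show "tensor_map S T (tensor (bvec x) q) = tensor (S (bvec x)) (T q)"
  proof (rule plin_eqI[of "\<lambda>q. tensor_map S T (tensor (bvec x) q)" "\<lambda>q. tensor (S (bvec x)) (T q)"])
    fix y
    show "tensor_map S T (tensor (bvec x) (bvec y)) = tensor (S (bvec x)) (T (bvec y))"
      by (simp add: tensor_bvec tensor_map_def)
  qed (simp_all add: tensor_map_def plin_comp[OF plin_lin_ext plin_tensor_right] plin_comp[OF plin_tensor_right assms(2)])
qed (simp_all add: tensor_map_def plin_comp[OF plin_lin_ext plin_tensor_left] plin_comp[OF plin_tensor_left assms(1)])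

lemma plin_tensor_map: "plin (tensor_map S T)"
  unfolding tensor_map_def by (rule plin_lin_ext)

lemma plin_sym_map: "plin (sym_map T)"
  unfolding sym_map_def by (rule plin_alg_ext)


section \<open>Quadratic forms in the bracket symbols\<close>

text \<open>Monomials of degree two are handled in the syntactic form
  \<open>single v 1 + single w 1\<close>; the simplifier must not turn the exponent 1 into
  \<open>Suc 0\<close>.\<close>

declare One_nat_def [simp del]

lemma single_pair_eq_iff:
  "single v (1::nat) + single w 1 = single v' 1 + single w' 1 \<longleftrightarrow> (v = v' \<and> w = w') \<or> (v = w' \<and> w = v')"
proof
  assume eq: "single v (1::nat) + single w 1 = single v' 1 + single w' 1"
  have *: "(if v = x then 1 else 0) + (if w = x then 1 else 0) = (if v' = x then 1 else 0) + (if w' = x then 1 else 0 :: nat)" for x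
    using arg_cong[OF eq, of "\<lambda>p. lookup p x"]
    by (simp add: lookup_add lookup_single when_def split del: if_split)
  show "(v = v' \<and> w = w') \<or> (v = w' \<and> w = v')"
    using *[of v] *[of w] *[of v'] by (auto split: if_splits)
qed (auto simp: add.commute)

lemma Var_mult: "Var v * Var w = (bvec (single v 1 + single w 1) :: ('v, 'k::field) mpoly)"
  by (simp add: Var_def bvec_mult)

text \<open>The array of second partial derivatives, that is, the symmetric bilinear form of a
  quadratic form. Doubling the diagonal makes the group act on it by the tensor square formula for
  all v and w alike.\<close>

definition pol :: "('v, 'k::field) mpoly \<Rightarrow> 'v \<Rightarrow> 'v \<Rightarrow> 'k" where
  "pol x v w = (if v = w then 2 else 1) * lookup x (single v 1 + single w 1)"

lemma pol_add: "pol (x + y) v w = pol x v w + pol y v w"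
  and pol_scale: "pol (pm_scale c x) v w = c * pol x v w"
  and pol_diff: "pol (x - y) v w = pol x v w - pol y v w"
  and pol_0 [simp]: "pol 0 v w = 0"
  by (simp_all add: pol_def lookup_add lookup_minus algebra_simps)

lemma pol_sum: "pol (\<Sum>i\<in>A. f i) v w = (\<Sum>i\<in>A. pol (f i) v w)"
  by (induction A rule: infinite_finite_induct) (simp_all add: pol_add)

lemma pol_sym: "pol x v w = pol x w v"
  by (simp add: pol_def add.commute)

lemma pol_Var_Var: "pol (Var a * Var b) v w =
   of_bool (a = v \<and> b = w) + (of_bool (a = w \<and> b = v) :: 'k::field)"
  by (auto simp: pol_def Var_mult bvec_def lookup_single when_def single_pair_eq_iff)

definition quad :: "'v set \<Rightarrow> ('v, 'k::field) mpoly set" where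
  "quad B = polys_in B \<inter> homogeneous 2"

lemma degree_superset:
  "finite A \<Longrightarrow> keys mm \<subseteq> A \<Longrightarrow> (\<Sum>x\<in>keys mm. lookup mm x) = (\<Sum>x\<in>A. lookup mm x)"
  for mm :: "'v \<Rightarrow>\<^sub>0 nat"
  by (rule sum.mono_neutral_left) (auto simp: in_keys_iff)

lemma degree_Suc_split:
  fixes mm :: "'v \<Rightarrow>\<^sub>0 nat"
  assumes "(\<Sum>x\<in>keys mm. lookup mm x) = Suc d" "keys mm \<subseteq> B"
  shows "\<exists>v mm'. v \<in> B \<and> mm = single v 1 + mm' \<and> keys mm' \<subseteq> B \<and> (\<Sum>x\<in>keys mm'. lookup mm' x) = d"
proof -
  have "keys mm \<noteq> {}" using assms by auto
  then obtain v where v: "v \<in> keys mm" by blast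
  let ?m = "mm - single v 1"
  have l: "lookup ?m x = lookup mm x - (if v = x then 1 else 0)" for x
    by (simp add: lookup_minus lookup_single when_def)
  have pos: "lookup mm v > 0" using v by (simp add: in_keys_iff)
  have eq: "mm = single v 1 + ?m"
    by (rule poly_mapping_eqI) (use pos in \<open>auto simp: lookup_add l lookup_single when_def\<close>)
  have k: "keys ?m \<subseteq> keys mm" by (auto simp: in_keys_iff l)
  have "Suc d = (\<Sum>x\<in>keys mm. lookup mm x)" using assms by simp
  also have "\<dots> = (\<Sum>x\<in>keys mm. (if v = x then 1 else 0) + lookup ?m x)"
    by (intro sum.cong refl) (use pos in \<open>auto simp: l\<close>)
  also have "\<dots> = 1 + (\<Sum>x\<in>keys ?m. lookup ?m x)"
    using v k by (simp add: sum.distrib degree_superset[of "keys mm"])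
  finally show ?thesis using eq k v assms(2) by (intro exI[of _ v] exI[of _ ?m]) auto
qed

lemma quad_monomial:
  assumes "x \<in> quad B" "mm \<in> keys x"
  shows "\<exists>v\<in>B. \<exists>w\<in>B. mm = single v 1 + single w 1"
proof -
  have "keys mm \<subseteq> B" "(\<Sum>x\<in>keys mm. lookup mm x) = Suc (Suc 0)"
    using assms by (auto simp: quad_def polys_in_def homogeneous_def numeral_2_eq_2)
  then obtain v mm' where v: "v \<in> B" "mm = single v 1 + mm'" "keys mm' \<subseteq> B"
    "(\<Sum>x\<in>keys mm'. lookup mm' x) = Suc 0"
    using degree_Suc_split[of mm "Suc 0" B] by blast
  obtain w mm'' where w: "w \<in> B" "mm' = single w 1 + mm''" "(\<Sum>x\<in>keys mm''. lookup mm'' x) = 0"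
    using degree_Suc_split[OF v(4,3)] by blast
  have "mm'' = 0" using w(3) by (intro poly_mapping_eqI) (auto simp: in_keys_iff)
  then show ?thesis using v w by auto
qed

lemma subspace_polys_in: "pm.subspace (polys_in B :: ('v, 'k::field) mpoly set)"
proof (rule pm.subspaceI)
  fix x y :: "('v, 'k) mpoly" assume "x \<in> polys_in B" "y \<in> polys_in B"
  then show "x + y \<in> polys_in B" using keys_add[of x y] unfolding polys_in_def by blast
next
  fix c and x :: "('v, 'k) mpoly" assume "x \<in> polys_in B"
  moreover have "keys (pm_scale c x) \<subseteq> keys x" by (auto simp: in_keys_iff)
  ultimately show "pm_scale c x \<in> polys_in B" unfolding polys_in_def by blast
qed (simp add: polys_in_def)

lemma subspace_homogeneous: "pm.subspace (homogeneous d :: ('v, 'k::field) mpoly set)"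
proof (rule pm.subspaceI)
  fix x y :: "('v, 'k) mpoly" assume "x \<in> homogeneous d" "y \<in> homogeneous d"
  then show "x + y \<in> homogeneous d" using keys_add[of x y] unfolding homogeneous_def by blast
next
  fix c and x :: "('v, 'k) mpoly" assume "x \<in> homogeneous d"
  moreover have "keys (pm_scale c x) \<subseteq> keys x" by (auto simp: in_keys_iff)
  ultimately show "pm_scale c x \<in> homogeneous d" unfolding homogeneous_def by blast
qed (simp add: homogeneous_def)

lemma subspace_quad: "pm.subspace (quad B :: ('v, 'k::field) mpoly set)"
  unfolding quad_def by (intro pm.subspace_inter subspace_polys_in subspace_homogeneous)

lemma Var_mult_quad: "v \<in> B \<Longrightarrow> w \<in> B \<Longrightarrow> (Var v * Var w :: ('v, 'k::field) mpoly) \<in> quad B"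
proof -
  assume vw: "v \<in> B" "w \<in> B"
  let ?m = "single v (1::nat) + single w 1"
  have k: "keys ?m \<subseteq> {v, w}" using keys_add[of "single v (1::nat)" "single w 1"] by auto
  have "(\<Sum>x\<in>keys ?m. lookup ?m x) = (\<Sum>x\<in>{v, w}. lookup ?m x)"
    using k by (intro degree_superset) auto
  also have "\<dots> = 2" by (cases "v = w") (simp_all add: lookup_add lookup_single)
  finally have "(\<Sum>x\<in>keys ?m. lookup ?m x) = 2" .
  moreover have "keys (bvec ?m :: ('v, 'k) mpoly) = {?m}" by (simp add: bvec_def)
  ultimately show ?thesis using k vw unfolding quad_def polys_in_def homogeneous_def Var_mult by auto
qed

lemma quad_span: "quad B = pm.span {Var v * Var w :: ('v, 'k::field) mpoly |v w. v \<in> B \<and> w \<in> B}"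
proof (intro equalityI subsetI)
  fix x :: "('v, 'k) mpoly" assume x: "x \<in> quad B"
  have "(\<Sum>mm\<in>keys x. pm_scale (lookup x mm) (bvec mm)) \<in>
      pm.span {Var v * Var w :: ('v, 'k) mpoly |v w. v \<in> B \<and> w \<in> B}"
  proof (intro pm.span_sum pm.span_scale pm.span_base)
    fix mm assume "mm \<in> keys x"
    from quad_monomial[OF x this] show "bvec mm \<in> {Var v * Var w :: ('v, 'k) mpoly |v w. v \<in> B \<and> w \<in> B}"
      by (auto simp: Var_mult)
  qed
  then show "x \<in> pm.span {Var v * Var w :: ('v, 'k) mpoly |v w. v \<in> B \<and> w \<in> B}"
    by (simp flip: pm_expand)
next
  fix x :: "('v, 'k) mpoly" assume "x \<in> pm.span {Var v * Var w |v w. v \<in> B \<and> w \<in> B}"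
  moreover have "pm.span {Var v * Var w :: ('v, 'k) mpoly |v w. v \<in> B \<and> w \<in> B} \<subseteq> quad B"
    by (intro pm.span_minimal subspace_quad) (auto intro: Var_mult_quad)
  ultimately show "x \<in> quad B" by blast
qed

lemma quad_induct [consumes 1, case_names zero step]:
  assumes "x \<in> quad B" "P 0"
    and "\<And>c v w y. v \<in> B \<Longrightarrow> w \<in> B \<Longrightarrow> P y \<Longrightarrow> P (pm_scale c (Var v * Var w) + y)"
  shows "P (x :: ('v, 'k::field) mpoly)"
  using assms(1) unfolding quad_span
proof (induction rule: pm.span_induct_alt)
  case (step c v y)
  then show ?case using assms(3) by auto
qed (rule assms(2))

lemma quad_plin_eqI:
  assumes "x \<in> quad B" "plin F" "plin G"
    "\<And>v w. v \<in> B \<Longrightarrow> w \<in> B \<Longrightarrow> F (Var v * Var w) = G (Var v * Var w)"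
  shows "F (x :: ('v, 'k::field) mpoly) = G x"
  using assms(1)
  by (induction rule: quad_induct) (simp_all add: assms plin_0 plin_add plin_scale)

text \<open>Summation over ordered pairs counts every quadratic form twice. The linear maps out of
  the quadratic forms are obtained in this way, hence the recurrent factor 2.\<close>

definition unpol :: "'v set \<Rightarrow> ('v \<Rightarrow> 'v \<Rightarrow> ('w \<Rightarrow>\<^sub>0 'k::field)) \<Rightarrow> ('v, 'k) mpoly \<Rightarrow> ('w \<Rightarrow>\<^sub>0 'k)" where
  "unpol B f x = (\<Sum>v\<in>B. \<Sum>w\<in>B. pm_scale (pol x v w) (f v w))"

lemma plin_unpol: "plin (unpol B f)"
  by (rule plinI)
    (simp_all add: unpol_def pol_add pol_scale pm.scale_left_distrib sum.distrib pm.scale_sum_right)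

lemma unpol_Var_Var:
  assumes "finite B" "a \<in> B" "b \<in> B"
  shows "unpol B f (Var a * Var b) = f a b + f b a"
proof -
  have "unpol B f (Var a * Var b) = (\<Sum>v\<in>B. \<Sum>w\<in>B. (if w = b then if v = a then f v w else 0 else 0)
      + (if w = a then if v = b then f v w else 0 else 0))"
    unfolding unpol_def pol_Var_Var by (intro sum.cong refl) (auto simp: pm.scale_left_distrib)
  also have "\<dots> = (\<Sum>v\<in>B. (if v = a then f v b else 0) + (if v = b then f v a else 0))"
    by (intro sum.cong refl, subst sum.distrib) (use assms in \<open>simp add: sum.delta\<close>)
  finally show ?thesis using assms by (simp add: sum.distrib sum.delta)
qed

lemma pm_scale_2: "pm_scale 2 p = p + (p :: _ \<Rightarrow>\<^sub>0 'k::field)"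
  by (rule poly_mapping_eqI) (simp add: lookup_add)

lemma unpol_Var:
  assumes "finite B" "x \<in> quad B"
  shows "unpol B (\<lambda>v w. Var v * Var w) x = pm_scale 2 (x :: ('v, 'k::field) mpoly)"
proof (rule quad_plin_eqI[OF assms(2) plin_unpol])
  show "plin (pm_scale 2 :: ('v, 'k) mpoly \<Rightarrow> _)"
    by (rule plinI) (simp_all add: pm.scale_right_distrib mult.commute)
  fix v w assume "v \<in> B" "w \<in> B"
  then show "unpol B (\<lambda>v w. Var v * Var w) (Var v * Var w) = pm_scale 2 (Var v * Var w :: ('v, 'k) mpoly)"
    by (subst unpol_Var_Var) (use assms in \<open>simp_all only: pm_scale_2 mult.commute\<close>)
qed

text \<open>\<open>unpol\<close> recovers twice the form from the array, and 2 is
  invertible.\<close>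

lemma pol_inject:
  assumes "finite B" "x \<in> quad B" "y \<in> quad B" "\<And>v w. v \<in> B \<Longrightarrow> w \<in> B \<Longrightarrow> pol x v w = pol y v w"
  shows "x = (y :: ('v, 'k::field_char_0) mpoly)"
proof -
  have "pm_scale 2 x = pm_scale 2 y"
    unfolding unpol_Var[OF assms(1,2), symmetric] unpol_Var[OF assms(1,3), symmetric] unpol_def
    by (intro sum.cong refl) (simp add: assms(4))
  then show ?thesis by (simp add: pm.scale_cancel_left)
qed

lemma pol_outside:
  assumes "x \<in> quad B" "pol x v w \<noteq> 0"
  shows "v \<in> B" "w \<in> B"
proof -
  have "single v 1 + single w 1 \<in> keys x" using assms(2) by (auto simp: pol_def in_keys_iff)
  from quad_monomial[OF assms(1) this] show "v \<in> B" "w \<in> B" by (auto simp: single_pair_eq_iff)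
qed

section \<open>The group, its compound matrices and its action on quadratic forms\<close>

section \<open>The general linear group\<close>

lemma group_GL: "group (GL d :: 'k::field mat monoid)"
proof -
  interpret ring "ring_mat TYPE('k) d ()" by (rule ring_mat)
  show ?thesis unfolding GL_def by (rule units_group)
qed

lemma GL_mult [simp]: "a \<otimes>\<^bsub>GL d\<^esub> b = a * b"
  by (simp add: GL_def units_of_mult ring_mat_simps)

lemma GL_one [simp]: "\<one>\<^bsub>GL d\<^esub> = 1\<^sub>m d"
  by (simp add: GL_def units_of_one ring_mat_simps)

lemma GL_carrier_mat: "a \<in> carrier (GL d) \<Longrightarrow> a \<in> carrier_mat d d"
  by (simp add: GL_def units_of_carrier Units_def ring_mat_simps)

lemma GL_I:
  assumes "a \<in> carrier_mat d d" "a' \<in> carrier_mat d d" "a * a' = 1\<^sub>m d" "a' * a = 1\<^sub>m d"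
  shows "a \<in> carrier (GL d)" "inv\<^bsub>GL d\<^esub> a = a'"
proof -
  show a: "a \<in> carrier (GL d)"
    using assms by (auto simp: GL_def units_of_carrier Units_def ring_mat_simps)
  have "a' \<in> carrier (GL d)"
    using assms by (auto simp: GL_def units_of_carrier Units_def ring_mat_simps)
  then show "inv\<^bsub>GL d\<^esub> a = a'"
    using a assms by (intro group.inv_equality[OF group_GL]) auto
qed

lemma GL_inv:
  assumes "a \<in> carrier (GL d)"
  shows "inv\<^bsub>GL d\<^esub> a \<in> carrier (GL d)" "inv\<^bsub>GL d\<^esub> a * a = 1\<^sub>m d" "a * inv\<^bsub>GL d\<^esub> a = 1\<^sub>m d"
  using group.inv_closed[OF group_GL assms] group.l_inv[OF group_GL assms] group.r_inv[OF group_GL assms]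
  by simp_all

lemma GL_transpose:
  assumes "a \<in> carrier (GL d)"
  shows "transpose_mat a \<in> carrier (GL d)" "inv\<^bsub>GL d\<^esub> (transpose_mat a) = transpose_mat (inv\<^bsub>GL d\<^esub> a)"
proof -
  note c = GL_carrier_mat[OF assms] GL_carrier_mat[OF GL_inv(1)[OF assms]]
  have "transpose_mat a * transpose_mat (inv\<^bsub>GL d\<^esub> a) = 1\<^sub>m d"
    using transpose_mult[OF c(2,1)] GL_inv(2)[OF assms] by simp
  moreover have "transpose_mat (inv\<^bsub>GL d\<^esub> a) * transpose_mat a = 1\<^sub>m d"
    using transpose_mult[OF c(1,2)] GL_inv(3)[OF assms] by simp
  ultimately show "transpose_mat a \<in> carrier (GL d)" "inv\<^bsub>GL d\<^esub> (transpose_mat a) = transpose_mat (inv\<^bsub>GL d\<^esub> a)"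
    using c GL_I[of "transpose_mat a" d "transpose_mat (inv\<^bsub>GL d\<^esub> a)"] by auto
qed

text \<open>The matrix by which b acts on the dual space. As an involution of the group it allows
  passing freely between b and the matrix that acts on the dual.\<close>

definition contragredient :: "nat \<Rightarrow> 'k::field mat \<Rightarrow> 'k mat" where
  "contragredient n b = transpose_mat (inv\<^bsub>GL n\<^esub> b)"

lemma contragredient_GL: "b \<in> carrier (GL n) \<Longrightarrow> contragredient n b \<in> carrier (GL n)"
  by (simp add: contragredient_def GL_transpose GL_inv)

lemma contragredient_contragredient: "b \<in> carrier (GL n) \<Longrightarrow> contragredient n (contragredient n b) = b"
  by (simp add: contragredient_def GL_transpose GL_inv group.inv_inv[OF group_GL])

lemma contragredient_transpose: "b \<in> carrier (GL n) \<Longrightarrow> contragredient n (transpose_mat b) = transpose_mat (contragredient n b)"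
  by (simp add: contragredient_def GL_transpose)

lemma contragredient_one: "contragredient n (1\<^sub>m n) = (1\<^sub>m n :: 'k::field mat)"
  using GL_I(2)[of "1\<^sub>m n :: 'k mat" n "1\<^sub>m n"]
  by (auto simp: contragredient_def intro!: eq_matI)

lemma contragredient_mult:
  assumes "b \<in> carrier (GL n)" "b' \<in> carrier (GL n)"
  shows "contragredient n (b * b') = contragredient n b * contragredient n b'"
proof -
  have "inv\<^bsub>GL n\<^esub> (b * b') = inv\<^bsub>GL n\<^esub> b' * inv\<^bsub>GL n\<^esub> b"
    using group.inv_mult_group[OF group_GL assms] by simp
  then show ?thesis
    using assms by (simp add: contragredient_def transpose_mult[of _ n n _ n] GL_carrier_mat GL_inv)
qed

lemma GG_carrier: "(a, b) \<in> carrier (GG m n) \<longleftrightarrow> a \<in> carrier (GL m) \<and> b \<in> carrier (GL n)"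
  by (simp add: GG_def DirProd_def)

lemma GG_mult: "(a, b) \<otimes>\<^bsub>GG m n\<^esub> (a', b') = (a * a', b * b')"
  by (simp add: GG_def)

lemma GG_one: "\<one>\<^bsub>GG m n\<^esub> = (1\<^sub>m m, 1\<^sub>m n)"
  by (simp add: GG_def)

lemma group_GG: "group (GG m n)"
  unfolding GG_def by (intro DirProd_group group_GL)


section \<open>Compound matrices\<close>

definition mat_fun :: "'k mat \<Rightarrow> nat \<Rightarrow> nat \<Rightarrow> 'k" where
  "mat_fun a i j = a $$ (i, j)"

lemma mnr_zero_row:
  fixes M :: "nat \<Rightarrow> nat \<Rightarrow> 'r::comm_ring_1"
  assumes "finite K" "k \<in> K" "\<And>i. i \<in> I \<Longrightarrow> M k i = 0"
  shows "mnr M K I = 0"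
proof (cases "card I = card K")
  case True
  then have "finite I" using assms by (metis card_gt_0_iff empty_iff)
  then show ?thesis using mnr_row_expand[of K I k M] True assms by simp
qed (simp add: mnr_nonsquare)

lemma mnr_identity:
  assumes "finite K" "finite I" "card K = card I"
  shows "mnr (\<lambda>i j. of_bool (i = j)) K I = (of_bool (K = I) :: 'r::comm_ring_1)"
proof (cases "K = I")
  case True
  have "mat (card I) (card I) (\<lambda>(r, s). of_bool (sorted_list_of_set I ! r = sorted_list_of_set I ! s))
    = (1\<^sub>m (card I) :: 'r mat)"
    using nth_eq_iff_index_eq[OF distinct_sorted_list_of_set, of _ I] by (intro eq_matI) auto
  then show ?thesis using True by (simp add: mnr_def)
next
  case False
  have "\<not> K \<subseteq> I" using False assms card_subset_eq by blast
  then obtain k where "k \<in> K" "k \<notin> I" by blast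
  then show ?thesis using False assms mnr_zero_row[of K k I "\<lambda>i j. of_bool (i = j)"] by auto
qed

lemma mnr_mat_fun_mult:
  assumes "a \<in> carrier_mat m m" "a' \<in> carrier_mat m m" "K \<in> subsets_of_size m t" "I \<in> subsets_of_size m t"
  shows "mnr (mat_fun (a * a')) K I = (\<Sum>J\<in>subsets_of_size m t. mnr (mat_fun a) K J * mnr (mat_fun a') J I)"
proof -
  have fin: "finite K" "finite I" "card K = t" "card I = t"
    using assms(3,4) by (auto dest: subsets_of_size_finite subsets_of_size_card)
  have "mnr (mat_fun (a * a')) K I = mnr (\<lambda>i j. \<Sum>k<m. mat_fun a i k * mat_fun a' k j) K I"
  proof (rule mnr_cong)
    fix i j assume "i \<in> K" "j \<in> I"
    then have "i < m" "j < m" using assms by (auto simp: subsets_of_size_def)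
    then show "mat_fun (a * a') i j = (\<Sum>k<m. mat_fun a i k * mat_fun a' k j)"
      using assms(1,2) by (auto simp: mat_fun_def scalar_prod_def lessThan_atLeast0 intro!: sum.cong)
  qed
  then show ?thesis by (simp add: Cauchy_Binet[OF fin])
qed

lemma mnr_mat_fun_one:
  assumes "K \<in> subsets_of_size m t" "I \<in> subsets_of_size m t"
  shows "mnr (mat_fun (1\<^sub>m m)) K I = (of_bool (K = I) :: 'k::field)"
proof -
  have fin: "finite K" "finite I" "card K = card I"
    using assms by (auto dest: subsets_of_size_finite subsets_of_size_card)
  have "mnr (mat_fun (1\<^sub>m m)) K I = mnr (\<lambda>i j. of_bool (i = j) :: 'k) K I"
  proof (rule mnr_cong)
    fix i j assume "i \<in> K" "j \<in> I"
    then have "i < m" "j < m" using assms by (auto simp: subsets_of_size_def)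
    then show "mat_fun (1\<^sub>m m) i j = (of_bool (i = j) :: 'k)" by (simp add: mat_fun_def)
  qed
  then show ?thesis using mnr_identity[OF fin] by simp
qed

lemma mnr_mat_fun_transpose:
  assumes "a \<in> carrier_mat m m" "K \<in> subsets_of_size m t" "I \<in> subsets_of_size m t"
  shows "mnr (mat_fun (transpose_mat a)) K I = mnr (mat_fun a) I K"
proof -
  have "mnr (mat_fun (transpose_mat a)) K I = mnr (\<lambda>i j. mat_fun a j i) K I"
  proof (rule mnr_cong)
    fix i j assume "i \<in> K" "j \<in> I"
    then have "i < m" "j < m" using assms by (auto simp: subsets_of_size_def)
    then show "mat_fun (transpose_mat a) i j = mat_fun a j i" using assms(1) by (simp add: mat_fun_def)
  qed
  then show ?thesis by (simp add: mnr_transpose[of "mat_fun a"])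
qed

lemma lookup_std_act:
  "lookup (std_act a (bvec i)) k = (if k < dim_row a then mat_fun (a :: 'k::field mat) k i else 0)"
  by (simp add: std_act_def lookup_sum lookup_single when_def mat_fun_def)

text \<open>The matrix of the exterior power is the compound matrix of t-minors.
  \<open>wedge\<close> only sums over subsets of the joint support of the vectors, so the remaining
  K have to be shown to carry a zero minor.\<close>

lemma ext_map_bvec:
  assumes a: "a \<in> carrier_mat m m" and I: "I \<in> subsets_of_size m t"
  shows "ext_map (std_act a) (bvec I) = (\<Sum>K\<in>subsets_of_size m t. pm_scale (mnr (mat_fun a) K I) (bvec K :: _ \<Rightarrow>\<^sub>0 'k::field))"
proof (rule poly_mapping_eqI)
  fix K
  let ?vs = "map (\<lambda>i. std_act a (bvec i)) (sorted_list_of_set I)"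
  let ?U = "\<Union>v\<in>set ?vs. keys v"
  let ?d = "\<lambda>K. det (mat (length ?vs) (length ?vs) (\<lambda>(r, s). lookup (?vs ! s) (sorted_list_of_set K ! r)))"
  have fI: "finite I" "card I = t" using I by (auto dest: subsets_of_size_finite subsets_of_size_card)
  have len: "length ?vs = t" using fI by simp
  have U: "?U \<subseteq> {..<m}"
  proof
    fix k assume "k \<in> ?U"
    then obtain i where "k \<in> keys (std_act a (bvec i))" by auto
    then show "k \<in> {..<m}" using a by (auto simp: in_keys_iff lookup_std_act split: if_splits)
  qed
  then have finU: "finite ?U" using finite_subset by blast
  have "lookup (ext_map (std_act a) (bvec I)) K
     = (\<Sum>K'\<in>{K'. K' \<subseteq> ?U \<and> card K' = t}. if K' = K then ?d K' else 0)"
    unfolding ext_map_def lin_ext_bvec wedge_def len lookup_sum lookup_single when_def ..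
  also have "\<dots> = (if K \<subseteq> ?U \<and> card K = t then ?d K else 0)"
    by (subst sum.delta) (use finU in \<open>auto intro: finite_subset[of _ "Pow ?U"]\<close>)
  also have "\<dots> = (if K \<in> subsets_of_size m t then mnr (mat_fun a) K I else 0)"
  proof (cases "K \<subseteq> ?U \<and> card K = t")
    case True
    then have "K \<subseteq> {..<m}" using U by blast
    then have K: "K \<in> subsets_of_size m t" "finite K" using True finite_subset[OF _ finite_lessThan]
      by (simp_all add: subsets_of_size_def)
    have "sorted_list_of_set K ! r < m" if "r < t" for r
      using nth_mem[of r "sorted_list_of_set K"] that K True by (auto simp: subsets_of_size_def)
    then have "?d K = mnr (mat_fun a) K I"
      unfolding mnr_def len using fI True a
      by (intro arg_cong[of _ _ det] eq_matI) (auto simp: lookup_std_act)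
    then show ?thesis using True K by simp
  next
    \<comment> \<open>A set K of the right size outside the joint support contains an index whose
      row vanishes on I.\<close>
    case False
    have "mnr (mat_fun a) K I = 0" if K: "K \<in> subsets_of_size m t"
    proof -
      obtain k where k: "k \<in> K" "k \<notin> ?U" using False K by (auto simp: subsets_of_size_def)
      have "mat_fun a k i = 0" if "i \<in> I" for i
      proof -
        have "k \<notin> keys (std_act a (bvec i))" using k that fI by auto
        moreover have "k < m" using k K by (auto simp: subsets_of_size_def)
        ultimately show ?thesis using a by (auto simp: in_keys_iff lookup_std_act)
      qed
      then show ?thesis using K k by (intro mnr_zero_row[of _ k]) (auto dest: subsets_of_size_finite)
    qed
    then show ?thesis using False by (simp only: if_False) simp
  qed
  also have "\<dots> = lookup (\<Sum>K\<in>subsets_of_size m t. pm_scale (mnr (mat_fun a) K I) (bvec K)) K"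
  proof -
    have "lookup (\<Sum>K\<in>subsets_of_size m t. pm_scale (mnr (mat_fun a) K I) (bvec K)) K
       = (\<Sum>K'\<in>subsets_of_size m t. if K' = K then mnr (mat_fun a) K' I else 0)"
      unfolding lookup_sum by (intro sum.cong refl) (simp add: bvec_def lookup_single when_def)
    then show ?thesis by simp
  qed
  finally show "lookup (ext_map (std_act a) (bvec I)) K
    = lookup (\<Sum>K\<in>subsets_of_size m t. pm_scale (mnr (mat_fun a) K I) (bvec K)) K" .
qed


section \<open>The action on quadratic forms\<close>

definition brackets :: "nat \<Rightarrow> nat \<Rightarrow> nat \<Rightarrow> (nat set \<times> nat set) set" where
  "brackets t m n = subsets_of_size m t \<times> subsets_of_size n t"

lemma finite_brackets [simp]: "finite (brackets t m n)"
  by (simp add: brackets_def)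

text \<open>Entries of the Kronecker product of two compound matrices, the second one taken for the
  action on the dual space.\<close>

definition act_coeff :: "nat \<Rightarrow> 'k::field mat \<times> 'k mat \<Rightarrow> nat set \<times> nat set \<Rightarrow> nat set \<times> nat set \<Rightarrow> 'k" where
  "act_coeff n g v' v = mnr (mat_fun (fst g)) (fst v') (fst v) * mnr (mat_fun (contragredient n (snd g))) (snd v') (snd v)"

lemma S_act_Var:
  assumes g: "g \<in> carrier (GG m n)" and v: "v \<in> brackets t m n"
  shows "S_act n g (Var v) = (\<Sum>v'\<in>brackets t m n. pm_scale (act_coeff n g v' v) (Var v'))"
proof -
  obtain a b where ab: "g = (a, b)" by (cases g)
  obtain I H where IH: "v = (I, H)" by (cases v)
  have c: "a \<in> carrier_mat m m" "contragredient n b \<in> carrier_mat n n"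
    using g unfolding ab by (auto simp: GG_carrier GL_carrier_mat contragredient_GL)
  have IHb: "I \<in> subsets_of_size m t" "H \<in> subsets_of_size n t" using v IH by (auto simp: brackets_def)
  have d: "dual_act n b = std_act (contragredient n b)" by (simp add: dual_act_def contragredient_def fun_eq_iff)
  have "S_act n g (Var v) = lin_ext Var (tensor (ext_map (std_act a) (bvec I)) (ext_map (std_act (contragredient n b)) (bvec H)))"
    by (simp add: S_act_def ab IH sym_map_def tensor_map_def d)
  also have "\<dots> = (\<Sum>H'\<in>subsets_of_size n t. \<Sum>I'\<in>subsets_of_size m t.
      pm_scale (mnr (mat_fun a) I' I * mnr (mat_fun (contragredient n b)) H' H) (Var (I', H')))"
    unfolding ext_map_bvec[OF c(1) IHb(1)] ext_map_bvec[OF c(2) IHb(2)]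
    by (simp add: plin_sum[OF plin_tensor_left] plin_sum[OF plin_tensor_right] plin_sum[OF plin_lin_ext]
      plin_scale[OF plin_tensor_left] plin_scale[OF plin_tensor_right] plin_scale[OF plin_lin_ext]
      tensor_bvec pm.scale_sum_right mult.commute)
  also have "\<dots> = (\<Sum>I'\<in>subsets_of_size m t. \<Sum>H'\<in>subsets_of_size n t.
      pm_scale (mnr (mat_fun a) I' I * mnr (mat_fun (contragredient n b)) H' H) (Var (I', H')))"
    by (rule sum.swap)
  also have "\<dots> = (\<Sum>v'\<in>brackets t m n. pm_scale (act_coeff n g v' v) (Var v'))"
    unfolding brackets_def sum.cartesian_product by (intro sum.cong refl) (auto simp: act_coeff_def ab IH)
  finally show ?thesis .
qed

lemma S_act_mult: "S_act n g (x * y) = S_act n g x * (S_act n g y :: 'k::field minor_poly)"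
  by (cases g) (simp add: S_act_def sym_map_def alg_ext_mult)

lemma plin_S_act: "plin (S_act n g :: 'k::field minor_poly \<Rightarrow> _)"
  by (cases g) (simp add: S_act_def plin_sym_map)

lemma S_act_Var_Var:
  assumes g: "g \<in> carrier (GG m n)" and v: "v \<in> brackets t m n" "w \<in> brackets t m n"
  shows "S_act n g (Var v * Var w) = (\<Sum>v'\<in>brackets t m n. \<Sum>w'\<in>brackets t m n.
     pm_scale (act_coeff n g v' v * act_coeff n g w' w) (Var v' * Var w'))"
  unfolding S_act_mult S_act_Var[OF g v(1)] S_act_Var[OF g v(2)] sum_product
  by (simp add: pm_scale_mult[symmetric] pm_scale_mult_right mult.commute)

lemma S_act_quad:
  assumes g: "g \<in> carrier (GG m n)" and x: "x \<in> quad (brackets t m n)"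
  shows "S_act n g x \<in> quad (brackets t m n)"
  using x
proof (induction rule: quad_induct)
  case zero
  then show ?case by (simp add: plin_0[OF plin_S_act] pm.subspace_0[OF subspace_quad])
next
  case (step c v w y)
  have "S_act n g (Var v * Var w) \<in> quad (brackets t m n)"
    unfolding S_act_Var_Var[OF g step(1,2)]
    by (intro pm.subspace_sum[OF subspace_quad] pm.subspace_scale[OF subspace_quad] Var_mult_quad)
  then show ?case using step(3)
    by (simp add: plin_add[OF plin_S_act] plin_scale[OF plin_S_act]
        pm.subspace_add[OF subspace_quad] pm.subspace_scale[OF subspace_quad])
qed

text \<open>It is enough to compare both sides on a product of two variables, where each of them has
  two terms, one for each order of the factors.\<close>

lemma pol_S_act:
  assumes g: "g \<in> carrier (GG m n)" and x: "x \<in> quad (brackets t m n)"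
    and vw: "v' \<in> brackets t m n" "w' \<in> brackets t m n"
  shows "pol (S_act n g x) v' w' = (\<Sum>v\<in>brackets t m n. \<Sum>w\<in>brackets t m n. act_coeff n g v' v * act_coeff n g w' w * pol x v w)"
  using x
proof (induction rule: quad_induct)
  case zero
  then show ?case by (simp add: plin_0[OF plin_S_act])
next
  case (step c a b y)
  let ?B = "brackets t m n"
  have 1: "(\<Sum>v\<in>?B. \<Sum>w\<in>?B. h v w * pol (Var a * Var b) v w) = h a b + h b a"
    for h :: "_ \<Rightarrow> _ \<Rightarrow> 'a"
  proof -
    have "(\<Sum>v\<in>?B. \<Sum>w\<in>?B. h v w * pol (Var a * Var b) v w)
      = (\<Sum>v\<in>?B. \<Sum>w\<in>?B. (if w = b then if v = a then h v w else 0 else 0)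
      + (if w = a then if v = b then h v w else 0 else 0))"
      unfolding pol_Var_Var by (intro sum.cong refl) (auto simp: algebra_simps)
    also have "\<dots> = (\<Sum>v\<in>?B. (if v = a then h v b else 0) + (if v = b then h v a else 0))"
      by (intro sum.cong refl, subst sum.distrib) (use step in \<open>simp add: sum.delta\<close>)
    finally show ?thesis using step by (simp add: sum.distrib sum.delta)
  qed
  have "pol (S_act n g (Var a * Var b)) v' w' = (\<Sum>v\<in>?B. \<Sum>w\<in>?B. act_coeff n g v a * act_coeff n g w b *
      (of_bool (v = v' \<and> w = w') + of_bool (v = w' \<and> w = v')))"
    by (simp add: S_act_Var_Var[OF g step(1,2)] pol_sum pol_scale pol_Var_Var)
  also have "\<dots> = (\<Sum>v\<in>?B. \<Sum>w\<in>?B. act_coeff n g v a * act_coeff n g w b * pol (Var v' * Var w') v w)"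
    unfolding pol_Var_Var by (intro sum.cong refl) (auto simp: eq_commute conj_commute)
  also have "\<dots> = act_coeff n g v' a * act_coeff n g w' b + act_coeff n g w' a * act_coeff n g v' b"
  proof -
    have "(\<Sum>v\<in>?B. \<Sum>w\<in>?B. h v w * pol (Var v' * Var w') v w) = h v' w' + h w' v'" for h :: "_ \<Rightarrow> _ \<Rightarrow> 'a"
    proof -
      have "(\<Sum>v\<in>?B. \<Sum>w\<in>?B. h v w * pol (Var v' * Var w') v w)
        = (\<Sum>v\<in>?B. \<Sum>w\<in>?B. (if w = w' then if v = v' then h v w else 0 else 0)
        + (if w = v' then if v = w' then h v w else 0 else 0))"
        unfolding pol_Var_Var by (intro sum.cong refl) (auto simp: algebra_simps)
      also have "\<dots> = (\<Sum>v\<in>?B. (if v = v' then h v w' else 0) + (if v = w' then h v v' else 0))"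
        by (intro sum.cong refl, subst sum.distrib) (use vw in \<open>simp add: sum.delta\<close>)
      finally show ?thesis using vw by (simp add: sum.distrib sum.delta)
    qed
    then show ?thesis by simp
  qed
  also have "\<dots> = (\<Sum>v\<in>?B. \<Sum>w\<in>?B. act_coeff n g v' v * act_coeff n g w' w * pol (Var a * Var b) v w)"
    unfolding 1 by (simp add: mult.commute)
  finally have e: "pol (S_act n g (Var a * Var b)) v' w'
    = (\<Sum>v\<in>?B. \<Sum>w\<in>?B. act_coeff n g v' v * act_coeff n g w' w * pol (Var a * Var b) v w)" .
  have "pol (S_act n g (pm_scale c (Var a * Var b) + y)) v' w'
     = c * pol (S_act n g (Var a * Var b)) v' w' + pol (S_act n g y) v' w'"
    by (simp add: plin_add[OF plin_S_act] plin_scale[OF plin_S_act] pol_add pol_scale)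
  also have "\<dots> = (\<Sum>v\<in>?B. \<Sum>w\<in>?B. act_coeff n g v' v * act_coeff n g w' w * pol (pm_scale c (Var a * Var b) + y) v w)"
    unfolding e step.IH pol_add pol_scale distrib_left sum.distrib sum_distrib_left
    by (simp only: mult.left_commute)
  finally show ?case .
qed

lemma act_coeff_mult:
  assumes "g \<in> carrier (GG m n)" "h \<in> carrier (GG m n)" "v' \<in> brackets t m n" "v \<in> brackets t m n"
  shows "act_coeff n (g \<otimes>\<^bsub>GG m n\<^esub> h) v' v = (\<Sum>w\<in>brackets t m n. act_coeff n g v' w * act_coeff n h w v)"
proof -
  obtain a b a' b' where ab: "g = (a, b)" "h = (a', b')" by (cases g, cases h)
  obtain I H I' H' where IH: "v = (I, H)" "v' = (I', H')" by (cases v, cases v')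
  have c: "a \<in> carrier_mat m m" "contragredient n b \<in> carrier_mat n n" "a' \<in> carrier_mat m m" "contragredient n b' \<in> carrier_mat n n"
    "b \<in> carrier (GL n)" "b' \<in> carrier (GL n)"
    using assms(1,2) unfolding ab by (auto simp: GG_carrier GL_carrier_mat contragredient_GL)
  have "act_coeff n (g \<otimes>\<^bsub>GG m n\<^esub> h) v' v = mnr (mat_fun (a * a')) I' I * mnr (mat_fun (contragredient n b * contragredient n b')) H' H"
    by (simp add: act_coeff_def ab GG_mult IH contragredient_mult c)
  also have "\<dots> = (\<Sum>J\<in>subsets_of_size m t. \<Sum>K\<in>subsets_of_size n t.
      (mnr (mat_fun a) I' J * mnr (mat_fun a') J I) * (mnr (mat_fun (contragredient n b)) H' K * mnr (mat_fun (contragredient n b')) K H))"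
    using assms(3,4) IH c by (subst (1 2) mnr_mat_fun_mult) (auto simp: brackets_def sum_product)
  also have "\<dots> = (\<Sum>w\<in>brackets t m n. act_coeff n g v' w * act_coeff n h w v)"
    unfolding brackets_def sum.cartesian_product
    by (intro sum.cong refl) (auto simp: act_coeff_def ab IH)
  finally show ?thesis .
qed

lemma act_coeff_one:
  assumes "v' \<in> brackets t m n" "v \<in> brackets t m n"
  shows "act_coeff n \<one>\<^bsub>GG m n\<^esub> v' v = of_bool (v' = v)"
  using assms by (auto simp: act_coeff_def GG_one brackets_def contragredient_one mnr_mat_fun_one)

definition gtrans :: "'k mat \<times> 'k mat \<Rightarrow> 'k mat \<times> 'k mat" where
  "gtrans g = (transpose_mat (fst g), transpose_mat (snd g))"

lemma gtrans_GG: "g \<in> carrier (GG m n) \<Longrightarrow> gtrans g \<in> carrier (GG m n)"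
  by (cases g) (simp add: gtrans_def GG_carrier GL_transpose)

text \<open>Compound matrices and contragredients are both compatible with transposition.\<close>

lemma act_coeff_gtrans:
  assumes "g \<in> carrier (GG m n)" "v' \<in> brackets t m n" "v \<in> brackets t m n"
  shows "act_coeff n (gtrans g) v' v = act_coeff n g v v'"
proof -
  have c: "fst g \<in> carrier_mat m m" "contragredient n (snd g) \<in> carrier_mat n n" "snd g \<in> carrier (GL n)"
    using assms(1) by (cases g, simp add: GG_carrier GL_carrier_mat contragredient_GL)+
  show ?thesis
    using assms(2,3) mnr_mat_fun_transpose[OF c(1), of "fst v'" t "fst v"]
      mnr_mat_fun_transpose[OF c(2), of "snd v'" t "snd v"]
    by (auto simp: act_coeff_def gtrans_def brackets_def contragredient_transpose[OF c(3)])
qed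

lemma S_act_one:
  assumes "x \<in> quad (brackets t m n)"
  shows "S_act n \<one>\<^bsub>GG m n\<^esub> x = (x :: 'k::field minor_poly)"
proof -
  have one: "\<one>\<^bsub>GG m n\<^esub> \<in> carrier (GG m n)" by (simp add: group.is_monoid[OF group_GG] monoid.one_closed)
  have "S_act n \<one>\<^bsub>GG m n\<^esub> (Var v) = (Var v :: 'k minor_poly)" if "v \<in> brackets t m n" for v
  proof -
    have "S_act n \<one>\<^bsub>GG m n\<^esub> (Var v) = (\<Sum>v'\<in>brackets t m n. if v' = v then Var v' else 0 :: 'k minor_poly)"
      unfolding S_act_Var[OF one that] by (intro sum.cong refl) (auto simp: act_coeff_one that)
    then show ?thesis using that by simp
  qed
  then show ?thesis
    by (intro quad_plin_eqI[OF assms plin_S_act plin_id]) (simp add: S_act_mult)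
qed

lemma S_act_comp:
  assumes "x \<in> quad (brackets t m n)" and g: "g \<in> carrier (GG m n)" and h: "h \<in> carrier (GG m n)"
  shows "S_act n (g \<otimes>\<^bsub>GG m n\<^esub> h) x = S_act n g (S_act n h (x :: 'k::field minor_poly))"
proof -
  have gh: "g \<otimes>\<^bsub>GG m n\<^esub> h \<in> carrier (GG m n)"
    using g h by (simp add: group.is_monoid[OF group_GG] monoid.m_closed)
  have "S_act n (g \<otimes>\<^bsub>GG m n\<^esub> h) (Var v) = S_act n g (S_act n h (Var v :: 'k minor_poly))" if v: "v \<in> brackets t m n" for v
  proof -
    have "S_act n g (S_act n h (Var v)) = (\<Sum>w\<in>brackets t m n. \<Sum>v'\<in>brackets t m n.
        pm_scale (act_coeff n h w v * act_coeff n g v' w) (Var v') :: 'k minor_poly)"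
      unfolding S_act_Var[OF h v] plin_sum[OF plin_S_act] plin_scale[OF plin_S_act]
      by (intro sum.cong refl) (simp add: S_act_Var[OF g] pm.scale_sum_right)
    also have "\<dots> = (\<Sum>v'\<in>brackets t m n. pm_scale (\<Sum>w\<in>brackets t m n. act_coeff n g v' w * act_coeff n h w v) (Var v'))"
      by (subst sum.swap) (simp add: pm.scale_sum_left mult.commute)
    also have "\<dots> = S_act n (g \<otimes>\<^bsub>GG m n\<^esub> h) (Var v)"
      unfolding S_act_Var[OF gh v] by (intro sum.cong refl) (simp add: act_coeff_mult[OF g h _ v])
    finally show ?thesis by simp
  qed
  then show ?thesis
    by (intro quad_plin_eqI[OF assms(1) plin_S_act plin_comp[OF plin_S_act plin_S_act]])
      (simp add: S_act_mult)
qed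

lemma gsubmodule_quadI:
  assumes "pm.subspace N" "N \<subseteq> quad (brackets t m n)"
    "\<And>g x. g \<in> carrier (GG m n) \<Longrightarrow> x \<in> N \<Longrightarrow> S_act n g x \<in> N"
  shows "gmodule (GG m n) (S_act n) (N :: 'k::field minor_poly set)"
  unfolding gmodule_def
proof (intro conjI ballI allI)
  show "S_act n \<one>\<^bsub>GG m n\<^esub> x = x" if "x \<in> N" for x
    using that assms(2) by (intro S_act_one) blast
  show "S_act n (g \<otimes>\<^bsub>GG m n\<^esub> h) x = S_act n g (S_act n h x)"
    if "g \<in> carrier (GG m n)" "h \<in> carrier (GG m n)" "x \<in> N" for g h x
    using that assms(2) by (intro S_act_comp[where t = t]) auto
qed (auto simp: assms plin_add[OF plin_S_act] plin_scale[OF plin_S_act])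

text \<open>The standard dot product of the polarised coefficient arrays. It need not be anisotropic
  over the given field.\<close>

definition form :: "'v set \<Rightarrow> ('v, 'k::field) mpoly \<Rightarrow> ('v, 'k) mpoly \<Rightarrow> 'k" where
  "form B x y = (\<Sum>v\<in>B. \<Sum>w\<in>B. pol x v w * pol y v w)"

text \<open>The adjoint of g is its transpose, which again lies in the group. This makes orthogonal
  complements of submodules stable.\<close>

lemma form_S_act:
  assumes g: "g \<in> carrier (GG m n)" and x: "x \<in> quad (brackets t m n)" and y: "y \<in> quad (brackets t m n)"
  shows "form (brackets t m n) (S_act n g x) y = form (brackets t m n) x (S_act n (gtrans g) y)"
proof -
  let ?B = "brackets t m n"
  have "form ?B (S_act n g x) y
      = (\<Sum>(v', w')\<in>?B \<times> ?B. \<Sum>(v, w)\<in>?B \<times> ?B. act_coeff n g v' v * act_coeff n g w' w * pol x v w * pol y v' w')"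
    unfolding form_def sum.cartesian_product
    by (intro sum.cong refl) (auto simp: pol_S_act[OF g x] sum_distrib_right sum.cartesian_product case_prod_unfold)
  also have "\<dots> = (\<Sum>(v, w)\<in>?B \<times> ?B. \<Sum>(v', w')\<in>?B \<times> ?B. act_coeff n g v' v * act_coeff n g w' w * pol x v w * pol y v' w')"
    unfolding case_prod_unfold by (rule sum.swap)
  also have "\<dots> = (\<Sum>(v, w)\<in>?B \<times> ?B. pol x v w * (\<Sum>(v', w')\<in>?B \<times> ?B.
      act_coeff n (gtrans g) v v' * act_coeff n (gtrans g) w w' * pol y v' w'))"
    by (intro sum.cong refl)
      (auto simp: sum_distrib_left act_coeff_gtrans[OF g] case_prod_unfold mult_ac intro!: sum.cong)
  also have "\<dots> = form ?B x (S_act n (gtrans g) y)"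
    unfolding form_def sum.cartesian_product
    by (intro sum.cong refl) (auto simp: pol_S_act[OF gtrans_GG[OF g] y] sum.cartesian_product)
  finally show ?thesis .
qed

section \<open>Equivariance of the minors\<close>

definition const_poly :: "'k::field \<Rightarrow> ('v, 'k) mpoly" where "const_poly c = single 0 c"

lemma pm_scale_const_poly: "pm_scale c p = const_poly c * p"
  by (simp add: pm_scale_def const_poly_def mult_map_scale_conv_mult)

lemma const_poly_hom: "comm_ring_hom (const_poly :: 'k::field \<Rightarrow> ('v, 'k) mpoly)"
  by unfold_locales (simp_all add: const_poly_def single_add mult_single)

lemma const_poly_mult: "const_poly (a * b) = const_poly a * const_poly b"
  by (simp add: const_poly_def mult_single)

lemma const_poly_sign: "const_poly ((-1) ^ k) = (-1) ^ k"
  by (simp add: minus_one_power_iff const_poly_def single_uminus)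

lemma const_poly_of_nat: "const_poly (of_nat k) = of_nat k"
  by (simp add: const_poly_def)

lemma alg_ext_const_poly: "alg_ext h (const_poly c :: ('v, 'k::field) mpoly) = (const_poly c :: ('w, 'k) mpoly)"
proof -
  have e: "(const_poly c :: ('v, 'k) mpoly) = pm_scale c (bvec 0)" by (simp add: const_poly_def single_eq_scale[symmetric])
  have "alg_ext h (const_poly c) = pm_scale c (mono_val h 0)"
    unfolding e by (simp only: plin_scale[OF plin_alg_ext] alg_ext_bvec)
  then show ?thesis by (simp add: mono_val_def pm_scale_const_poly)
qed

text \<open>\<open>hvec\<close> takes values in any commutative ring; its polynomial version is the
  constant polynomial of the scalar version, so it can be pulled out of algebra maps.\<close>

lemma hvec_const_poly: "hvec a b p I J = const_poly (hvec a b p I J)"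
  by (simp add: hvec_def const_poly_def single_uminus minus_one_power_iff)

lemma msign_const_poly: "msign I J j = const_poly (msign I J j)"
  by (simp add: msign_def const_poly_def single_uminus minus_one_power_iff)

abbreviation genX :: "nat \<Rightarrow> nat \<Rightarrow> (nat \<times> nat, 'k::field) mpoly" where
  "genX i j \<equiv> Var (i, j)"

lemma minor_mnr: "minor I J = mnr genX I J"
  by (simp add: minor_def mnr_def)

lemma sorted_list_of_set_lessThan: "sorted_list_of_set {..<n} = [0..<n]" for n :: nat
  by (simp add: lessThan_atLeast0)

lemma schur_row_mnr: "schur_row I = mnr genX I {..<card I}"
  unfolding schur_row_def mnr_def
  by (intro arg_cong[of _ _ det] eq_matI) (auto simp: sorted_list_of_set_lessThan)

lemma mnr_cst': "mnr (\<lambda>i j. const_poly (M i j) :: ('v, 'k::field) mpoly) I J = const_poly (mnr M I J)"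
  by (rule mnr_hom[OF const_poly_hom, symmetric])

lemma mnr_const_poly: "mnr (\<lambda>i j. const_poly (M j i) :: ('v, 'k::field) mpoly) I J = const_poly (mnr M J I)"
  by (subst mnr_transpose[symmetric]) (rule mnr_cst')

lemma std_act_bvec:
  "std_act a (bvec i) = (\<Sum>k<dim_row a. pm_scale (mat_fun a k i) (bvec k))" for a :: "'k::field mat"
  by (simp add: std_act_def mat_fun_def single_eq_scale[symmetric])

lemma plin_schur_map: "plin (schur_map T)"
  unfolding schur_map_def by (rule plin_sym_map)

lemma schur_map_hom: "comm_ring_hom (schur_map T :: (nat \<times> nat, 'k::field) mpoly \<Rightarrow> _)"
  unfolding schur_map_def sym_map_def by (rule alg_ext_hom)

lemma schur_map_mult: "schur_map T (p * q) = schur_map T p * schur_map T (q :: (nat \<times> nat, 'k::field) mpoly)"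
  unfolding schur_map_def sym_map_def by (rule alg_ext_mult)

lemma schur_map_const_poly: "schur_map T (const_poly c) = const_poly c"
  unfolding schur_map_def sym_map_def by (rule alg_ext_const_poly)

lemma schur_map_genX:
  "schur_map (std_act a) (genX i c) = (\<Sum>k<dim_row a. const_poly (mat_fun a k i) * (genX k c :: (_, 'k::field) mpoly))"
proof -
  have "schur_map (std_act a) (genX i c) = lin_ext Var (tensor (std_act a (bvec i)) (bvec c :: nat \<Rightarrow>\<^sub>0 'k))"
    by (simp add: schur_map_def sym_map_def tensor_map_def)
  also have "\<dots> = (\<Sum>k<dim_row a. pm_scale (mat_fun a k i) (genX k c))"
    by (simp add: std_act_bvec plin_sum[OF plin_tensor_left] plin_sum[OF plin_lin_ext]
        plin_scale[OF plin_tensor_left] plin_scale[OF plin_lin_ext] tensor_bvec)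
  finally show ?thesis by (simp add: pm_scale_const_poly)
qed

text \<open>The map replaces the generic matrix X by the product of the transpose of
  \<open>a\<close> with X, so Cauchy-Binet gives the row coefficients.\<close>

lemma schur_map_mnr:
  assumes a: "a \<in> carrier_mat m m" and I: "I \<in> subsets_of_size m t" and C: "finite C"
  shows "schur_map (std_act a) (mnr genX I C)
    = (\<Sum>K\<in>subsets_of_size m t. const_poly (mnr (mat_fun a) K I) * (mnr genX K C :: (_, 'k::field) mpoly))"
proof (cases "card C = t")
  case True
  have I': "finite I" "card I = t" using I by (auto dest: subsets_of_size_finite subsets_of_size_card)
  have "schur_map (std_act a) (mnr genX I C) = mnr (\<lambda>i c. \<Sum>k<m. const_poly (mat_fun a k i) * (genX k c :: (_, 'k) mpoly)) I C"
    unfolding mnr_hom[OF schur_map_hom] schur_map_genX using a by simp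
  also have "\<dots> = (\<Sum>K\<in>subsets_of_size m t. mnr (\<lambda>i k. const_poly (mat_fun a k i)) I K * mnr genX K C)"
    by (rule Cauchy_Binet[OF I'(1) C I'(2) True])
  finally show ?thesis by (simp add: mnr_const_poly)
next
  case False
  have "mnr genX I C = (0 :: (_, 'k) mpoly)" using I False by (auto simp: mnr_nonsquare subsets_of_size_def)
  moreover have "mnr genX K C = (0 :: (_, 'k) mpoly)" if "K \<in> subsets_of_size m t" for K
    using that False by (auto simp: mnr_nonsquare subsets_of_size_def)
  ultimately show ?thesis by (simp add: plin_0[OF plin_schur_map])
qed

text \<open>The substitution of A X B for the generic matrix X, with A the transpose of the first
  component and B the contragredient of the second. It is chosen so that minors transform like
  brackets.\<close>

definition act_X :: "nat \<Rightarrow> nat \<Rightarrow> 'k::field mat \<times> 'k mat \<Rightarrow> (nat \<times> nat, 'k) mpoly \<Rightarrow> (nat \<times> nat, 'k) mpoly" where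
  "act_X m n g = alg_ext (\<lambda>(i, j). \<Sum>k<m. const_poly (mat_fun (fst g) k i) * (\<Sum>l<n. genX k l * const_poly (mat_fun (contragredient n (snd g)) l j)))"

lemma act_X_minor:
  assumes I: "I \<in> subsets_of_size m t" and H: "H \<in> subsets_of_size n t"
  shows "act_X m n g (minor I H) = (\<Sum>v\<in>brackets t m n. pm_scale (act_coeff n g v (I, H)) (minor (fst v) (snd v) :: (_, 'k::field) mpoly))"
proof -
  have I': "finite I" "card I = t" "finite H" "card H = t"
    using I H by (auto dest: subsets_of_size_finite subsets_of_size_card)
  have "act_X m n g (minor I H) = mnr (\<lambda>i j. \<Sum>k<m. const_poly (mat_fun (fst g) k i) *
      (\<Sum>l<n. genX k l * const_poly (mat_fun (contragredient n (snd g)) l j)) :: (_, 'k) mpoly) I H"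
    unfolding minor_mnr act_X_def mnr_hom[OF alg_ext_hom] by simp
  also have "\<dots> = (\<Sum>K\<in>subsets_of_size m t. mnr (\<lambda>i k. const_poly (mat_fun (fst g) k i)) I K *
      mnr (\<lambda>k j. \<Sum>l<n. genX k l * const_poly (mat_fun (contragredient n (snd g)) l j)) K H)"
    by (rule Cauchy_Binet[OF I'(1,3,2,4)])
  also have "\<dots> = (\<Sum>K\<in>subsets_of_size m t. \<Sum>L\<in>subsets_of_size n t.
     const_poly (mnr (mat_fun (fst g)) K I) * (mnr genX K L * const_poly (mnr (mat_fun (contragredient n (snd g))) L H)))"
  proof (rule sum.cong[OF refl])
    fix K assume "K \<in> subsets_of_size m t"
    then have K: "finite K" "card K = t" by (auto dest: subsets_of_size_finite subsets_of_size_card)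
    show "mnr (\<lambda>i k. const_poly (mat_fun (fst g) k i)) I K * mnr (\<lambda>k j. \<Sum>l<n. genX k l * const_poly (mat_fun (contragredient n (snd g)) l j)) K H
      = (\<Sum>L\<in>subsets_of_size n t. const_poly (mnr (mat_fun (fst g)) K I) * (mnr genX K L * (const_poly (mnr (mat_fun (contragredient n (snd g))) L H) :: (_, 'k) mpoly)))"
      unfolding Cauchy_Binet[OF K(1) I'(3) K(2) I'(4)] mnr_const_poly[of "mat_fun (fst g)"]
      unfolding mnr_cst'
      by (rule sum_distrib_left)
  qed
  also have "\<dots> = (\<Sum>v\<in>brackets t m n. pm_scale (act_coeff n g v (I, H)) (minor (fst v) (snd v)))"
    unfolding brackets_def sum.cartesian_product
    by (intro sum.cong refl)
      (auto simp: act_coeff_def minor_mnr pm_scale_const_poly const_poly_mult mult_ac)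
  finally show ?thesis .
qed

lemma pi_map_Var: "pi_map (Var v) = minor (fst v) (snd v)"
  by (simp add: pi_map_def case_prod_unfold)

lemma pi_map_mult: "pi_map (x * y) = pi_map x * pi_map (y :: 'k::field minor_poly)"
  unfolding pi_map_def by (rule alg_ext_mult)

lemma plin_pi_map: "plin (pi_map :: 'k::field minor_poly \<Rightarrow> _)"
  unfolding pi_map_def by (rule plin_alg_ext)

lemma plin_act_X: "plin (act_X m n g)"
  unfolding act_X_def by (rule plin_alg_ext)

text \<open>Both sides are multiplicative, so a single bracket suffices, where this is
  \<open>act_X_minor\<close>. The kernel of \<open>pi_map\<close> in degree two is thereby
  stable.\<close>

lemma pi_map_S_act:
  assumes g: "g \<in> carrier (GG m n)" and x: "x \<in> quad (brackets t m n)"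
  shows "pi_map (S_act n g x) = act_X m n g (pi_map (x :: 'k::field minor_poly))"
proof (rule quad_plin_eqI[OF x])
  show "plin (\<lambda>x. pi_map (S_act n g x) :: (_, 'k) mpoly)" by (rule plin_comp[OF plin_pi_map plin_S_act])
  show "plin (\<lambda>x. act_X m n g (pi_map (x :: 'k minor_poly)))" by (rule plin_comp[OF plin_act_X plin_pi_map])
  have "pi_map (S_act n g (Var v)) = act_X m n g (pi_map (Var v :: 'k minor_poly))" if v: "v \<in> brackets t m n" for v
  proof -
    have "fst v \<in> subsets_of_size m t" "snd v \<in> subsets_of_size n t" using v by (auto simp: brackets_def)
    from act_X_minor[OF this, of g] show ?thesis
      by (simp add: S_act_Var[OF g v] plin_sum[OF plin_pi_map] plin_scale[OF plin_pi_map] pi_map_Var)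
  qed
  then show "pi_map (S_act n g (Var v * Var w)) = act_X m n g (pi_map (Var v * Var w :: 'k minor_poly))"
    if "v \<in> brackets t m n" "w \<in> brackets t m n" for v w
    using that by (simp add: S_act_mult pi_map_mult) (simp add: act_X_def alg_ext_mult)
qed

lemma J_deg2_eq: "J_deg2 t m n = {x \<in> quad (brackets t m n). pi_map x = (0 :: (_, 'k::field) mpoly)}"
  by (auto simp: J_deg2_def J_ideal_def S_space_def quad_def brackets_def)

lemma pi_map_unpol:
  assumes "x \<in> quad (brackets t m n)"
  shows "pm_scale 2 (pi_map x) = unpol (brackets t m n) (\<lambda>v w. minor (fst v) (snd v) * minor (fst w) (snd w)) (x :: 'k::field minor_poly)"
proof -
  have "pm_scale 2 (pi_map x) = pi_map (unpol (brackets t m n) (\<lambda>v w. Var v * Var w) x)"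
    by (simp add: unpol_Var[OF finite_brackets assms] plin_scale[OF plin_pi_map])
  then show ?thesis
    by (simp add: unpol_def plin_sum[OF plin_pi_map] plin_scale[OF plin_pi_map] pi_map_mult pi_map_Var)
qed


section \<open>The projections to the Schur modules\<close>

text \<open>The bound 2 * t on the columns contains every {..<t + u} with u \<le> t. At p = t + u
  the values are the generators of the Schur module, at p = t they live on pairs of t-sets as needed
  for brackets.\<close>

definition Phi :: "nat \<Rightarrow> nat \<Rightarrow> nat \<Rightarrow> nat set \<Rightarrow> nat set \<Rightarrow> (nat \<times> nat, 'k::field) mpoly" where
  "Phi t u p = bi_minor genX (2 * t) (hvec (t - u) (t + u) p)"

lemma sum_swap_pairs:
  "(\<Sum>a\<in>A. \<Sum>b\<in>B. \<Sum>c\<in>C. \<Sum>d\<in>D. f a b c d) = (\<Sum>c\<in>C. \<Sum>d\<in>D. \<Sum>a\<in>A. \<Sum>b\<in>B. f a b c d)"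
proof -
  have "(\<Sum>x\<in>A \<times> B. \<Sum>y\<in>C \<times> D. f (fst x) (snd x) (fst y) (snd y))
    = (\<Sum>y\<in>C \<times> D. \<Sum>x\<in>A \<times> B. f (fst x) (snd x) (fst y) (snd y))" by (rule sum.swap)
  then show ?thesis by (simp add: sum.cartesian_product')
qed

text \<open>The action changes row sets only, while \<open>hvec\<close> involves column sets only,
  so the two sums can be interchanged.\<close>

lemma schur_map_Phi:
  assumes a: "a \<in> carrier_mat m m" and I: "I \<in> subsets_of_size m t" "J \<in> subsets_of_size m t"
  shows "schur_map (std_act a) (Phi t u p I J) = (\<Sum>K\<in>subsets_of_size m t. \<Sum>L\<in>subsets_of_size m t.
    pm_scale (mnr (mat_fun a) K I * mnr (mat_fun a) L J) (Phi t u p K L :: (_, 'k::field) mpoly))"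
proof -
  let ?P = "Pow {..<2 * t}" and ?h = "hvec (t - u) (t + u) p" and ?B = "subsets_of_size m t"
  have "schur_map (std_act a) (Phi t u p I J) = (\<Sum>C\<in>?P. \<Sum>D\<in>?P. ?h C D *
     ((\<Sum>K\<in>?B. const_poly (mnr (mat_fun a) K I) * mnr genX K C) * (\<Sum>L\<in>?B. const_poly (mnr (mat_fun a) L J) * (mnr genX L D :: (_, 'k) mpoly))))"
    unfolding Phi_def bi_minor_def pairing_def plin_sum[OF plin_schur_map]
  proof (intro sum.cong refl)
    fix C D assume "C \<in> ?P" "D \<in> ?P"
    then have "finite C" "finite D" by (auto intro: finite_subset[OF _ finite_lessThan])
    then show "schur_map (std_act a) (?h C D * (mnr genX I C * mnr genX J D)) = ?h C D *
     ((\<Sum>K\<in>?B. const_poly (mnr (mat_fun a) K I) * mnr genX K C) * (\<Sum>L\<in>?B. const_poly (mnr (mat_fun a) L J) * (mnr genX L D :: (_, 'k) mpoly)))"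
      by (subst (1 2) hvec_const_poly)
        (simp add: schur_map_mult schur_map_const_poly schur_map_mnr[OF a I(1)] schur_map_mnr[OF a I(2)])
  qed
  also have "\<dots> = (\<Sum>C\<in>?P. \<Sum>D\<in>?P. \<Sum>K\<in>?B. \<Sum>L\<in>?B.
      const_poly (mnr (mat_fun a) K I * mnr (mat_fun a) L J) * (?h C D * (mnr genX K C * mnr genX L D)))"
    unfolding sum_product
    unfolding sum_distrib_left
    by (intro sum.cong refl) (simp only: const_poly_mult mult_ac)
  also have "\<dots> = (\<Sum>K\<in>?B. \<Sum>L\<in>?B. \<Sum>C\<in>?P. \<Sum>D\<in>?P.
      const_poly (mnr (mat_fun a) K I * mnr (mat_fun a) L J) * (?h C D * (mnr genX K C * mnr genX L D)))"
    by (rule sum_swap_pairs)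
  finally show ?thesis
    by (simp only: Phi_def bi_minor_def pairing_def pm_scale_const_poly sum_distrib_left)
qed

lemma Phi_top: "u \<le> t \<Longrightarrow> Phi t u (t + u) I J = mnr genX I {..<t + u} * mnr genX J {..<t - u}"
  unfolding Phi_def by (rule bi_minor_hvec_top) auto

lemma Phi_beyond: "t + u < p \<Longrightarrow> Phi t u p I J = 0"
  by (simp add: Phi_def bi_minor_def pairing_def hvec_beyond)

lemma Phi_swap: "u \<le> t \<Longrightarrow> Phi t u t J I = (-1) ^ u * Phi t u t I J"
  unfolding Phi_def by (rule bi_minor_hvec_swap) auto

lemma Uop_Phi: "finite I \<Longrightarrow> finite J \<Longrightarrow>
    Uop (Phi t u (Suc p)) I J = (-1) ^ (t - u) * of_nat (t + u - p) * Phi t u p I J"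
  unfolding Phi_def by (rule Uop_bi_minor_hvec)

lemma Dop_Phi: "finite I \<Longrightarrow> finite J \<Longrightarrow>
    Dop (Phi t u p) I J = (-1) ^ (t - u) * of_nat (Suc p - (t - u)) * Phi t u (Suc p) I J"
  unfolding Phi_def by (rule Dop_bi_minor_hvec)

text \<open>In the support of the middle member of the string both column sets have t
  elements.\<close>

lemma Phi_nonsquare:
  assumes "card I \<noteq> t \<or> card J \<noteq> t" "u \<le> t"
  shows "Phi t u t I J = 0"
proof -
  have "hvec (t - u) (t + u) t C D * (mnr genX I C * mnr genX J D) = (0 :: (nat \<times> nat, 'a) mpoly)" for C D
  proof (cases "card C = t \<and> C \<inter> D = {..<t - u} \<and> C \<union> D = {..<t + u}")
    case True
    then have "finite C" "finite D" by (metis finite_Un finite_lessThan)+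
    then have "card D = t" using card_Un_Int[of C D] True assms by simp
    from assms(1) have "mnr genX I C = (0 :: (nat \<times> nat, 'a) mpoly) \<or> mnr genX J D = (0 :: (nat \<times> nat, 'a) mpoly)"
    proof
      assume "card I \<noteq> t"
      then have "mnr genX I C = (0 :: (nat \<times> nat, 'a) mpoly)" using True by (intro mnr_nonsquare) simp
      then show ?thesis ..
    next
      assume "card J \<noteq> t"
      then have "mnr genX J D = (0 :: (nat \<times> nat, 'a) mpoly)" using \<open>card D = t\<close> by (intro mnr_nonsquare) simp
      then show ?thesis ..
    qed
    then show ?thesis by auto
  next
    case False
    then show ?thesis by (simp only: hvec_def if_False) simp
  qed
  then show ?thesis by (simp add: Phi_def bi_minor_def pairing_def)
qed

text \<open>Division by a nonzero integer, the form in which characteristic 0 enters the arguments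
  along strings.\<close>

lemma sign_of_nat_cancel:
  assumes "(-1) ^ k * of_nat c * p \<in> S" "pm.subspace S" "c > 0"
  shows "p \<in> (S :: ('v, 'k::field_char_0) mpoly set)"
proof -
  let ?c = "(-1) ^ k * of_nat c :: 'k"
  have c: "inverse ?c * ?c = 1" using assms(3) by (intro left_inverse) simp
  have "(-1) ^ k * of_nat c * p = pm_scale ?c p"
    by (simp only: pm_scale_const_poly const_poly_mult const_poly_sign const_poly_of_nat)
  then have "pm_scale ?c p \<in> S" using assms(1) by simp
  then have "pm_scale (inverse ?c) (pm_scale ?c p) \<in> S" by (rule pm.subspace_scale[OF assms(2)])
  then show ?thesis by (simp only: pm.scale_scale c pm.scale_one)
qed

lemma Uop_mem:
  assumes "pm.subspace S" "I \<subseteq> A" "J \<subseteq> A" "\<And>I J. I \<subseteq> A \<Longrightarrow> J \<subseteq> A \<Longrightarrow> z I J \<in> S"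
  shows "Uop z I J \<in> (S :: ('v, 'k::field) mpoly set)"
  unfolding Uop_def msign_const_poly pm_scale_const_poly[symmetric]
  by (intro pm.subspace_sum pm.subspace_scale assms) (use assms in auto)

lemma Dop_mem:
  assumes "pm.subspace S" "I \<subseteq> A" "J \<subseteq> A" "\<And>I J. I \<subseteq> A \<Longrightarrow> J \<subseteq> A \<Longrightarrow> z I J \<in> S"
  shows "Dop z I J \<in> (S :: ('v, 'k::field) mpoly set)"
  unfolding Dop_def msign_const_poly pm_scale_const_poly[symmetric]
  by (intro pm.subspace_sum pm.subspace_scale assms) (use assms in auto)

lemma schur_module_tau:
  "schur_module d (tau t u) = pm.span {schur_row I * schur_row J |I J.
     I \<in> subsets_of_size d (t + u) \<and> J \<in> subsets_of_size d (t - u)}"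
proof -
  have "{\<Prod>r<length (tau t u). schur_row (R r) |R. \<forall>r<length (tau t u). R r \<in> subsets_of_size d (tau t u ! r)}
    = {schur_row I * schur_row J :: (nat \<times> nat, 'a) mpoly |I J. I \<in> subsets_of_size d (t + u) \<and> J \<in> subsets_of_size d (t - u)}"
    (is "?A = ?B")
  proof (intro equalityI subsetI)
    fix x assume "x \<in> ?A"
    then obtain R where R: "x = (\<Prod>r<2. schur_row (R r))"
      "\<forall>r<2. R r \<in> subsets_of_size d ([t + u, t - u] ! r)" by (auto simp: tau_def numeral_2_eq_2)
    have "R 0 \<in> subsets_of_size d (t + u)" "R 1 \<in> subsets_of_size d (t - u)"
      using R(2)[rule_format, of 0] R(2)[rule_format, of 1] by (auto simp: One_nat_def)
    moreover have "x = schur_row (R 0) * schur_row (R 1)"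
      unfolding R(1) by (simp add: numeral_2_eq_2 lessThan_Suc mult.commute One_nat_def)
    ultimately show "x \<in> ?B" by blast
  next
    fix x assume "x \<in> ?B"
    then obtain I J where IJ: "x = schur_row I * schur_row J" "I \<in> subsets_of_size d (t + u)"
      "J \<in> subsets_of_size d (t - u)" by blast
    let ?R = "\<lambda>r. if r = 0 then I else J"
    have "x = (\<Prod>r<length (tau t u). schur_row (?R r))"
      by (simp add: IJ tau_def numeral_2_eq_2 lessThan_Suc mult.commute)
    moreover have "\<forall>r<length (tau t u). ?R r \<in> subsets_of_size d (tau t u ! r)"
      using IJ by (auto simp: tau_def less_Suc_eq nth_Cons')
    ultimately show "x \<in> ?A" by (auto intro: exI[of _ ?R])
  qed
  then show ?thesis by (simp add: schur_module_def)
qed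

text \<open>The sl2-operators connect the two ends t + u and t of the string with nonzero integer
  factors, so the values of \<open>Phi\<close> at either end span the same space. Intermediate
  values are taken at row sets of arbitrary sizes.\<close>

lemma schur_module_span_Phi:
  assumes u: "u \<le> t"
  shows "schur_module m (tau t u) = pm.span {Phi t u t I J :: (_, 'k::field_char_0) mpoly |I J.
    I \<in> subsets_of_size m t \<and> J \<in> subsets_of_size m t}"
proof (intro equalityI)
  let ?L = "schur_module m (tau t u) :: (_, 'k) mpoly set"
  let ?P = "pm.span {Phi t u t I J :: (_, 'k) mpoly |I J. I \<in> subsets_of_size m t \<and> J \<in> subsets_of_size m t}"
  have subL: "pm.subspace ?L" by (simp add: schur_module_tau)
  \<comment> \<open>Descent from p = t + u, where the values are products of two Schur rows, by
    means of \<open>Uop\<close>.\<close>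
  have L: "Phi t u p I J \<in> ?L" if "p \<le> t + u" "I \<subseteq> {..<m}" "J \<subseteq> {..<m}" for p I J
    using that
  proof (induction arbitrary: I J rule: inc_induct)
    case base
    show ?case
    proof (cases "card I = t + u \<and> card J = t - u")
      case True
      then have "schur_row I * schur_row J \<in> ?L" unfolding schur_module_tau
        using base by (intro pm.span_base) (auto simp: subsets_of_size_def)
      then show ?thesis using True by (simp add: Phi_top[OF u] schur_row_mnr)
    next
      case False
      then have "Phi t u (t + u) I J = (0 :: (_, 'k) mpoly)"
        by (auto simp: Phi_top[OF u] mnr_nonsquare)
      then show ?thesis by (simp add: pm.subspace_0[OF subL])
    qed
  next
    case (step p)
    have fin: "finite I" "finite J" using step.prems by (auto intro: finite_subset)
    have "Uop (Phi t u (Suc p)) I J \<in> ?L"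
      by (rule Uop_mem[OF subL step.prems]) (rule step.IH)
    then show ?case unfolding Uop_Phi[OF fin] using step.hyps
      by - (erule sign_of_nat_cancel[OF _ subL], simp)
  qed
  show "?P \<subseteq> ?L"
  proof (rule pm.span_minimal[OF _ subL], rule subsetI)
    fix x assume "x \<in> {Phi t u t I J :: (_, 'k) mpoly |I J. I \<in> subsets_of_size m t \<and> J \<in> subsets_of_size m t}"
    then obtain I J where "x = Phi t u t I J" "I \<subseteq> {..<m}" "J \<subseteq> {..<m}" by (auto simp: subsets_of_size_def)
    then show "x \<in> ?L" using L[of t I J] by simp
  qed
  \<comment> \<open>Ascent from p = t by means of \<open>Dop\<close>.\<close>
  have P: "Phi t u p I J \<in> ?P" if "t \<le> p" "I \<subseteq> {..<m}" "J \<subseteq> {..<m}" for p I J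
    using that
  proof (induction arbitrary: I J rule: dec_induct)
    case base
    show ?case
    proof (cases "card I = t \<and> card J = t")
      case True
      then show ?thesis using base by (intro pm.span_base) (auto simp: subsets_of_size_def)
    next
      case False
      then have "Phi t u t I J = (0 :: (_, 'k) mpoly)" using u by (intro Phi_nonsquare) auto
      then show ?thesis by (simp add: pm.span_zero)
    qed
  next
    case (step p)
    have fin: "finite I" "finite J" using step.prems by (auto intro: finite_subset)
    have "Dop (Phi t u p) I J \<in> ?P"
      by (rule Dop_mem[OF pm.subspace_span step.prems]) (rule step.IH)
    then show ?case unfolding Dop_Phi[OF fin] using step.hyps
      by - (erule sign_of_nat_cancel[OF _ pm.subspace_span], simp)
  qed
  have "schur_row I * schur_row J \<in> ?P" if "I \<in> subsets_of_size m (t + u)" "J \<in> subsets_of_size m (t - u)" for I J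
    using P[of "t + u" I J] that by (simp add: Phi_top[OF u] schur_row_mnr subsets_of_size_def)
  then show "?L \<subseteq> ?P" unfolding schur_module_tau
    by (intro pm.span_minimal) auto
qed

text \<open>The support of the middle \<open>hvec\<close> consists of pairs of t-subsets of {..<t +
  u}, so the various summation ranges (power sets, t-subsets of a larger range) are
  interchangeable.\<close>

lemma sum_hvec_restrict:
  assumes "finite A" "subsets_of_size (t + u) t \<subseteq> A" "u \<le> t"
  shows "(\<Sum>C\<in>A. \<Sum>D\<in>A. hvec (t - u) (t + u) t C D * f C D)
    = (\<Sum>C\<in>subsets_of_size (t + u) t. \<Sum>D\<in>subsets_of_size (t + u) t. hvec (t - u) (t + u) t C D * (f C D :: 'r::comm_ring_1))"
proof -
  let ?S = "subsets_of_size (t + u) t"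
  have z: "hvec (t - u) (t + u) t C D = (0::'r)" if "C \<notin> ?S \<or> D \<notin> ?S" for C D
  proof (rule ccontr)
    assume "hvec (t - u) (t + u) t C D \<noteq> (0::'r)"
    then have c: "card C = t" "C \<inter> D = {..<t - u}" "C \<union> D = {..<t + u}"
      by (auto simp: hvec_def split: if_splits)
    have fin: "finite C" "finite D" using c(3) by (metis finite_Un finite_lessThan)+
    have "card D = t" using card_Un_Int[OF fin] c assms(3) by simp
    moreover have "C \<subseteq> {..<t + u}" "D \<subseteq> {..<t + u}" using c(3) by blast+
    ultimately show False using that c(1) by (auto simp: subsets_of_size_def)
  qed
  have "(\<Sum>C\<in>A. \<Sum>D\<in>A. hvec (t - u) (t + u) t C D * f C D)
     = (\<Sum>C\<in>?S. \<Sum>D\<in>A. hvec (t - u) (t + u) t C D * f C D)"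
    by (rule sum.mono_neutral_right) (use assms z in auto)
  also have "\<dots> = (\<Sum>C\<in>?S. \<Sum>D\<in>?S. hvec (t - u) (t + u) t C D * f C D)"
    by (rule sum.cong[OF refl], rule sum.mono_neutral_right) (use assms z in auto)
  finally show ?thesis .
qed

lemma subsets_of_size_mono: "d \<le> d' \<Longrightarrow> subsets_of_size d t \<subseteq> subsets_of_size d' t"
  by (auto simp: subsets_of_size_def)

lemma subsets_of_size_Pow: "d \<le> d' \<Longrightarrow> subsets_of_size d t \<subseteq> Pow {..<d'}"
  by (auto simp: subsets_of_size_def)

text \<open>One quantity decides two questions: it is a tensor factor of the value of a Schur
  projection on a pair of \<open>hvec\<close>, by \<open>schur_proj_hvec2\<close>, and up to a
  scalar it is the image of that pair under the minor map, by \<open>pi_map_hvec2\<close>.\<close>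

definition Theta :: "nat \<Rightarrow> nat \<Rightarrow> nat \<Rightarrow> nat \<Rightarrow> (nat \<times> nat, 'k::field) mpoly" where
  "Theta m t u v = pairing m (hvec (t - u) (t + u) t) (Phi t v t)"

lemma sign_of_nat_cancel_0:
  assumes "(-1) ^ k * of_nat c * p = 0" "c > 0"
  shows "p = (0 :: ('v, 'k::field_char_0) mpoly)"
  using sign_of_nat_cancel[of k c p "{0}"] assms by (simp add: pm.subspace_single_0)

text \<open>Adjointness relates the pairings at p and p + 1 through the structure constants of the
  two strings. The shorter string of v has ended at p = t + v + 1, and going down from there the
  factor t + u - p stays positive because v < u.\<close>

lemma Theta_eq_0_gt:
  assumes "v < u" "u \<le> t"
  shows "Theta m t u v = (0 :: (_, 'k::field_char_0) mpoly)"
proof -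
  have "pairing m (hvec (t - u) (t + u) p) (Phi t v p) = (0 :: (_, 'k) mpoly)" if "p \<le> Suc (t + v)" for p
    using that
  proof (induction rule: inc_induct)
    case base
    show ?case by (simp add: pairing_def Phi_beyond)
  next
    case (step p)
    have "(-1) ^ (t - u) * of_nat (t + u - p) * pairing m (hvec (t - u) (t + u) p) (Phi t v p :: _ \<Rightarrow> _ \<Rightarrow> (_, 'k) mpoly)
       = pairing m (\<lambda>I J. ((-1) ^ (t - u) * of_nat (t + u - p)) * hvec (t - u) (t + u) p I J) (Phi t v p)"
      by (simp only: pairing_scale_left)
    also have "\<dots> = pairing m (Uop (hvec (t - u) (t + u) (Suc p))) (Phi t v p)"
      by (rule pairing_cong) (simp_all add: Uop_hvec)
    also have "\<dots> = pairing m (hvec (t - u) (t + u) (Suc p)) (Dop (Phi t v p))" by (rule pairing_Uop)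
    also have "\<dots> = pairing m (hvec (t - u) (t + u) (Suc p)) (\<lambda>I J. ((-1) ^ (t - v) * of_nat (Suc p - (t - v))) * Phi t v (Suc p) I J)"
      by (rule pairing_cong) (simp_all add: Dop_Phi)
    also have "\<dots> = 0" by (simp only: pairing_scale_right step.IH mult_zero_right)
    finally show ?case using assms step.hyps by - (erule sign_of_nat_cancel_0, simp)
  qed
  then show ?thesis by (simp add: Theta_def)
qed

text \<open>The same descent with the roles exchanged: now the string of \<open>hvec\<close> ends
  first.\<close>

lemma Theta_eq_0_less:
  assumes "u < v" "v \<le> t"
  shows "Theta m t u v = (0 :: (_, 'k::field_char_0) mpoly)"
proof -
  have "pairing m (hvec (t - u) (t + u) p) (Phi t v p) = (0 :: (_, 'k) mpoly)" if "p \<le> Suc (t + u)" for p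
    using that
  proof (induction rule: inc_induct)
    case base
    show ?case by (simp add: pairing_def hvec_beyond)
  next
    case (step p)
    have "(-1) ^ (t - v) * of_nat (t + v - p) * pairing m (hvec (t - u) (t + u) p) (Phi t v p :: _ \<Rightarrow> _ \<Rightarrow> (_, 'k) mpoly)
       = pairing m (\<lambda>I J. ((-1) ^ (t - v) * of_nat (t + v - p)) * Phi t v p I J) (hvec (t - u) (t + u) p)"
      by (simp only: pairing_scale_left pairing_commute[of m "Phi t v p"])
    also have "\<dots> = pairing m (Uop (Phi t v (Suc p))) (hvec (t - u) (t + u) p)"
      by (rule pairing_cong) (simp_all add: Uop_Phi)
    also have "\<dots> = pairing m (Phi t v (Suc p)) (Dop (hvec (t - u) (t + u) p))" by (rule pairing_Uop)
    also have "\<dots> = pairing m (Phi t v (Suc p)) (\<lambda>I J. ((-1) ^ (t - u) * of_nat (Suc p - (t - u))) * hvec (t - u) (t + u) (Suc p) I J)"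
      by (rule pairing_cong) (simp_all add: Dop_hvec)
    also have "\<dots> = 0"
      by (simp only: pairing_scale_right pairing_commute[of m "Phi t v (Suc p)"] step.IH mult_zero_right)
    finally show ?case using assms step.hyps by - (erule sign_of_nat_cancel_0, simp)
  qed
  then show ?thesis by (simp add: Theta_def)
qed

text \<open>Evaluation at the identity matrix turns minors into Kronecker deltas and
  \<open>Phi\<close> back into \<open>hvec\<close>. The value becomes a sum of squares of signs,
  which is the number of pairs in the support.\<close>

lemma Theta_neq_0:
  assumes "u \<le> t" "t + u \<le> m"
  shows "Theta m t u u \<noteq> (0 :: (_, 'k::field_char_0) mpoly)"
proof
  let ?ev = "alg_ext (\<lambda>(i, j). of_bool (i = j)) :: (nat \<times> nat, 'k) mpoly \<Rightarrow> (nat \<times> nat, 'k) mpoly"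
  let ?h = "hvec (t - u) (t + u) t" and ?S = "subsets_of_size (t + u) t"
  have ev: "?ev (mnr genX I C) = of_bool (I = C)" if "finite I" "finite C" for I C
  proof (cases "card I = card C")
    case True
    show ?thesis unfolding mnr_hom[OF alg_ext_hom] alg_ext_Var prod.case by (rule mnr_identity[OF that True])
  next
    case False
    then show ?thesis by (auto simp: mnr_nonsquare plin_0[OF plin_alg_ext])
  qed
  have S: "?S \<subseteq> Pow {..<m}" "?S \<subseteq> Pow {..<2 * t}"
    using assms by (simp_all add: subsets_of_size_Pow)
  have h: "?ev (?h I J * p) = ?h I J * ?ev p" for I J p
    by (subst (1 2) hvec_const_poly) (simp add: alg_ext_mult alg_ext_const_poly)
  have "?ev (Theta m t u u) = (\<Sum>I\<in>?S. \<Sum>J\<in>?S. ?h I J * ?ev (Phi t u t I J))"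
    unfolding Theta_def pairing_def
    by (subst sum_hvec_restrict[OF _ S(1) assms(1)]) (simp_all add: plin_sum[OF plin_alg_ext] h)
  also have "\<dots> = (\<Sum>I\<in>?S. \<Sum>J\<in>?S. ?h I J * ?h I J)"
  proof (intro sum.cong refl arg_cong2[of _ _ _ _ "(*)"])
    fix I J assume IJ: "I \<in> ?S" "J \<in> ?S"
    have "?ev (Phi t u t I J) = (\<Sum>C\<in>?S. \<Sum>D\<in>?S. ?h C D * ?ev (mnr genX I C * mnr genX J D))"
      unfolding Phi_def bi_minor_def pairing_def
      by (subst sum_hvec_restrict[OF _ S(2) assms(1)]) (simp_all add: plin_sum[OF plin_alg_ext] h)
    also have "\<dots> = (\<Sum>C\<in>?S. \<Sum>D\<in>?S. if D = J then if C = I then ?h C D else 0 else 0)"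
      using IJ by (intro sum.cong refl) (auto simp: alg_ext_mult ev subsets_of_size_finite)
    also have "\<dots> = ?h I J" using IJ by simp
    finally show "?ev (Phi t u t I J) = ?h I J" .
  qed
  also have "\<dots> = (\<Sum>I\<in>?S. \<Sum>J\<in>?S. of_nat (of_bool (?h I J \<noteq> (0::'k))))"
    by (intro sum.cong refl) (auto simp: hvec_def minus_one_power_iff)
  also have "\<dots> = of_nat (\<Sum>I\<in>?S. \<Sum>J\<in>?S. of_bool (?h I J \<noteq> (0::'k)))" by simp
  finally have 1: "?ev (Theta m t u u) = of_nat (\<Sum>I\<in>?S. \<Sum>J\<in>?S. of_bool (?h I J \<noteq> (0::'k)))" .
  \<comment> \<open>The pair without inversions witnesses that the support is nonempty.\<close>
  let ?a = "{..<t}" and ?b = "{..<t - u} \<union> {t..<t + u}"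
  have "?a \<inter> ?b = {..<t - u}" "?a \<union> ?b = {..<t + u}" using assms by auto
  then have hab: "?h ?a ?b \<noteq> (0::'k)" by (simp add: hvec_def)
  have cb: "card ?b = t" using assms by (subst card_Un_disjoint) auto
  have ab: "?a \<in> ?S" "?b \<in> ?S" using cb assms by (auto simp: subsets_of_size_def)
  have p: "0 < (\<Sum>J\<in>?S. of_bool (?h ?a J \<noteq> (0::'k)) :: nat)"
    by (rule sum_pos2[OF _ ab(2)]) (use hab in auto)
  have "0 < (\<Sum>I\<in>?S. \<Sum>J\<in>?S. of_bool (?h I J \<noteq> (0::'k)) :: nat)"
    by (rule sum_pos2[OF _ ab(1)]) (rule finite_subsets_of_size p le0)+
  moreover assume "Theta m t u u = (0 :: (_, 'k) mpoly)"
  \<comment> \<open>The evaluation still takes values in a polynomial ring, so the integer is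
    cancelled against the constant polynomial 1.\<close>
  then have "of_nat (\<Sum>I\<in>?S. \<Sum>J\<in>?S. of_bool (?h I J \<noteq> (0::'k))) * 1 = (0 :: (nat \<times> nat, 'k) mpoly)"
    using 1 by (simp only: plin_0[OF plin_alg_ext] mult_1_right)
  ultimately show False
    using sign_of_nat_cancel_0[of 0 "\<Sum>I\<in>?S. \<Sum>J\<in>?S. of_bool (?h I J \<noteq> (0::'k))" "1 :: (nat \<times> nat, 'k) mpoly"]
    by simp
qed

lemma Theta_eq_0_iff:
  assumes "u \<le> t" "v \<le> t" "t + u \<le> m"
  shows "Theta m t u v = (0 :: (_, 'k::field_char_0) mpoly) \<longleftrightarrow> u \<noteq> v"
  using assms Theta_neq_0[of u t m] Theta_eq_0_gt[of v u t m] Theta_eq_0_less[of u v t m]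
  by (cases u v rule: linorder_cases) auto

lemma Theta_alt:
  assumes "u \<le> t" "t + u \<le> m"
  shows "Theta m t u v = (\<Sum>I\<in>subsets_of_size m t. \<Sum>J\<in>subsets_of_size m t.
    pm_scale (hvec (t - u) (t + u) t I J) (Phi t v t I J :: (_, 'k::field) mpoly))"
proof -
  let ?h = "hvec (t - u) (t + u) t"
  have "Theta m t u v = (\<Sum>I\<in>subsets_of_size (t + u) t. \<Sum>J\<in>subsets_of_size (t + u) t. ?h I J * (Phi t v t I J :: (_, 'k) mpoly))"
    unfolding Theta_def pairing_def using assms by (intro sum_hvec_restrict subsets_of_size_Pow) auto
  also have "\<dots> = (\<Sum>I\<in>subsets_of_size m t. \<Sum>J\<in>subsets_of_size m t. ?h I J * (Phi t v t I J :: (_, 'k) mpoly))"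
    using assms by (intro sum_hvec_restrict[symmetric] subsets_of_size_mono) auto
  finally show ?thesis unfolding pm_scale_const_poly hvec_const_poly[symmetric] .
qed

definition hvec2 :: "nat \<Rightarrow> nat \<Rightarrow> nat \<Rightarrow> nat set \<times> nat set \<Rightarrow> nat set \<times> nat set \<Rightarrow> 'k::comm_ring_1" where
  "hvec2 t u v x y = hvec (t - u) (t + u) t (fst x) (fst y) * hvec (t - v) (t + v) t (snd x) (snd y)"

definition schur_pair :: "nat \<Rightarrow> nat \<Rightarrow> nat \<Rightarrow> nat set \<times> nat set \<Rightarrow> nat set \<times> nat set \<Rightarrow>
    (((nat \<times> nat) \<Rightarrow>\<^sub>0 nat) \<times> ((nat \<times> nat) \<Rightarrow>\<^sub>0 nat) \<Rightarrow>\<^sub>0 'k::field)" where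
  "schur_pair t u v x y = tensor (Phi t u t (fst x) (fst y)) (Phi t v t (snd x) (snd y))"

text \<open>A product of two brackets is sent to the sum of \<open>schur_pair\<close> over both
  orders of the factors, as symmetry demands.\<close>

definition schur_proj :: "nat \<Rightarrow> nat \<Rightarrow> nat \<Rightarrow> nat \<Rightarrow> nat \<Rightarrow> 'k::field minor_poly \<Rightarrow>
    (((nat \<times> nat) \<Rightarrow>\<^sub>0 nat) \<times> ((nat \<times> nat) \<Rightarrow>\<^sub>0 nat) \<Rightarrow>\<^sub>0 'k)" where
  "schur_proj t m n u v = unpol (brackets t m n) (schur_pair t u v)"

lemma plin_schur_proj: "plin (schur_proj t m n u v)"
  unfolding schur_proj_def by (rule plin_unpol)

lemma sum_brackets_brackets:
  "(\<Sum>x\<in>brackets t m n. \<Sum>y\<in>brackets t m n. f (fst x) (fst y) (snd x) (snd y))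
   = (\<Sum>I\<in>subsets_of_size m t. \<Sum>J\<in>subsets_of_size m t. \<Sum>H\<in>subsets_of_size n t. \<Sum>K\<in>subsets_of_size n t. f I J H K)"
  unfolding brackets_def sum.cartesian_product'
  by (simp, rule sum.cong[OF refl], rule sum.swap)

lemma tensor_sum_sum:
  "tensor (\<Sum>I\<in>A. \<Sum>J\<in>B. pm_scale (a I J) (P I J)) (\<Sum>H\<in>C. \<Sum>K\<in>D. pm_scale (b H K) (Q H K))
   = (\<Sum>I\<in>A. \<Sum>J\<in>B. \<Sum>H\<in>C. \<Sum>K\<in>D. pm_scale (a I J * b H K) (tensor (P I J) (Q H K :: _ \<Rightarrow>\<^sub>0 'k::field)))"
  unfolding plin_sum[OF plin_tensor_left] plin_scale[OF plin_tensor_left]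
  unfolding plin_sum[OF plin_tensor_right] plin_scale[OF plin_tensor_right] pm.scale_sum_right pm.scale_scale ..

lemma schur_proj_hvec2:
  assumes "u' \<le> t" "v' \<le> t" "t + u' \<le> m" "t + v' \<le> n"
    and "\<And>y z. y \<in> brackets t m n \<Longrightarrow> z \<in> brackets t m n \<Longrightarrow> pol x y z = c * hvec2 t u' v' y z"
  shows "schur_proj t m n u v x = pm_scale c (tensor (Theta m t u' u) (Theta n t v' v))"
proof -
  let ?h = "hvec (t - u') (t + u') t" and ?k = "hvec (t - v') (t + v') t"
  have "schur_proj t m n u v x = (\<Sum>y\<in>brackets t m n. \<Sum>z\<in>brackets t m n. pm_scale (c * hvec2 t u' v' y z) (schur_pair t u v y z))"
    unfolding schur_proj_def unpol_def by (intro sum.cong refl) (simp add: assms(5))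
  also have "\<dots> = (\<Sum>I\<in>subsets_of_size m t. \<Sum>J\<in>subsets_of_size m t. \<Sum>H\<in>subsets_of_size n t. \<Sum>K\<in>subsets_of_size n t.
      pm_scale (c * (?h I J * ?k H K)) (tensor (Phi t u t I J) (Phi t v t H K)))"
    unfolding hvec2_def schur_pair_def by (rule sum_brackets_brackets)
  also have "\<dots> = pm_scale c (tensor (Theta m t u' u) (Theta n t v' v))"
    unfolding Theta_alt[OF assms(1,3)] Theta_alt[OF assms(2,4)]
      tensor_sum_sum pm.scale_sum_right pm.scale_scale ..
  finally show ?thesis .
qed

text \<open>Summing products of minors against the column factor alone already gives
  \<open>Phi\<close> of type v; the row factor then pairs with it to \<open>Theta\<close>.\<close>

lemma pi_map_hvec2:
  assumes "u \<le> t" "v \<le> t" "t + u \<le> m" "t + v \<le> n" "x \<in> quad (brackets t m n)"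
    and "\<And>y z. y \<in> brackets t m n \<Longrightarrow> z \<in> brackets t m n \<Longrightarrow> pol x y z = c * hvec2 t u v y z"
  shows "pm_scale 2 (pi_map x) = pm_scale c (Theta m t u v :: (_, 'k::field) mpoly)"
proof -
  let ?h = "hvec (t - u) (t + u) t" and ?k = "hvec (t - v) (t + v) t"
  have "pm_scale 2 (pi_map x) = (\<Sum>y\<in>brackets t m n. \<Sum>z\<in>brackets t m n. pm_scale (c * hvec2 t u v y z)
      (minor (fst y) (snd y) * minor (fst z) (snd z)))"
    unfolding pi_map_unpol[OF assms(5)] unpol_def by (intro sum.cong refl) (simp add: assms(6))
  also have "\<dots> = (\<Sum>I\<in>subsets_of_size m t. \<Sum>J\<in>subsets_of_size m t. \<Sum>H\<in>subsets_of_size n t. \<Sum>K\<in>subsets_of_size n t.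
      pm_scale (c * (?h I J * ?k H K)) (mnr genX I H * (mnr genX J K :: (_, 'k) mpoly)))"
    unfolding hvec2_def minor_mnr by (rule sum_brackets_brackets)
  also have "\<dots> = (\<Sum>I\<in>subsets_of_size m t. \<Sum>J\<in>subsets_of_size m t. pm_scale c (pm_scale (?h I J) (Phi t v t I J)))"
  proof (intro sum.cong refl)
    fix I J
    have "Phi t v t I J = (\<Sum>C\<in>subsets_of_size (t + v) t. \<Sum>D\<in>subsets_of_size (t + v) t. ?k C D * (mnr genX I C * (mnr genX J D :: (_, 'k) mpoly)))"
      unfolding Phi_def bi_minor_def pairing_def using assms by (intro sum_hvec_restrict subsets_of_size_Pow) auto
    also have "\<dots> = (\<Sum>C\<in>subsets_of_size n t. \<Sum>D\<in>subsets_of_size n t. ?k C D * (mnr genX I C * (mnr genX J D :: (_, 'k) mpoly)))"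
      using assms by (intro sum_hvec_restrict[symmetric] subsets_of_size_mono) auto
    also have "\<dots> = (\<Sum>C\<in>subsets_of_size n t. \<Sum>D\<in>subsets_of_size n t. pm_scale (?k C D) (mnr genX I C * (mnr genX J D :: (_, 'k) mpoly)))"
      unfolding pm_scale_const_poly hvec_const_poly[symmetric] ..
    finally show "(\<Sum>H\<in>subsets_of_size n t. \<Sum>K\<in>subsets_of_size n t.
      pm_scale (c * (?h I J * ?k H K)) (mnr genX I H * mnr genX J K)) = pm_scale c (pm_scale (?h I J) (Phi t v t I J :: (_, 'k) mpoly))"
      by (simp only: pm.scale_sum_right pm.scale_scale mult.assoc)
  qed
  also have "\<dots> = pm_scale c (Theta m t u v)"
    unfolding Theta_alt[OF assms(1,3)] pm.scale_sum_right ..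
  finally show ?thesis .
qed

lemma schur_tensor_act_schur_pair:
  assumes g: "g \<in> carrier (GG m n)" and xy: "x \<in> brackets t m n" "y \<in> brackets t m n"
  shows "schur_tensor_act n g (schur_pair t u v x y) = (\<Sum>x'\<in>brackets t m n. \<Sum>y'\<in>brackets t m n.
    pm_scale (act_coeff n g x' x * act_coeff n g y' y) (schur_pair t u v x' y' :: _ \<Rightarrow>\<^sub>0 'k::field))"
proof -
  obtain a b where ab: "g = (a, b)" by (cases g)
  have c: "a \<in> carrier_mat m m" "contragredient n b \<in> carrier_mat n n"
    using g unfolding ab by (auto simp: GG_carrier GL_carrier_mat contragredient_GL)
  have d: "dual_act n b = std_act (contragredient n b)" by (simp add: dual_act_def contragredient_def fun_eq_iff)
  have V: "fst x \<in> subsets_of_size m t" "fst y \<in> subsets_of_size m t"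
    "snd x \<in> subsets_of_size n t" "snd y \<in> subsets_of_size n t" using xy by (auto simp: brackets_def)
  have "schur_tensor_act n g (schur_pair t u v x y) =
     tensor (schur_map (std_act a) (Phi t u t (fst x) (fst y))) (schur_map (std_act (contragredient n b)) (Phi t v t (snd x) (snd y)))"
    by (simp add: schur_tensor_act_def ab schur_pair_def tensor_map_tensor[OF plin_schur_map plin_schur_map] d)
  also have "\<dots> = (\<Sum>I\<in>subsets_of_size m t. \<Sum>J\<in>subsets_of_size m t. \<Sum>H\<in>subsets_of_size n t. \<Sum>K\<in>subsets_of_size n t.
      pm_scale ((mnr (mat_fun a) I (fst x) * mnr (mat_fun (contragredient n b)) H (snd x)) * (mnr (mat_fun a) J (fst y) * mnr (mat_fun (contragredient n b)) K (snd y)))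
        (tensor (Phi t u t I J) (Phi t v t H K)))"
    unfolding schur_map_Phi[OF c(1) V(1,2)] schur_map_Phi[OF c(2) V(3,4)]
      tensor_sum_sum
    by (intro sum.cong refl) (simp only: mult_ac)
  also have "\<dots> = (\<Sum>x'\<in>brackets t m n. \<Sum>y'\<in>brackets t m n.
    pm_scale (act_coeff n g x' x * act_coeff n g y' y) (schur_pair t u v x' y'))"
    unfolding act_coeff_def schur_pair_def ab fst_conv snd_conv by (rule sum_brackets_brackets[symmetric])
  finally show ?thesis .
qed

lemma plin_schur_tensor_act: "plin (schur_tensor_act n g)"
  by (cases g) (simp add: schur_tensor_act_def plin_tensor_map)

text \<open>On a product of two brackets the projection has two summands, one for each order, and
  \<open>schur_tensor_act_schur_pair\<close> gives the action on each of them.\<close>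

lemma schur_proj_S_act:
  assumes g: "g \<in> carrier (GG m n)" and x: "x \<in> quad (brackets t m n)"
  shows "schur_proj t m n u v (S_act n g x) = schur_tensor_act n g (schur_proj t m n u v (x :: 'k::field minor_poly))"
proof (rule quad_plin_eqI[OF x plin_comp[OF plin_schur_proj plin_S_act] plin_comp[OF plin_schur_tensor_act plin_schur_proj]])
  fix x y assume xy: "x \<in> brackets t m n" "y \<in> brackets t m n"
  have "schur_proj t m n u v (S_act n g (Var x * Var y :: 'k minor_poly)) = (\<Sum>x'\<in>brackets t m n. \<Sum>y'\<in>brackets t m n.
      pm_scale (act_coeff n g x' x * act_coeff n g y' y) (schur_pair t u v x' y' + schur_pair t u v y' x'))"
    unfolding S_act_Var_Var[OF g xy] plin_sum[OF plin_schur_proj] plin_scale[OF plin_schur_proj]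
    by (intro sum.cong refl) (simp add: schur_proj_def unpol_Var_Var)
  also have "\<dots> = schur_tensor_act n g (schur_pair t u v x y) + schur_tensor_act n g (schur_pair t u v y x)"
    unfolding schur_tensor_act_schur_pair[OF g xy] schur_tensor_act_schur_pair[OF g xy(2,1)] pm.scale_right_distrib sum.distrib
    by (subst (4) sum.swap) (simp only: mult.commute)
  finally show "schur_proj t m n u v (S_act n g (Var x * Var y)) = schur_tensor_act n g (schur_proj t m n u v (Var x * Var y))"
    using xy by (simp add: schur_proj_def unpol_Var_Var plin_add[OF plin_schur_tensor_act])
qed

section \<open>The vectors \<open>f_vec\<close>\<close>

lemma finite_ordered_partitions: "finite S \<Longrightarrow> finite (ordered_partitions S u)"
  by (rule finite_subset[of _ "Pow S \<times> Pow S"]) (auto simp: ordered_partitions_def)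

text \<open>At most one ordered partition yields given sets A and B, namely (A - B, B - A). So
  \<open>hvec\<close> is the coefficient function of one tensor factor of
  \<open>f_vec\<close>.\<close>

lemma sum_ordered_partitions:
  assumes u: "u \<le> t"
  shows "(\<Sum>p\<in>ordered_partitions {t - u..<t + u} u. of_int (partition_sign (fst p) (snd p)) *
      of_bool ({..<t - u} \<union> fst p = A \<and> {..<t - u} \<union> snd p = B)) = (hvec (t - u) (t + u) t A B :: 'k::comm_ring_1)"
proof -
  let ?S = "ordered_partitions {t - u..<t + u} u" and ?T = "{..<t - u}"
  let ?c = "card A = t \<and> A \<inter> B = ?T \<and> A \<union> B = {..<t + u}"
  have fin: "finite ?S" by (simp add: finite_ordered_partitions)
  have TU: "?T \<union> {t - u..<t + u} = {..<t + u}" using u by auto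
  have 1: "?c \<and> p = (A - B, B - A)" if p: "p \<in> ?S" and AB: "?T \<union> fst p = A" "?T \<union> snd p = B" for p
  proof -
    obtain I J where IJ: "p = (I, J)" "I \<union> J = {t - u..<t + u}" "I \<inter> J = {}" "card I = u"
      using p by (auto simp: ordered_partitions_def)
    have "I \<subseteq> {t - u..<t + u}" "J \<subseteq> {t - u..<t + u}" using IJ(2) by blast+
    then have d: "?T \<inter> I = {}" "?T \<inter> J = {}" by auto
    have A: "A = ?T \<union> I" and B: "B = ?T \<union> J" using AB IJ by auto
    have finI: "finite I" using IJ(2) by (metis finite_Un finite_atLeastLessThan)
    have "card A = t" unfolding A using d finI IJ u by (subst card_Un_disjoint) auto
    moreover have "A \<inter> B = ?T" unfolding A B using IJ(3) by auto
    moreover have "A \<union> B = {..<t + u}"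
      unfolding A B using IJ(2) TU by (metis Un_assoc Un_left_commute sup.idem)
    moreover have "I = A - B" "J = B - A" unfolding A B using d IJ(3) by auto
    ultimately show ?thesis using IJ(1) by simp
  qed
  have 2: "(A - B, B - A) \<in> ?S \<and> ?T \<union> (A - B) = A \<and> ?T \<union> (B - A) = B" if c: ?c
  proof -
    have fin: "finite A" "finite B" using c by (metis finite_Un finite_lessThan)+
    have cB: "card B = t" using card_Un_Int[OF fin] c u by simp
    have "(A - B) \<union> (B - A) = (A \<union> B) - (A \<inter> B)" by blast
    also have "\<dots> = {..<t + u} - ?T" using c by simp
    also have "\<dots> = {t - u..<t + u}" by auto
    finally have "(A - B) \<union> (B - A) = {t - u..<t + u}" .
    moreover have "card (A - B) = u" "card (B - A) = u"
      using c cB fin u by (simp_all add: card_Diff_subset_Int Int_commute)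
    moreover have "?T \<union> (A - B) = A" "?T \<union> (B - A) = B" using c by blast+
    ultimately show ?thesis by (auto simp: ordered_partitions_def)
  qed
  show ?thesis
  proof (cases ?c)
    case True
    note T2 = 2[OF True]
    have "(A - B) \<union> (B - A) = {t - u..<t + u}" using T2 by (simp add: ordered_partitions_def)
    from partition_sign_eq[OF this]
    have s: "of_int (partition_sign (A - B) (B - A)) = (hvec (t - u) (t + u) t A B :: 'k)"
      using True by (simp add: hvec_def) (simp add: Diff_Int_distrib2)
    have "(\<Sum>p\<in>?S. of_int (partition_sign (fst p) (snd p)) * of_bool (?T \<union> fst p = A \<and> ?T \<union> snd p = B))
      = (\<Sum>p\<in>?S. if p = (A - B, B - A) then (hvec (t - u) (t + u) t A B :: 'k) else 0)"
    proof (intro sum.cong refl)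
      fix p assume p: "p \<in> ?S"
      show "of_int (partition_sign (fst p) (snd p)) * of_bool (?T \<union> fst p = A \<and> ?T \<union> snd p = B)
        = (if p = (A - B, B - A) then (hvec (t - u) (t + u) t A B :: 'k) else 0)"
      proof (cases "p = (A - B, B - A)")
        case p': True
        have "?T \<union> fst p = A \<and> ?T \<union> snd p = B" unfolding p' fst_conv snd_conv using T2 by blast
        then show ?thesis using s p' by simp
      next
        case False
        then have "\<not> (?T \<union> fst p = A \<and> ?T \<union> snd p = B)" using 1[OF p] by blast
        then show ?thesis using False by (simp only: of_bool_eq(1) if_False mult_zero_right)
      qed
    qed
    then show ?thesis using fin T2 by simp
  next
    case False
    then have "(\<Sum>p\<in>?S. of_int (partition_sign (fst p) (snd p)) * of_bool (?T \<union> fst p = A \<and> ?T \<union> snd p = B)) = (0::'k)"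
    proof (intro sum.neutral ballI)
      fix p assume "p \<in> ?S"
      with 1[OF this] False have "\<not> (?T \<union> fst p = A \<and> ?T \<union> snd p = B)" by blast
      then show "of_int (partition_sign (fst p) (snd p)) * of_bool (?T \<union> fst p = A \<and> ?T \<union> snd p = B) = (0::'k)"
        by (simp only: of_bool_eq(1) mult_zero_right)
    qed
    moreover have "hvec (t - u) (t + u) t A B = (0::'k)" using False by (simp only: hvec_def if_False)
    ultimately show ?thesis by simp
  qed
qed

lemma const_poly_of_int: "const_poly (of_int k) = of_int k"
  by (simp add: const_poly_def)

lemma f_vec_alt:
  "f_vec t u v = (\<Sum>p\<in>ordered_partitions {t - u..<t + u} u. \<Sum>q\<in>ordered_partitions {t - v..<t + v} v.
     pm_scale (of_int (partition_sign (fst p) (snd p)) * of_int (partition_sign (fst q) (snd q)))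
      (Var ({..<t - u} \<union> fst p, {..<t - v} \<union> fst q) * (Var ({..<t - u} \<union> snd p, {..<t - v} \<union> snd q) :: 'k::field minor_poly)))"
  unfolding f_vec_def case_prod_unfold pm_scale_const_poly const_poly_mult const_poly_of_int
  by (simp only: mult.assoc)

lemma of_bool_pair: "of_bool ((a, b) = x \<and> (c, d) = y) =
    (of_bool (a = fst x \<and> c = fst y) * of_bool (b = snd x \<and> d = snd y) :: 'r::comm_ring_1)"
  by (cases x, cases y) (auto simp: of_bool_def)

lemma pol_f_vec:
  assumes "u \<le> t" "v \<le> t"
  shows "pol (f_vec t u v) x y = hvec2 t u v x y + (hvec2 t u v y x :: 'k::field)"
proof -
  let ?P = "ordered_partitions {t - u..<t + u} u" and ?Q = "ordered_partitions {t - v..<t + v} v"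
  let ?f = "\<lambda>A B p. of_int (partition_sign (fst p) (snd p)) * of_bool ({..<t - u} \<union> fst p = A \<and> {..<t - u} \<union> snd p = B) :: 'k"
  let ?g = "\<lambda>A B p. of_int (partition_sign (fst p) (snd p)) * of_bool ({..<t - v} \<union> fst p = A \<and> {..<t - v} \<union> snd p = B) :: 'k"
  have "pol (f_vec t u v) x y = (\<Sum>p\<in>?P. \<Sum>q\<in>?Q. ?f (fst x) (fst y) p * ?g (snd x) (snd y) q
      + ?f (fst y) (fst x) p * ?g (snd y) (snd x) q)"
    unfolding f_vec_alt pol_sum pol_scale pol_Var_Var
    by (intro sum.cong refl) (simp add: of_bool_pair algebra_simps)
  also have "\<dots> = (\<Sum>p\<in>?P. ?f (fst x) (fst y) p) * (\<Sum>q\<in>?Q. ?g (snd x) (snd y) q)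
      + (\<Sum>p\<in>?P. ?f (fst y) (fst x) p) * (\<Sum>q\<in>?Q. ?g (snd y) (snd x) q)"
    unfolding sum_product sum.distrib ..
  finally show ?thesis by (simp only: sum_ordered_partitions assms hvec2_def)
qed

lemma hvec2_swap:
  assumes "u \<le> t" "v \<le> t"
  shows "hvec2 t u v y x = (-1) ^ (u + v) * (hvec2 t u v x y :: 'k::comm_ring_1)"
  unfolding hvec2_def hvec_swap[OF refl refl assms(1), of "fst y"] hvec_swap[OF refl refl assms(2), of "snd y"]
  by (simp add: power_add)

text \<open>Polarisation symmetrises the coefficient function; for even u + v the two summands
  coincide by \<open>hvec2_swap\<close>.\<close>

lemma pol_f_vec_even:
  assumes "u \<le> t" "v \<le> t" "even (u + v)"
  shows "pol (f_vec t u v) x y = 2 * (hvec2 t u v x y :: 'k::field)"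
proof -
  have "hvec2 t u v y x = (hvec2 t u v x y :: 'k)" using assms by (subst hvec2_swap) auto
  then show ?thesis by (simp add: pol_f_vec assms)
qed

lemma f_vec_quad:
  assumes "u \<le> t" "v \<le> t" "t + u \<le> m" "t + v \<le> n"
  shows "(f_vec t u v :: 'k::field minor_poly) \<in> quad (brackets t m n)"
proof -
  have *: "{..<t - u} \<union> I \<in> subsets_of_size d t"
    if "I \<subseteq> {t - u..<t + u}" "card I = u" "u \<le> t" "t + u \<le> d" for I u d
  proof -
    have "finite I" using that by (auto intro: finite_subset)
    then have "card ({..<t - u} \<union> I) = t" using that by (subst card_Un_disjoint) auto
    then show ?thesis using that by (auto simp: subsets_of_size_def)
  qed
  have op: "fst p \<subseteq> {t - u..<t + u}" "snd p \<subseteq> {t - u..<t + u}" "card (fst p) = u" "card (snd p) = u"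
    if "p \<in> ordered_partitions {t - u..<t + u} u" for p u
    using that by (auto simp: ordered_partitions_def)
  show ?thesis unfolding f_vec_alt
  proof (intro pm.subspace_sum[OF subspace_quad] pm.subspace_scale[OF subspace_quad] Var_mult_quad)
    fix p q assume "p \<in> ordered_partitions {t - u..<t + u} u" "q \<in> ordered_partitions {t - v..<t + v} v"
    note pq = op[OF this(1)] op[OF this(2)]
    show "({..<t - u} \<union> fst p, {..<t - v} \<union> fst q) \<in> brackets t m n"
      using *[OF pq(1,3) assms(1,3)] *[OF pq(5,7) assms(2,4)] by (simp add: brackets_def)
    show "({..<t - u} \<union> snd p, {..<t - v} \<union> snd q) \<in> brackets t m n"
      using *[OF pq(2,4) assms(1,3)] *[OF pq(6,8) assms(2,4)] by (simp add: brackets_def)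
  qed
qed

lemma hvec2_neq_0: "u \<le> t \<Longrightarrow> v \<le> t \<Longrightarrow> t + u \<le> m \<Longrightarrow> t + v \<le> n \<Longrightarrow>
    \<exists>x\<in>brackets t m n. \<exists>y\<in>brackets t m n. hvec2 t u v x y \<noteq> (0 :: 'k::field)"
proof -
  assume a: "u \<le> t" "v \<le> t" "t + u \<le> m" "t + v \<le> n"
  have *: "hvec (t - u) (t + u) t {..<t} ({..<t - u} \<union> {t..<t + u}) \<noteq> (0::'k) \<and>
      {..<t} \<in> subsets_of_size d t \<and> {..<t - u} \<union> {t..<t + u} \<in> subsets_of_size d t"
    if "u \<le> t" "t + u \<le> d" for u d
  proof -
    let ?b = "{..<t - u} \<union> {t..<t + u}"
    have e: "{..<t} \<inter> ?b = {..<t - u}" "{..<t} \<union> ?b = {..<t + u}" using that by auto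
    have "hvec (t - u) (t + u) t {..<t} ?b = ((-1) ^ inv_count ({..<t} - ?b) (?b - {..<t}) :: 'k)"
      unfolding hvec_def e by simp
    then have "hvec (t - u) (t + u) t {..<t} ?b \<noteq> (0::'k)" by (simp only: power_eq_0_iff) simp
    moreover have "card ?b = t" using that by (subst card_Un_disjoint) auto
    then have "?b \<in> subsets_of_size d t" using that unfolding subsets_of_size_def by auto
    moreover have "{..<t} \<in> subsets_of_size d t" using that by (auto simp: subsets_of_size_def)
    ultimately show ?thesis by blast
  qed
  let ?x = "({..<t}, {..<t})" and ?y = "({..<t - u} \<union> {t..<t + u}, {..<t - v} \<union> {t..<t + v})"
  have "?x \<in> brackets t m n" "?y \<in> brackets t m n" using *[OF a(1,3)] *[OF a(2,4)] by (simp_all only: brackets_def mem_Sigma_iff)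
  moreover have "hvec2 t u v ?x ?y \<noteq> (0::'k)"
    using *[OF a(1,3)] *[OF a(2,4)] by (simp only: hvec2_def fst_conv snd_conv mult_eq_0_iff) simp
  ultimately show ?thesis by blast
qed

lemma f_vec_neq_0:
  assumes "u \<le> t" "v \<le> t" "even (u + v)"
  shows "(f_vec t u v :: 'k::field_char_0 minor_poly) \<noteq> 0"
proof
  assume 0: "(f_vec t u v :: 'k minor_poly) = 0"
  have "2 * hvec2 t u v x y = pol (f_vec t u v :: 'k minor_poly) x y" for x y
    by (rule pol_f_vec_even[OF assms, symmetric])
  then have "hvec2 t u v x y = (0::'k)" for x y unfolding 0 by simp
  then show False using hvec2_neq_0[of u t v "t + u" "t + v"] assms by auto
qed

text \<open>A tensor vanishes only if a factor does, and each factor is a \<open>Theta\<close>,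
  nonzero exactly when the types agree. So the projections separate the
  \<open>f_vec\<close>.\<close>

lemma schur_proj_f_vec:
  assumes "u \<le> t" "v \<le> t" "t + u \<le> m" "t + v \<le> n" "even (u + v)" "u' \<le> t" "v' \<le> t"
  shows "schur_proj t m n u' v' (f_vec t u v :: 'k::field_char_0 minor_poly) = 0 \<longleftrightarrow> (u', v') \<noteq> (u, v)"
proof -
  have "schur_proj t m n u' v' (f_vec t u v :: 'k minor_poly) = pm_scale 2 (tensor (Theta m t u u') (Theta n t v v'))"
    by (rule schur_proj_hvec2[OF assms(1-4)]) (rule pol_f_vec_even[OF assms(1,2,5)])
  then show ?thesis using assms by (auto simp: tensor_eq_0_iff Theta_eq_0_iff)
qed

lemma f_vec_J_deg2:
  assumes "u \<le> t" "v \<le> t" "t + u \<le> m" "t + v \<le> n" "even (u + v)"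
  shows "(f_vec t u v :: 'k::field_char_0 minor_poly) \<in> J_deg2 t m n \<longleftrightarrow> u \<noteq> v"
proof -
  have "pm_scale 2 (pi_map (f_vec t u v)) = pm_scale 2 (Theta m t u v :: (_, 'k) mpoly)"
    by (rule pi_map_hvec2[OF assms(1-4) f_vec_quad[OF assms(1-4)]]) (rule pol_f_vec_even[OF assms(1,2,5)])
  moreover have "(f_vec t u v :: 'k minor_poly) \<in> quad (brackets t m n)" by (rule f_vec_quad[OF assms(1-4)])
  ultimately show ?thesis using assms by (simp add: J_deg2_eq Theta_eq_0_iff)
qed


section \<open>The images of the projections\<close>

lemma subspace_plin_image: "plin F \<Longrightarrow> pm.subspace S \<Longrightarrow> pm.subspace (F ` S)"
proof (rule pm.subspaceI)
  assume F: "plin F" and S: "pm.subspace S"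
  show "0 \<in> F ` S" using imageI[OF pm.subspace_0[OF S], of F] by (simp add: plin_0[OF F])
  show "x + y \<in> F ` S" if xy: "x \<in> F ` S" "y \<in> F ` S" for x y
  proof -
    obtain a b where "x = F a" "y = F b" "a \<in> S" "b \<in> S" using xy by blast
    then show ?thesis using plin_add[OF F, of a b] pm.subspace_add[OF S] by (metis image_eqI)
  qed
  show "pm_scale c x \<in> F ` S" if x: "x \<in> F ` S" for c x
  proof -
    obtain a where "x = F a" "a \<in> S" using x by blast
    then show ?thesis using plin_scale[OF F, of c a] pm.subspace_scale[OF S] by (metis image_eqI)
  qed
qed

lemma subspace_plin_vimage: "plin F \<Longrightarrow> pm.subspace S \<Longrightarrow> pm.subspace {x. F x \<in> S}"
  by (rule pm.subspaceI)
    (simp_all add: plin_0 plin_add plin_scale pm.subspace_0 pm.subspace_add pm.subspace_scale)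

text \<open>The two orders of a product of brackets contribute \<open>schur_pair\<close> with
  relative sign (-1)^(u+v). For even u + v they add up to twice a generator of the tensor product,
  so every generator is reached.\<close>

lemma schur_proj_image:
  assumes uv: "u \<le> t" "v \<le> t" "even (u + v)"
  shows "schur_proj t m n u v ` quad (brackets t m n) = (schur_tensor m n (tau t u) (tau t v) :: (_ \<Rightarrow>\<^sub>0 'k::field_char_0) set)"
proof -
  let ?L = "\<lambda>d u. schur_module d (tau t u) :: (_, 'k) mpoly set"
  let ?O = "schur_proj t m n u v ` quad (brackets t m n) :: (_ \<Rightarrow>\<^sub>0 'k) set"
  have Phi: "Phi t u t I J \<in> ?L m u" if "I \<in> subsets_of_size m t" "J \<in> subsets_of_size m t" "u \<le> t" for I J u m
    unfolding schur_module_span_Phi[OF that(3)] using that by (intro pm.span_base) blast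
  have schur_pair: "schur_pair t u v x y \<in> (schur_tensor m n (tau t u) (tau t v) :: (_ \<Rightarrow>\<^sub>0 'k) set)" if "x \<in> brackets t m n" "y \<in> brackets t m n" for x y
    unfolding schur_tensor_def tensor_space_def schur_pair_def
    by (rule pm.span_base, rule CollectI, rule exI, rule exI, rule conjI, rule refl)
      (use that uv in \<open>auto simp: brackets_def intro!: Phi\<close>)
  have subT: "pm.subspace (schur_tensor m n (tau t u) (tau t v) :: (_ \<Rightarrow>\<^sub>0 'k) set)"
    by (simp add: schur_tensor_def tensor_space_def)
  have sub: "?O \<subseteq> schur_tensor m n (tau t u) (tau t v)"
    unfolding image_subset_iff schur_proj_def unpol_def
    by (intro ballI pm.subspace_sum[OF subT] pm.subspace_scale[OF subT] schur_pair)
  have subO: "pm.subspace ?O" by (intro subspace_plin_image plin_schur_proj subspace_quad)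
  have base: "tensor (Phi t u t I J) (Phi t v t H K) \<in> ?O"
    if "I \<in> subsets_of_size m t" "J \<in> subsets_of_size m t" "H \<in> subsets_of_size n t" "K \<in> subsets_of_size n t" for I J H K
  proof -
    have x: "(I, H) \<in> brackets t m n" "(J, K) \<in> brackets t m n" using that by (auto simp: brackets_def)
    have sg: "(-1) ^ k * p = pm_scale ((-1) ^ k) (p :: (nat \<times> nat, 'k) mpoly)" for k p
      by (simp only: pm_scale_const_poly const_poly_sign)
    have "schur_pair t u v (J, K) (I, H) = pm_scale ((-1) ^ (u + v)) (schur_pair t u v (I, H) (J, K) :: _ \<Rightarrow>\<^sub>0 'k)"
      unfolding schur_pair_def fst_conv snd_conv Phi_swap[OF uv(1), of J] Phi_swap[OF uv(2), of K] sg
        plin_scale[OF plin_tensor_left] plin_scale[OF plin_tensor_right] pm.scale_scale power_add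
      by (simp only: mult.commute)
    then have "schur_proj t m n u v (Var (I, H) * Var (J, K)) = pm_scale 2 (schur_pair t u v (I, H) (J, K) :: _ \<Rightarrow>\<^sub>0 'k)"
      using uv(3) x by (simp add: schur_proj_def unpol_Var_Var pm_scale_2)
    then have "pm_scale 2 (schur_pair t u v (I, H) (J, K)) \<in> ?O" using x by (metis Var_mult_quad image_eqI)
    then have "pm_scale (1/2) (pm_scale 2 (schur_pair t u v (I, H) (J, K))) \<in> ?O" by (rule pm.subspace_scale[OF subO])
    then show ?thesis by (simp add: schur_pair_def)
  qed
  have "tensor p q \<in> ?O" if "p \<in> ?L m u" "q \<in> ?L n v" for p q
  proof -
    have 1: "tensor (Phi t u t I J) q \<in> ?O" if "I \<in> subsets_of_size m t" "J \<in> subsets_of_size m t" for I J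
    proof -
      have "?L n v \<subseteq> {q. tensor (Phi t u t I J) q \<in> ?O}"
        unfolding schur_module_span_Phi[OF uv(2)]
        by (intro pm.span_minimal subspace_plin_vimage plin_tensor_right subO) (auto intro!: base that)
      then show ?thesis using \<open>q \<in> ?L n v\<close> by blast
    qed
    have "?L m u \<subseteq> {p. tensor p q \<in> ?O}"
      unfolding schur_module_span_Phi[OF uv(1)]
      by (intro pm.span_minimal subspace_plin_vimage plin_tensor_left subO) (auto intro!: 1)
    then show ?thesis using \<open>p \<in> ?L m u\<close> by blast
  qed
  then have "schur_tensor m n (tau t u) (tau t v) \<subseteq> ?O"
    unfolding schur_tensor_def tensor_space_def by (intro pm.span_minimal subO) auto
  with sub show ?thesis by blast
qed

lemma schur_tensor_eq_0:
  assumes "t + u > m \<or> t + v > n"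
  shows "schur_tensor m n (tau t u) (tau t v) = ({0} :: (_ \<Rightarrow>\<^sub>0 'k::field) set)"
proof -
  have e: "schur_module d (tau t u) = ({0} :: (_, 'k) mpoly set)" if "t + u > d" for d u
  proof -
    have "subsets_of_size d (t + u) = {}"
    proof (rule ccontr)
      assume "subsets_of_size d (t + u) \<noteq> {}"
      then obtain I where "I \<subseteq> {..<d}" "card I = t + u" by (auto simp: subsets_of_size_def)
      then have "t + u \<le> d" using card_mono[of "{..<d}" I] by simp
      then show False using that by simp
    qed
    then show ?thesis by (simp add: schur_module_tau)
  qed
  have "tensor p q = 0" if "p \<in> schur_module m (tau t u)" "q \<in> schur_module n (tau t v)" for p q :: "(nat \<times> nat, 'k) mpoly"
    using assms e[of m u] e[of n v] that by auto
  then have "{tensor p q |p q. p \<in> schur_module m (tau t u) \<and> q \<in> schur_module n (tau t v)} \<subseteq> ({0} :: (_ \<Rightarrow>\<^sub>0 'k) set)" by blast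
  then have "schur_tensor m n (tau t u) (tau t v) \<subseteq> pm.span ({0} :: (_ \<Rightarrow>\<^sub>0 'k) set)"
    unfolding schur_tensor_def tensor_space_def by (rule pm.span_mono)
  moreover have "pm.span {0} = ({0} :: (_ \<Rightarrow>\<^sub>0 'k) set)" by (simp add: pm.span_insert_0)
  moreover have "(0 :: _ \<Rightarrow>\<^sub>0 'k) \<in> schur_tensor m n (tau t u) (tau t v)"
    unfolding schur_tensor_def tensor_space_def by (rule pm.span_zero)
  ultimately show ?thesis by blast
qed

section \<open>Unitriangular, elementary and torus elements, and their effect on
  coefficients\<close>

section \<open>Triangular elements of the group\<close>

lemma mnr_upper:
  fixes M :: "nat \<Rightarrow> nat \<Rightarrow> 'r::comm_ring_1"
  assumes "finite I" "\<And>i j. i \<in> I \<Longrightarrow> j \<in> I \<Longrightarrow> j < i \<Longrightarrow> M i j = 0"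
  shows "mnr M I I = (\<Prod>i\<in>I. M i i)"
proof -
  let ?s = "\<lambda>k. sorted_list_of_set I ! k"
  let ?A = "mat (card I) (card I) (\<lambda>(r, c). M (?s r) (?s c))"
  have mem: "?s r \<in> I" if "r < card I" for r
    using nth_mem[of r "sorted_list_of_set I"] that assms(1) by simp
  have "?A $$ (r, c) = 0" if "c < r" "r < card I" for r c
  proof -
    have "?s c < ?s r"
      using sorted_wrt_nth_less[OF strict_sorted_list_of_set, of c r I] that assms(1) by simp
    then show ?thesis using that assms(2) mem by simp
  qed
  then have "upper_triangular ?A" by auto
  then have "det ?A = prod_list (diag_mat ?A)" by (rule det_upper_triangular[where n = "card I"]) simp
  also have "\<dots> = (\<Prod>r\<in>{..<card I}. M (?s r) (?s r))"
    by (simp add: prod_list_diag_prod lessThan_atLeast0)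
  also have "\<dots> = (\<Prod>i\<in>I. M i i)"
    by (rule prod.reindex_bij_betw[OF bij_betw_sorted_list_of_set[OF assms(1)]])
  finally show ?thesis by (simp add: mnr_def)
qed

lemma sum_sorted_list_of_set: "finite I \<Longrightarrow> (\<Sum>r\<in>{0..<card I}. sorted_list_of_set I ! r) = \<Sum>I"
  using sum.reindex_bij_betw[OF bij_betw_sorted_list_of_set, of I "\<lambda>x. x"] by (simp add: lessThan_atLeast0)

text \<open>A nonzero term of the determinant would match every element of K with one of I that is
  at least as large. Comparing the sums forces equality throughout and hence K = I. So compound
  matrices of triangular matrices are triangular with respect to the index sum.\<close>

lemma mnr_upper_eq_0:
  fixes M :: "nat \<Rightarrow> nat \<Rightarrow> 'r::comm_ring_1"
  assumes fin: "finite K" "finite I" and card: "card K = card I" and ne: "K \<noteq> I" and sum: "\<Sum>I \<le> \<Sum>K"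
    and M: "\<And>i j. i \<in> K \<Longrightarrow> j \<in> I \<Longrightarrow> j < i \<Longrightarrow> M i j = 0"
  shows "mnr M K I = 0"
proof -
  let ?n = "card I"
  let ?k = "\<lambda>r. sorted_list_of_set K ! r" and ?i = "\<lambda>r. sorted_list_of_set I ! r"
  let ?A = "mat ?n ?n (\<lambda>(r, c). M (?k r) (?i c))"
  have memK: "?k r \<in> K" if "r < ?n" for r
    using nth_mem[of r "sorted_list_of_set K"] that fin card by simp
  have memI: "?i r \<in> I" if "r < ?n" for r
    using nth_mem[of r "sorted_list_of_set I"] that fin by simp
  have "(\<Prod>r = 0..<?n. ?A $$ (r, p r)) = 0" if p: "p permutes {0..<?n}" for p
  proof (rule ccontr)
    assume nz: "(\<Prod>r = 0..<?n. ?A $$ (r, p r)) \<noteq> 0"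
    have pr: "p r < ?n" if "r < ?n" for r using permutes_in_image[OF p, of r] that by simp
    have le: "?k r \<le> ?i (p r)" if "r < ?n" for r
    proof (rule ccontr)
      assume "\<not> ?k r \<le> ?i (p r)"
      then have "?A $$ (r, p r) = 0" using that pr M memK memI by simp
      then have "(\<Prod>r = 0..<?n. ?A $$ (r, p r)) = 0" using that by (intro prod_zero) auto
      then show False using nz by simp
    qed
    have sI: "(\<Sum>r\<in>{0..<?n}. ?i (p r)) = \<Sum>I"
      using sum.permute[OF p, of ?i] sum_sorted_list_of_set[OF fin(2)] by (simp add: comp_def)
    have sK: "(\<Sum>r\<in>{0..<?n}. ?k r) = \<Sum>K" using sum_sorted_list_of_set[OF fin(1)] card by simp
    have eq: "?k r = ?i (p r)" if "r < ?n" for r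
    proof (rule ccontr)
      assume "?k r \<noteq> ?i (p r)"
      then have "?k r < ?i (p r)" using le[OF that] by simp
      then have "(\<Sum>r\<in>{0..<?n}. ?k r) < (\<Sum>r\<in>{0..<?n}. ?i (p r))"
        by (intro sum_strict_mono_ex1) (use le that in auto)
      then show False using sI sK sum by simp
    qed
    have "K \<subseteq> I"
    proof
      fix x assume "x \<in> K"
      then obtain r where "r < card K" "x = ?k r"
        using fin(1) by (metis in_set_conv_nth length_sorted_list_of_set set_sorted_list_of_set)
      then show "x \<in> I" using eq[of r] memI[OF pr[of r]] card by simp
    qed
    then show False using ne card fin card_subset_eq by blast
  qed
  then have "det ?A = 0"
    by (subst det_def'[of _ ?n]) (auto intro!: sum.neutral)
  then show ?thesis by (simp add: mnr_def card)
qed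

definition unitriangular :: "nat \<Rightarrow> 'k::field mat \<Rightarrow> bool" where
  "unitriangular d a \<longleftrightarrow> a \<in> carrier (GL d) \<and> (\<forall>i<d. \<forall>j<d. j < i \<longrightarrow> a $$ (i, j) = 0) \<and> (\<forall>i<d. a $$ (i, i) = 1)"

lemma mnr_unitriangular:
  assumes "unitriangular d a" "K \<in> subsets_of_size d t" "I \<in> subsets_of_size d t"
  shows "mnr (mat_fun a) I I = 1" "K \<noteq> I \<Longrightarrow> \<Sum>I \<le> \<Sum>K \<Longrightarrow> mnr (mat_fun a) K I = 0"
proof -
  have f: "finite K" "finite I" "card K = card I" and d: "K \<subseteq> {..<d}" "I \<subseteq> {..<d}"
    using assms(2,3) by (auto simp: subsets_of_size_def intro: finite_subset)
  have "mnr (mat_fun a) I I = (\<Prod>i\<in>I. mat_fun a i i)"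
    using f d assms(1) by (intro mnr_upper) (auto simp: unitriangular_def mat_fun_def)
  then show "mnr (mat_fun a) I I = 1" using d assms(1) by (auto simp: unitriangular_def mat_fun_def intro!: prod.neutral)
  assume "K \<noteq> I" "\<Sum>I \<le> \<Sum>K"
  then show "mnr (mat_fun a) K I = 0"
    using f d assms(1) by (intro mnr_upper_eq_0) (auto simp: unitriangular_def mat_fun_def)
qed

text \<open>The second component is chosen so that \<open>b\<close> itself, and not its
  contragredient, is the matrix acting on the dual space. Rows and columns are then treated
  alike.\<close>

definition group_elt :: "nat \<Rightarrow> 'k::field mat \<Rightarrow> 'k mat \<Rightarrow> 'k mat \<times> 'k mat" where
  "group_elt n a b = (a, contragredient n b)"

lemma group_elt_GG: "a \<in> carrier (GL m) \<Longrightarrow> b \<in> carrier (GL n) \<Longrightarrow> group_elt n a b \<in> carrier (GG m n)"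
  by (simp add: group_elt_def GG_carrier contragredient_GL)

lemma act_coeff_group_elt: "b \<in> carrier (GL n) \<Longrightarrow>
    act_coeff n (group_elt n a b) v' v = mnr (mat_fun a) (fst v') (fst v) * mnr (mat_fun b) (snd v') (snd v)"
  by (simp add: act_coeff_def group_elt_def contragredient_contragredient)

lemma one_GL: "1\<^sub>m d \<in> carrier (GL d)"
  by (rule GL_I(1)[of _ _ "1\<^sub>m d"]) auto

text \<open>The index sum is a coarse linear order in place of the dominance order on
  weights.\<close>

definition pot1 :: "nat set \<times> nat set \<Rightarrow> nat" where
  "pot1 v = \<Sum>(fst v) + \<Sum>(snd v)"

definition pot :: "nat set \<times> nat set \<Rightarrow> nat set \<times> nat set \<Rightarrow> nat" where
  "pot v w = pot1 v + pot1 w"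

lemma act_coeff_unitriangular:
  assumes "unitriangular m a" "unitriangular n b" "v' \<in> brackets t m n" "v \<in> brackets t m n"
  shows "act_coeff n (group_elt n a b) v v = 1" "v' \<noteq> v \<Longrightarrow> pot1 v \<le> pot1 v' \<Longrightarrow> act_coeff n (group_elt n a b) v' v = 0"
proof -
  have b: "b \<in> carrier (GL n)" using assms(2) by (simp add: unitriangular_def)
  have V: "fst v \<in> subsets_of_size m t" "snd v \<in> subsets_of_size n t"
    "fst v' \<in> subsets_of_size m t" "snd v' \<in> subsets_of_size n t"
    using assms(3,4) by (auto simp: brackets_def)
  show "act_coeff n (group_elt n a b) v v = 1"
    using mnr_unitriangular(1)[OF assms(1) V(1,1)] mnr_unitriangular(1)[OF assms(2) V(2,2)] by (simp add: act_coeff_group_elt[OF b])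
  assume ne: "v' \<noteq> v" and le: "pot1 v \<le> pot1 v'"
  show "act_coeff n (group_elt n a b) v' v = 0"
  proof (cases "mnr (mat_fun a) (fst v') (fst v) = 0 \<or> mnr (mat_fun b) (snd v') (snd v) = 0")
    case False
    then have 1: "fst v' = fst v \<or> \<Sum>(fst v') < \<Sum>(fst v)" "snd v' = snd v \<or> \<Sum>(snd v') < \<Sum>(snd v)"
      using mnr_unitriangular(2)[OF assms(1) V(3,1)] mnr_unitriangular(2)[OF assms(2) V(4,2)] by (meson not_le)+
    from 1 have "\<Sum>(fst v') \<le> \<Sum>(fst v)" "\<Sum>(snd v') \<le> \<Sum>(snd v)" by (metis le_refl less_imp_le)+
    with 1 le have "fst v' = fst v" "snd v' = snd v" unfolding pot1_def by linarith+
    then show ?thesis using ne by (metis prod.collapse)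
  qed (auto simp: act_coeff_group_elt[OF b])
qed

text \<open>If no support pair of x had larger index sum than the given pair, triangularity would
  leave only the diagonal term in \<open>pol_S_act\<close>, and the difference would vanish
  there.\<close>

lemma unitriangular_lowers_pot:
  assumes ab: "unitriangular m a" "unitriangular n b" and x: "x \<in> quad (brackets t m n)"
    and nz: "pol (S_act n (group_elt n a b) x - x) v' w' \<noteq> (0 :: 'k::field)"
  shows "\<exists>v w. pol x v w \<noteq> 0 \<and> pot v' w' < pot v w"
proof (rule ccontr)
  assume "\<not> ?thesis"
  then have le: "pol x v w \<noteq> 0 \<Longrightarrow> pot v w \<le> pot v' w'" for v w by (meson not_le)
  let ?g = "group_elt n a b" and ?B = "brackets t m n"
  have g: "?g \<in> carrier (GG m n)" using ab by (auto simp: unitriangular_def intro: group_elt_GG)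
  have "S_act n ?g x - x \<in> quad ?B"
    using S_act_quad[OF g x] x by (rule pm.subspace_diff[OF subspace_quad])
  note V = pol_outside[OF this nz]
  have "act_coeff n ?g v' v * act_coeff n ?g w' w * pol x v w = (if w = w' then if v = v' then pol x v w else 0 else 0)"
    if vw: "v \<in> ?B" "w \<in> ?B" for v w
  proof (cases "v = v' \<and> w = w'")
    case True
    then show ?thesis using act_coeff_unitriangular(1)[OF ab V(1,1)] act_coeff_unitriangular(1)[OF ab V(2,2)] by simp
  next
    case False
    show ?thesis
    proof (cases "pol x v w = 0")
      case nz: False
      have p: "pot1 v + pot1 w \<le> pot1 v' + pot1 w'" using le[OF nz] by (simp add: pot_def)
      \<comment> \<open>By the inequality of the sums, at least one of the two brackets does not
        increase in passing from the primed to the unprimed one; the case of an equality in one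
        factor is settled by the other.\<close>
      have "act_coeff n ?g v' v = 0 \<or> act_coeff n ?g w' w = 0"
      proof (cases "pot1 v \<le> pot1 v'")
        case True
        show ?thesis
        proof (cases "v' = v")
          case True
          then have "w' \<noteq> w" "pot1 w \<le> pot1 w'" using False p by auto
          then show ?thesis using act_coeff_unitriangular(2)[OF ab V(2) vw(2)] by simp
        next
          case False
          then show ?thesis using act_coeff_unitriangular(2)[OF ab V(1) vw(1)] True by simp
        qed
      next
        case F: False
        then have "pot1 w \<le> pot1 w'" "w' \<noteq> w" using p by auto
        then show ?thesis using act_coeff_unitriangular(2)[OF ab V(2) vw(2)] by simp
      qed
      then show ?thesis using False by auto
    qed auto
  qed
  then have "pol (S_act n ?g x) v' w' = (\<Sum>v\<in>?B. \<Sum>w\<in>?B. if w = w' then if v = v' then pol x v w else 0 else 0)"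
    unfolding pol_S_act[OF g x V] by (intro sum.cong refl) blast
  also have "\<dots> = pol x v' w'" using V by simp
  finally show False using nz by (simp add: pol_diff)
qed

definition elem_mat :: "nat \<Rightarrow> 'k::field \<Rightarrow> nat \<Rightarrow> 'k mat" where
  "elem_mat d s i = mat d d (\<lambda>(r, c). if r = c then 1 else if r = i \<and> c = Suc i then s else 0)"

lemma elem_mat_mult: "elem_mat d s i * elem_mat d s' i = (elem_mat d (s + s') i :: 'k::field mat)"
proof (rule eq_matI)
  fix r c assume "r < dim_row (elem_mat d (s + s') i)" "c < dim_col (elem_mat d (s + s') i)"
  then have rc: "r < d" "c < d" by (auto simp: elem_mat_def)
  have "(elem_mat d s i * elem_mat d s' i) $$ (r, c)
      = (\<Sum>k = 0..<d. (if k = r then elem_mat d s' i $$ (k, c) else 0)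
         + (if k = Suc i then if r = i then s * elem_mat d s' i $$ (k, c) else 0 else 0))"
    using rc by (auto simp: elem_mat_def scalar_prod_def intro!: sum.cong)
  also have "\<dots> = elem_mat d s' i $$ (r, c) + (if r = i \<and> Suc i < d then s * elem_mat d s' i $$ (Suc i, c) else 0)"
    using rc by (auto simp: sum.distrib)
  also have "\<dots> = elem_mat d (s + s') i $$ (r, c)"
    using rc by (auto simp: elem_mat_def)
  finally show "(elem_mat d s i * elem_mat d s' i) $$ (r, c) = elem_mat d (s + s') i $$ (r, c)" .
qed (auto simp: elem_mat_def)

lemma elem_mat_unitriangular: "unitriangular d (elem_mat d s i)"
proof -
  have "elem_mat d 0 i = (1\<^sub>m d :: 'a mat)" by (intro eq_matI) (auto simp: elem_mat_def)
  then have "elem_mat d s i \<in> carrier (GL d)"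
    using elem_mat_mult[of d s i "- s"] elem_mat_mult[of d "- s" i s]
    by (intro GL_I(1)[of _ _ "elem_mat d (- s) i"]) (auto simp: elem_mat_def)
  then show ?thesis by (auto simp: unitriangular_def elem_mat_def)
qed

lemma up_in_subsets_of_size:
  assumes "I \<in> subsets_of_size d t" "i \<in> I" "Suc i \<notin> I" "Suc i < d"
  shows "up i I \<in> subsets_of_size d t"
proof -
  have "finite I" "I \<subseteq> {..<d}" "card I = t" using subsets_of_size_finite[OF assms(1)] assms(1)
    by (auto simp: subsets_of_size_def)
  then show ?thesis using assms card_Suc_Diff1[of I i] by (auto simp: up_def subsets_of_size_def)
qed

text \<open>The compound of an adjacent elementary matrix has just one kind of entry off the
  diagonal. It is s without a sign, because i and i+1 occupy the same position in the increasing
  lists of K and \<open>up i K\<close>.\<close>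

lemma mnr_elem_mat:
  assumes K: "K \<in> subsets_of_size d t" and I: "I \<in> subsets_of_size d t" and i: "Suc i < d"
  shows "mnr (mat_fun (elem_mat d s i)) K I =
    (if I = K then 1 else if i \<in> K \<and> Suc i \<notin> K \<and> I = up i K then s else (0 :: 'k::field))"
proof -
  let ?M = "mat_fun (elem_mat d s i)"
  have f: "finite K" "finite I" "card K = card I" and d: "K \<subseteq> {..<d}" "I \<subseteq> {..<d}"
    using K I by (auto simp: subsets_of_size_def intro: finite_subset)
  have M: "?M r c = (if r = c then 1 else if r = i \<and> c = Suc i then s else 0)" if "r < d" "c < d" for r c
    using that by (simp add: mat_fun_def elem_mat_def)
  consider "I = K" | "I \<noteq> K" "i \<in> K" "Suc i \<notin> K" "I = up i K" | "I \<noteq> K" "\<not> (i \<in> K \<and> Suc i \<notin> K \<and> I = up i K)" by blast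
  then show ?thesis
  proof cases
    case 1
    then show ?thesis using mnr_unitriangular(1)[OF elem_mat_unitriangular K K] by simp
  next
    case 2
    have Ki: "K - {i} \<in> subsets_of_size d (t - 1)"
      using K 2 f by (auto simp: subsets_of_size_def)
    have I': "I - {Suc i} = K - {i}" "Suc i \<in> I" using 2 by (auto simp: up_def)
    have "(\<Sum>h\<in>I. (-1) ^ below I h * ?M i h * mnr ?M (K - {i}) (I - {h}))
       = (\<Sum>h\<in>I. if h = Suc i then (-1) ^ below I (Suc i) * s else 0)"
    proof (rule sum.cong[OF refl])
      fix h assume h: "h \<in> I"
      have "h \<noteq> i" using h 2 by (auto simp: up_def)
      moreover have "h < d" "i < d" using h d i by auto
      ultimately show "(-1) ^ below I h * ?M i h * mnr ?M (K - {i}) (I - {h}) = (if h = Suc i then (-1) ^ below I (Suc i) * s else 0)"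
        using mnr_unitriangular(1)[OF elem_mat_unitriangular Ki Ki, of s i] I' by (auto simp: M)
    qed
    also have "\<dots> = (-1) ^ below I (Suc i) * s" using I' f by simp
    finally have "mnr ?M K I = (-1) ^ below K i * ((-1) ^ below I (Suc i) * s)"
      using mnr_row_expand[OF f(1,2), of i ?M] f(3) 2 by simp
    moreover have "below I (Suc i) = below K i"
      unfolding below_def by (rule arg_cong[of _ _ card]) (use 2 in \<open>auto simp: up_def less_Suc_eq\<close>)
    ultimately show ?thesis using 2 by (simp add: mult.assoc[symmetric] power_add[symmetric])
  next
    case 3
    have "\<not> K \<subseteq> I" using 3(1) f card_subset_eq by blast
    then obtain k where k: "k \<in> K" "k \<notin> I" by blast
    have "mnr ?M K I = 0"
    proof (cases "\<exists>k\<in>K. k \<notin> I \<and> (k \<noteq> i \<or> Suc i \<notin> I)")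
      case True
      then obtain k where k: "k \<in> K" "k \<notin> I" "k \<noteq> i \<or> Suc i \<notin> I" by blast
      have "?M k h = 0" if "h \<in> I" for h
      proof -
        have "k < d" "h < d" "k \<noteq> h" using k that d by auto
        then show ?thesis using k that by (auto simp: M)
      qed
      then show ?thesis using k f by (intro mnr_zero_row[of _ k]) auto
    next
      case False
      \<comment> \<open>The remaining case: i is the only element of K missing from I. Then i+1 lies
        in both sets, so expanding along row i leaves only a minor with a zero row i+1.\<close>
      then have ki: "k = i" "Suc i \<in> I" and sub: "K - {i} \<subseteq> I" using k by auto
      have "Suc i \<in> K"
      proof (rule ccontr)
        assume n: "Suc i \<notin> K"
        have "up i K \<subseteq> I" using ki sub by (auto simp: up_def)
        moreover have "card (up i K) = card I"
          using up_in_subsets_of_size[OF K _ n i] k ki I by (auto simp: subsets_of_size_def)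
        ultimately have "up i K = I" using f card_subset_eq by blast
        then show False using 3 n k ki by auto
      qed
      have "(-1) ^ below I h * ?M i h * mnr ?M (K - {i}) (I - {h}) = 0" if h: "h \<in> I" for h
      proof (cases "h = Suc i")
        case True
        have "?M (Suc i) j = 0" if "j \<in> I - {Suc i}" for j
        proof -
          have "j < d" using that d by auto
          then show ?thesis using that i by (auto simp: M)
        qed
        then have "mnr ?M (K - {i}) (I - {Suc i}) = 0"
          using \<open>Suc i \<in> K\<close> f by (intro mnr_zero_row[of _ "Suc i"]) auto
        then show ?thesis using True by simp
      next
        case False
        have "h < d" "i < d" "h \<noteq> i" using h d i k ki by auto
        then show ?thesis using False by (simp add: M)
      qed
      then have "(\<Sum>h\<in>I. (-1) ^ below I h * ?M i h * mnr ?M (K - {i}) (I - {h})) = 0"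
        by (intro sum.neutral) blast
      then show ?thesis
        using mnr_row_expand[OF f(1,2), of i ?M] f(3) k ki by simp
    qed
    then show ?thesis using 3 by auto
  qed
qed

text \<open>A weight multiplicity is 0, 1 or 2 and gives the eigenvalue 1, 2 or 4. These are
  distinct in characteristic 0, so one such element for each i separates weights.\<close>

definition torus_mat :: "nat \<Rightarrow> nat \<Rightarrow> 'k::field_char_0 mat" where
  "torus_mat d i = mat d d (\<lambda>(r, c). if r = c then if r = i then 2 else 1 else 0)"

lemma diag_mult:
  "mat d d (\<lambda>(r, c). if r = c then f r else 0) * mat d d (\<lambda>(r, c). if r = c then g r else 0)
    = mat d d (\<lambda>(r, c). if r = c then f r * g r else (0 :: 'k::field))"
proof (rule eq_matI)
  fix r c assume "r < dim_row (mat d d (\<lambda>(r, c). if r = c then f r * g r else 0))"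
    "c < dim_col (mat d d (\<lambda>(r, c). if r = c then f r * g r else 0))"
  then have rc: "r < d" "c < d" by auto
  have "(mat d d (\<lambda>(r, c). if r = c then f r else 0) * mat d d (\<lambda>(r, c). if r = c then g r else 0)) $$ (r, c)
    = (\<Sum>k = 0..<d. (if r = k then f r else 0) * (if k = c then g k else 0))"
    using rc by (simp add: scalar_prod_def)
  also have "\<dots> = (\<Sum>k = 0..<d. if k = r then if r = c then f r * g r else 0 else 0)"
    by (intro sum.cong refl) auto
  finally show "(mat d d (\<lambda>(r, c). if r = c then f r else 0) * mat d d (\<lambda>(r, c). if r = c then g r else 0)) $$ (r, c)
    = mat d d (\<lambda>(r, c). if r = c then f r * g r else 0) $$ (r, c)"
    using rc by simp
qed auto

lemma torus_mat_GL: "torus_mat d i \<in> carrier (GL d)"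
proof -
  let ?B = "mat d d (\<lambda>(r, c). if r = c then if r = i then 1/2 else 1 else 0) :: 'a mat"
  have "torus_mat d i * ?B = 1\<^sub>m d" "?B * torus_mat d i = 1\<^sub>m d"
    unfolding torus_mat_def diag_mult by (intro eq_matI; simp)+
  then show ?thesis by (intro GL_I(1)[of _ _ ?B]) (auto simp: torus_mat_def)
qed

lemma mnr_torus_mat:
  assumes K: "K \<in> subsets_of_size d t" and I: "I \<in> subsets_of_size d t"
  shows "mnr (mat_fun (torus_mat d i)) K I = (if I = K then 2 ^ of_bool (i \<in> K) else (0 :: 'k::field_char_0))"
proof (cases "I = K")
  case True
  have f: "finite K" "K \<subseteq> {..<d}" using K subsets_of_size_finite[OF K] by (simp_all add: subsets_of_size_def)
  have "mnr (mat_fun (torus_mat d i)) K K = (\<Prod>k\<in>K. mat_fun (torus_mat d i) k k :: 'k)"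
    using f by (intro mnr_upper) (auto simp: torus_mat_def mat_fun_def)
  also have "\<dots> = (\<Prod>k\<in>K. if k = i then 2 else 1)"
    using f by (intro prod.cong refl) (auto simp: torus_mat_def mat_fun_def)
  also have "\<dots> = 2 ^ of_bool (i \<in> K)" using f by simp
  finally show ?thesis using True by simp
next
  case False
  have f: "finite K" "finite I" "card K = card I" and d: "K \<subseteq> {..<d}" "I \<subseteq> {..<d}"
    using K I by (auto simp: subsets_of_size_def intro: finite_subset)
  have "\<not> K \<subseteq> I" using False f card_subset_eq by blast
  then obtain k where k: "k \<in> K" "k \<notin> I" by blast
  have "mat_fun (torus_mat d i) k h = (0::'k)" if "h \<in> I" for h
  proof -
    have "k < d" "h < d" "k \<noteq> h" using k that d by auto
    then show ?thesis by (simp add: torus_mat_def mat_fun_def)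
  qed
  then show ?thesis using k f False by (simp add: mnr_zero_row[of K k])
qed

section \<open>Highest weight vectors in submodules\<close>

text \<open>Annihilation by all adjacent root vectors, written for the polarised coefficients: the
  two summands are the actions on the two brackets.\<close>

definition raised :: "nat \<Rightarrow> nat \<Rightarrow> nat \<Rightarrow> (nat set \<times> nat set \<Rightarrow> nat set \<times> nat set \<Rightarrow> 'k::field) \<Rightarrow> bool" where
  "raised t m n y \<longleftrightarrow> (\<forall>i. \<forall>v\<in>brackets t m n. \<forall>w\<in>brackets t m n.
    (Suc i < m \<longrightarrow> (if i \<in> fst v \<and> Suc i \<notin> fst v then y (up i (fst v), snd v) w else 0) +
       (if i \<in> fst w \<and> Suc i \<notin> fst w then y v (up i (fst w), snd w) else 0) = 0) \<and>
    (Suc i < n \<longrightarrow> (if i \<in> snd v \<and> Suc i \<notin> snd v then y (fst v, up i (snd v)) w else 0) +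
       (if i \<in> snd w \<and> Suc i \<notin> snd w then y v (fst w, up i (snd w)) else 0) = 0))"

lemma unitriangular_one: "unitriangular d (1\<^sub>m d)"
  by (simp add: unitriangular_def one_GL)

lemma unitriangular_GL: "unitriangular d a \<Longrightarrow> a \<in> carrier (GL d)"
  by (simp add: unitriangular_def)

lemma up_neq: "i \<in> I \<Longrightarrow> Suc i \<notin> I \<Longrightarrow> up i I \<noteq> I"
  by (auto simp: up_def)

lemma sum_act_coeff_elem_mat_V:
  assumes v': "v' \<in> brackets t m n" and i: "Suc i < m"
  shows "(\<Sum>v\<in>brackets t m n. act_coeff n (group_elt n (elem_mat m s i) (1\<^sub>m n)) v' v * f v)
    = f v' + s * (if i \<in> fst v' \<and> Suc i \<notin> fst v' then f (up i (fst v'), snd v') else (0 :: 'k::field))"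
proof -
  let ?c = "i \<in> fst v' \<and> Suc i \<notin> fst v'" and ?u = "(up i (fst v'), snd v')"
  have V: "fst v' \<in> subsets_of_size m t" "snd v' \<in> subsets_of_size n t" using v' by (auto simp: brackets_def)
  have "act_coeff n (group_elt n (elem_mat m s i) (1\<^sub>m n)) v' v * f v
      = (if v = v' then f v' else 0) + (if v = ?u then s * (if ?c then f ?u else 0) else 0)"
    if v: "v \<in> brackets t m n" for v
  proof -
    have W: "fst v \<in> subsets_of_size m t" "snd v \<in> subsets_of_size n t" using v by (auto simp: brackets_def)
    have "act_coeff n (group_elt n (elem_mat m s i) (1\<^sub>m n)) v' v
      = (if fst v = fst v' then 1 else if ?c \<and> fst v = up i (fst v') then s else 0) * of_bool (snd v' = snd v)"
      unfolding act_coeff_group_elt[OF one_GL] mnr_elem_mat[OF V(1) W(1) i] mnr_mat_fun_one[OF V(2) W(2)] by simp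
    then show ?thesis using up_neq[of i "fst v'"] by (cases v; cases v') auto
  qed
  then have "(\<Sum>v\<in>brackets t m n. act_coeff n (group_elt n (elem_mat m s i) (1\<^sub>m n)) v' v * f v)
     = (\<Sum>v\<in>brackets t m n. (if v = v' then f v' else 0) + (if v = ?u then s * (if ?c then f ?u else 0) else 0))"
    by (intro sum.cong refl) blast
  also have "\<dots> = f v' + s * (if ?c then f ?u else 0)"
  proof (cases ?c)
    case True
    then have "?u \<in> brackets t m n" using up_in_subsets_of_size[OF V(1) _ _ i] V(2) by (simp add: brackets_def)
    then show ?thesis using v' by (simp add: sum.distrib)
  next
    case False
    then show ?thesis unfolding if_not_P[OF False] using v' by (simp add: sum.distrib)
  qed
  finally show ?thesis .
qed

lemma sum_act_coeff_elem_mat_W: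
  assumes v': "v' \<in> brackets t m n" and i: "Suc i < n"
  shows "(\<Sum>v\<in>brackets t m n. act_coeff n (group_elt n (1\<^sub>m m) (elem_mat n s i)) v' v * f v)
    = f v' + s * (if i \<in> snd v' \<and> Suc i \<notin> snd v' then f (fst v', up i (snd v')) else (0 :: 'k::field))"
proof -
  let ?c = "i \<in> snd v' \<and> Suc i \<notin> snd v'" and ?u = "(fst v', up i (snd v'))"
  have V: "fst v' \<in> subsets_of_size m t" "snd v' \<in> subsets_of_size n t" using v' by (auto simp: brackets_def)
  have "act_coeff n (group_elt n (1\<^sub>m m) (elem_mat n s i)) v' v * f v
      = (if v = v' then f v' else 0) + (if v = ?u then s * (if ?c then f ?u else 0) else 0)"
    if v: "v \<in> brackets t m n" for v
  proof -
    have W: "fst v \<in> subsets_of_size m t" "snd v \<in> subsets_of_size n t" using v by (auto simp: brackets_def)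
    have "act_coeff n (group_elt n (1\<^sub>m m) (elem_mat n s i)) v' v
      = of_bool (fst v' = fst v) * (if snd v = snd v' then 1 else if ?c \<and> snd v = up i (snd v') then s else 0)"
      unfolding act_coeff_group_elt[OF unitriangular_GL[OF elem_mat_unitriangular]] mnr_elem_mat[OF V(2) W(2) i] mnr_mat_fun_one[OF V(1) W(1)] by simp
    then show ?thesis using up_neq[of i "snd v'"] by (cases v; cases v') auto
  qed
  then have "(\<Sum>v\<in>brackets t m n. act_coeff n (group_elt n (1\<^sub>m m) (elem_mat n s i)) v' v * f v)
     = (\<Sum>v\<in>brackets t m n. (if v = v' then f v' else 0) + (if v = ?u then s * (if ?c then f ?u else 0) else 0))"
    by (intro sum.cong refl) blast
  also have "\<dots> = f v' + s * (if ?c then f ?u else 0)"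
  proof (cases ?c)
    case True
    then have "?u \<in> brackets t m n" using up_in_subsets_of_size[OF V(2) _ _ i] V(1) by (simp add: brackets_def)
    then show ?thesis using v' by (simp add: sum.distrib)
  next
    case False
    then show ?thesis unfolding if_not_P[OF False] using v' by (simp add: sum.distrib)
  qed
  finally show ?thesis .
qed

text \<open>The linear term in \<open>s\<close> of the action of \<open>1 + s E_{i,i+1}\<close> is isolated by taking \<open>s = 1\<close> and \<open>s = -1\<close>.\<close>

lemma linear_term:
  assumes "\<And>s. s = 1 \<or> s = -1 \<Longrightarrow> y + s * a + s * (b + s * c) = (y :: 'k::field_char_0)"
  shows "b + a = 0"
proof -
  have 1: "a + b + c = 0" using assms[of 1] by (simp add: add.assoc)
  have 2: "c = a + b" using assms[of "-1"] by (simp add: algebra_simps)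
  have "(b + a) + (b + a) = 0" using 1 2 by (simp add: add_ac)
  then have "2 * (b + a) = 0" by (simp only: mult_2)
  then show ?thesis by (simp only: mult_eq_0_iff) simp
qed

lemma self_eq_minus: "x = - x \<Longrightarrow> x = (0 :: 'k::field_char_0)"
proof -
  assume "x = - x"
  then have "x + x = 0" by (metis add.right_inverse)
  then have "2 * x = 0" by (simp only: mult_2)
  then show ?thesis by (simp only: mult_eq_0_iff) simp
qed

text \<open>Acting by an elementary matrix makes a coefficient a polynomial of degree at most 2 in
  s. Invariance annihilates its linear term, which is the raising equation.\<close>

lemma fixed_imp_raised:
  assumes x: "x \<in> quad (brackets t m n)"
    and fixed: "\<And>a b. unitriangular m a \<Longrightarrow> unitriangular n b \<Longrightarrow> S_act n (group_elt n a b) x = (x :: 'k::field_char_0 minor_poly)"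
  shows "raised t m n (pol x)"
  unfolding raised_def
proof (intro allI ballI conjI impI)
  fix i v w assume v: "v \<in> brackets t m n" and w: "w \<in> brackets t m n"
  let ?B = "brackets t m n"
  \<comment> \<open>The double sum is nested, so that the formula for one bracket can be applied
    twice.\<close>
  have split: "pol (S_act n g x) v w = (\<Sum>v'\<in>?B. act_coeff n g v v' * (\<Sum>w'\<in>?B. act_coeff n g w w' * pol x v' w'))"
    if "g \<in> carrier (GG m n)" for g
    unfolding pol_S_act[OF that x v w] by (simp add: sum_distrib_left mult.assoc)
  {
    assume i: "Suc i < m"
    show "(if i \<in> fst v \<and> Suc i \<notin> fst v then pol x (up i (fst v), snd v) w else 0) +
         (if i \<in> fst w \<and> Suc i \<notin> fst w then pol x v (up i (fst w), snd w) else 0) = 0"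
    proof (rule linear_term[where y = "pol x v w" and c =
        "if i \<in> fst v \<and> Suc i \<notin> fst v then if i \<in> fst w \<and> Suc i \<notin> fst w
           then pol x (up i (fst v), snd v) (up i (fst w), snd w) else 0 else 0"])
      fix s :: 'k
      let ?g = "group_elt n (elem_mat m s i) (1\<^sub>m n)"
      have "?g \<in> carrier (GG m n)" by (intro group_elt_GG unitriangular_GL elem_mat_unitriangular unitriangular_one)
      from split[OF this] have "pol x v w = (\<Sum>v'\<in>?B. act_coeff n ?g v v' * (\<Sum>w'\<in>?B. act_coeff n ?g w w' * pol x v' w'))"
        by (simp add: fixed elem_mat_unitriangular unitriangular_one)
      then show "pol x v w + s * (if i \<in> fst w \<and> Suc i \<notin> fst w then pol x v (up i (fst w), snd w) else 0) +
        s * ((if i \<in> fst v \<and> Suc i \<notin> fst v then pol x (up i (fst v), snd v) w else 0) +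
        s * (if i \<in> fst v \<and> Suc i \<notin> fst v then if i \<in> fst w \<and> Suc i \<notin> fst w
           then pol x (up i (fst v), snd v) (up i (fst w), snd w) else 0 else 0)) = pol x v w"
        unfolding sum_act_coeff_elem_mat_V[OF v i] sum_act_coeff_elem_mat_V[OF w i] by (auto split: if_splits)
    qed
  next
    assume i: "Suc i < n"
    show "(if i \<in> snd v \<and> Suc i \<notin> snd v then pol x (fst v, up i (snd v)) w else 0) +
         (if i \<in> snd w \<and> Suc i \<notin> snd w then pol x v (fst w, up i (snd w)) else 0) = 0"
    proof (rule linear_term[where y = "pol x v w" and c =
        "if i \<in> snd v \<and> Suc i \<notin> snd v then if i \<in> snd w \<and> Suc i \<notin> snd w
           then pol x (fst v, up i (snd v)) (fst w, up i (snd w)) else 0 else 0"])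
      fix s :: 'k
      let ?g = "group_elt n (1\<^sub>m m) (elem_mat n s i)"
      have "?g \<in> carrier (GG m n)" by (intro group_elt_GG unitriangular_GL elem_mat_unitriangular unitriangular_one)
      from split[OF this] have "pol x v w = (\<Sum>v'\<in>?B. act_coeff n ?g v v' * (\<Sum>w'\<in>?B. act_coeff n ?g w w' * pol x v' w'))"
        by (simp add: fixed elem_mat_unitriangular unitriangular_one)
      then show "pol x v w + s * (if i \<in> snd w \<and> Suc i \<notin> snd w then pol x v (fst w, up i (snd w)) else 0) +
        s * ((if i \<in> snd v \<and> Suc i \<notin> snd v then pol x (fst v, up i (snd v)) w else 0) +
        s * (if i \<in> snd v \<and> Suc i \<notin> snd v then if i \<in> snd w \<and> Suc i \<notin> snd w
           then pol x (fst v, up i (snd v)) (fst w, up i (snd w)) else 0 else 0)) = pol x v w"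
        unfolding sum_act_coeff_elem_mat_W[OF v i] sum_act_coeff_elem_mat_W[OF w i] by (auto split: if_splits)
    qed
  }
qed

definition wt2 :: "nat set \<times> nat set \<Rightarrow> nat set \<times> nat set \<Rightarrow> (nat \<Rightarrow> nat) \<times> (nat \<Rightarrow> nat)" where
  "wt2 v w = (wt (fst v) (fst w), wt (snd v) (snd w))"

definition admissible :: "nat \<Rightarrow> nat \<Rightarrow> nat \<Rightarrow> nat \<times> nat \<Rightarrow> bool" where
  "admissible t m n q \<longleftrightarrow> fst q \<le> t \<and> snd q \<le> t \<and> t + fst q \<le> m \<and> t + snd q \<le> n \<and> even (fst q + snd q)"

abbreviation fv :: "nat \<Rightarrow> nat \<times> nat \<Rightarrow> 'k::field minor_poly" where
  "fv t q \<equiv> f_vec t (fst q) (snd q)"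

lemma fv_quad: "admissible t m n q \<Longrightarrow> (fv t q :: 'k::field minor_poly) \<in> quad (brackets t m n)"
  by (simp add: admissible_def f_vec_quad)

lemma fv_neq_0: "admissible t m n q \<Longrightarrow> (fv t q :: 'k::field_char_0 minor_poly) \<noteq> 0"
  by (simp add: admissible_def f_vec_neq_0)

text \<open>The two-sided classification yields a multiple of \<open>hvec2\<close>. Only types with
  u + v even are compatible with the symmetry of \<open>pol\<close>.\<close>

theorem highest_weight_vector:
  fixes x :: "'k::field_char_0 minor_poly"
  assumes x: "x \<in> quad (brackets t m n)" and r: "raised t m n (pol x)" and nz: "pol x v0 w0 \<noteq> 0"
    and pure: "\<And>v w. pol x v w \<noteq> 0 \<Longrightarrow> wt2 v w = wt2 v0 w0"
  shows "\<exists>q c. admissible t m n q \<and> c \<noteq> 0 \<and> x = pm_scale c (fv t q)"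
proof -
  have "\<exists>u v c. u \<le> t \<and> v \<le> t \<and> t + u \<le> m \<and> t + v \<le> n \<and> c \<noteq> 0 \<and>
     (\<forall>I H J K. pol x (I, H) (J, K) = c * (hvec (t - u) (t + u) t I J * hvec (t - v) (t + v) t H K))"
  proof (rule highest_weight_two_sided[where ?I0.0 = "fst v0" and ?J0.0 = "fst w0" and ?H0.0 = "snd v0" and ?K0.0 = "snd w0"])
    show "{I, J} \<subseteq> subsets_of_size m t \<and> {H, K} \<subseteq> subsets_of_size n t" if "pol x (I, H) (J, K) \<noteq> 0" for I H J K
      using pol_outside[OF x that] by (simp add: brackets_def)
    show "wt I J = wt (fst v0) (fst w0) \<and> wt H K = wt (snd v0) (snd w0)" if "pol x (I, H) (J, K) \<noteq> 0" for I H J K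
      using pure[OF that] by (simp add: wt2_def)
    fix i I H J K assume "I \<in> subsets_of_size m t" "J \<in> subsets_of_size m t" "H \<in> subsets_of_size n t" "K \<in> subsets_of_size n t"
    then have V: "(I, H) \<in> brackets t m n" "(J, K) \<in> brackets t m n" by (auto simp: brackets_def)
    note r' = r[unfolded raised_def, rule_format, OF V, of i, unfolded fst_conv snd_conv]
    show "(if i \<in> I \<and> Suc i \<notin> I then pol x (up i I, H) (J, K) else 0) +
        (if i \<in> J \<and> Suc i \<notin> J then pol x (I, H) (up i J, K) else 0) = 0" if "Suc i < m"
      by (rule conjunct1[OF r', rule_format, OF that])
    show "(if i \<in> H \<and> Suc i \<notin> H then pol x (I, up i H) (J, K) else 0) +
        (if i \<in> K \<and> Suc i \<notin> K then pol x (I, H) (J, up i K) else 0) = 0" if "Suc i < n"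
      by (rule conjunct2[OF r', rule_format, OF that])
  qed (use nz in simp)
  then obtain u v c where uv: "u \<le> t" "v \<le> t" "t + u \<le> m" "t + v \<le> n" and c: "c \<noteq> 0"
    and p: "\<And>I H J K. pol x (I, H) (J, K) = c * (hvec (t - u) (t + u) t I J * hvec (t - v) (t + v) t H K)"
    by blast
  have p': "pol x y z = c * hvec2 t u v y z" for y z
    using p[of "fst y" "snd y" "fst z" "snd z"] by (simp add: hvec2_def)
  \<comment> \<open>For odd u + v the array would be both symmetric and antisymmetric.\<close>
  have ev: "even (u + v)"
  proof (rule ccontr)
    assume "odd (u + v)"
    then have "hvec2 t u v w0 v0 = - (hvec2 t u v v0 w0 :: 'k)" by (subst hvec2_swap[OF uv(1,2)]) simp
    moreover have "c * hvec2 t u v v0 w0 = c * hvec2 t u v w0 v0" using pol_sym[of x v0 w0] by (simp add: p')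
    ultimately have "c * hvec2 t u v v0 w0 = - (c * hvec2 t u v v0 w0)" by (metis mult_minus_right)
    then have "c * hvec2 t u v v0 w0 = 0" by (rule self_eq_minus)
    then show False using nz p' by simp
  qed
  \<comment> \<open>Half the scalar appears because the polarisation of \<open>f_vec\<close> is
    twice \<open>hvec2\<close>.\<close>
  have "x = pm_scale (c / 2) (fv t (u, v))"
  proof (rule pol_inject[OF finite_brackets x])
    show "pm_scale (c / 2) (fv t (u, v)) \<in> quad (brackets t m n)"
      by (simp add: pm.subspace_scale[OF subspace_quad] f_vec_quad uv)
    show "pol x y z = pol (pm_scale (c / 2) (fv t (u, v))) y z" for y z
      by (simp add: pol_scale pol_f_vec_even[OF uv(1,2) ev] p')
  qed
  moreover have "admissible t m n (u, v)" using uv ev by (simp add: admissible_def)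
  moreover have "c / 2 \<noteq> 0" using c by simp
  ultimately show ?thesis by blast
qed

definition quad_submodule :: "nat \<Rightarrow> nat \<Rightarrow> nat \<Rightarrow> 'k::field minor_poly set \<Rightarrow> bool" where
  "quad_submodule t m n N \<longleftrightarrow> pm.subspace N \<and> N \<subseteq> quad (brackets t m n) \<and> (\<forall>g\<in>carrier (GG m n). \<forall>x\<in>N. S_act n g x \<in> N)"

lemma quad_submodule_subspace: "quad_submodule t m n N \<Longrightarrow> pm.subspace N"
  and quad_submodule_quad: "quad_submodule t m n N \<Longrightarrow> x \<in> N \<Longrightarrow> x \<in> quad (brackets t m n)"
  and quad_submodule_act: "quad_submodule t m n N \<Longrightarrow> g \<in> carrier (GG m n) \<Longrightarrow> x \<in> N \<Longrightarrow> S_act n g x \<in> N"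
  by (auto simp: quad_submodule_def)

lemma pol_torus_mat_V:
  assumes x: "x \<in> quad (brackets t m n)"
  shows "pol (S_act n (group_elt n (torus_mat m i) (1\<^sub>m n)) x) v w = 2 ^ wt (fst v) (fst w) i * pol (x :: 'k::field_char_0 minor_poly) v w"
proof (cases "v \<in> brackets t m n \<and> w \<in> brackets t m n")
  case True
  let ?g = "group_elt n (torus_mat m i) (1\<^sub>m n) :: 'k mat \<times> 'k mat" and ?B = "brackets t m n"
  have g: "?g \<in> carrier (GG m n)" by (intro group_elt_GG torus_mat_GL one_GL)
  have act_coeff: "act_coeff n ?g v v' = (if v' = v then 2 ^ of_bool (i \<in> fst v) else 0)" if "v \<in> ?B" "v' \<in> ?B" for v v'
  proof -
    have V: "fst v \<in> subsets_of_size m t" "snd v \<in> subsets_of_size n t"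
      "fst v' \<in> subsets_of_size m t" "snd v' \<in> subsets_of_size n t" using that by (auto simp: brackets_def)
    show ?thesis unfolding act_coeff_group_elt[OF one_GL] mnr_torus_mat[OF V(1,3)] mnr_mat_fun_one[OF V(2,4)]
      by (cases v; cases v') auto
  qed
  have "pol (S_act n ?g x) v w = (\<Sum>v'\<in>?B. \<Sum>w'\<in>?B. if w' = w then if v' = v then 2 ^ of_bool (i \<in> fst v) * 2 ^ of_bool (i \<in> fst w) * pol x v w else 0 else 0)"
    unfolding pol_S_act[OF g x conjunct1[OF True] conjunct2[OF True]]
    by (intro sum.cong refl) (use True in \<open>simp add: act_coeff\<close>)
  then show ?thesis using True by (simp add: wt_def power_add)
next
  case False
  have g: "group_elt n (torus_mat m i) (1\<^sub>m n) \<in> carrier (GG m n)" by (intro group_elt_GG torus_mat_GL one_GL)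
  have "pol x v w = 0" using False pol_outside[OF x, of v w] by blast
  moreover have "pol (S_act n (group_elt n (torus_mat m i) (1\<^sub>m n)) x) v w = 0"
    using False pol_outside[OF S_act_quad[OF g x], of v w] by blast
  ultimately show ?thesis by simp
qed

lemma pol_torus_mat_W:
  assumes x: "x \<in> quad (brackets t m n)"
  shows "pol (S_act n (group_elt n (1\<^sub>m m) (torus_mat n i)) x) v w = 2 ^ wt (snd v) (snd w) i * pol (x :: 'k::field_char_0 minor_poly) v w"
proof (cases "v \<in> brackets t m n \<and> w \<in> brackets t m n")
  case True
  let ?g = "group_elt n (1\<^sub>m m) (torus_mat n i) :: 'k mat \<times> 'k mat" and ?B = "brackets t m n"
  have g: "?g \<in> carrier (GG m n)" by (intro group_elt_GG torus_mat_GL one_GL)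
  have act_coeff: "act_coeff n ?g v v' = (if v' = v then 2 ^ of_bool (i \<in> snd v) else 0)" if "v \<in> ?B" "v' \<in> ?B" for v v'
  proof -
    have V: "fst v \<in> subsets_of_size m t" "snd v \<in> subsets_of_size n t"
      "fst v' \<in> subsets_of_size m t" "snd v' \<in> subsets_of_size n t" using that by (auto simp: brackets_def)
    show ?thesis unfolding act_coeff_group_elt[OF torus_mat_GL] mnr_torus_mat[OF V(2,4)] mnr_mat_fun_one[OF V(1,3)]
      by (cases v; cases v') auto
  qed
  have "pol (S_act n ?g x) v w = (\<Sum>v'\<in>?B. \<Sum>w'\<in>?B. if w' = w then if v' = v then 2 ^ of_bool (i \<in> snd v) * 2 ^ of_bool (i \<in> snd w) * pol x v w else 0 else 0)"
    unfolding pol_S_act[OF g x conjunct1[OF True] conjunct2[OF True]]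
    by (intro sum.cong refl) (use True in \<open>simp add: act_coeff\<close>)
  then show ?thesis using True by (simp add: wt_def power_add)
next
  case False
  have g: "group_elt n (1\<^sub>m m) (torus_mat n i) \<in> carrier (GG m n)" by (intro group_elt_GG torus_mat_GL one_GL)
  have "pol x v w = 0" using False pol_outside[OF x, of v w] by blast
  moreover have "pol (S_act n (group_elt n (1\<^sub>m m) (torus_mat n i)) x) v w = 0"
    using False pol_outside[OF S_act_quad[OF g x], of v w] by blast
  ultimately show ?thesis by simp
qed

lemma wt2_separating:
  assumes "wt2 v w \<noteq> wt2 v' w'"
  shows "\<exists>f e. (f = (\<lambda>p. fst p e) \<or> f = (\<lambda>p. snd p e)) \<and> f (wt2 v w) \<noteq> (f (wt2 v' w') :: nat)"
proof -
  have "fst (wt2 v w) \<noteq> fst (wt2 v' w') \<or> snd (wt2 v w) \<noteq> snd (wt2 v' w')"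
    using assms by (metis prod_eqI)
  then obtain e where "fst (wt2 v w) e \<noteq> fst (wt2 v' w') e \<or> snd (wt2 v w) e \<noteq> snd (wt2 v' w') e" by blast
  then show ?thesis by blast
qed

text \<open>The torus elements \<open>diag(1, \<dots>, 2, \<dots>, 1)\<close> separate the weights, so an element of a submodule whose
  support contains a given weight, and has as few elements as possible, is a weight vector.\<close>

lemma weight_component:
  fixes y :: "'k::field_char_0 minor_poly"
  assumes N: "quad_submodule t m n N" and y: "y \<in> N" and nz: "pol y v0 w0 \<noteq> 0"
  shows "\<exists>y'\<in>N. \<exists>\<phi>. (\<forall>v w. pol y' v w = \<phi> (wt2 v w) * pol y v w) \<and> pol y' v0 w0 \<noteq> 0 \<and>
    (\<forall>v w. pol y' v w \<noteq> 0 \<longrightarrow> wt2 v w = wt2 v0 w0)"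
proof -
  let ?supp = "\<lambda>x :: 'k minor_poly. {(v, w) \<in> brackets t m n \<times> brackets t m n. pol x v w \<noteq> 0}"
  \<comment> \<open>The function \<phi> records that only a rescaling of weight components has taken
    place. It is part of the conclusion because such rescalings preserve the raising
    equations.\<close>
  define Q where "Q x \<longleftrightarrow> x \<in> N \<and> (\<exists>\<phi>. \<forall>v w. pol x v w = \<phi> (wt2 v w) * pol y v w) \<and> pol x v0 w0 \<noteq> 0" for x
  have fin: "finite (?supp x)" for x by (rule finite_subset[of _ "brackets t m n \<times> brackets t m n"]) auto
  have "Q y" using y nz unfolding Q_def by (auto intro: exI[of _ "\<lambda>_. 1"])
  then obtain x where Qx: "Q x" and least: "\<And>z. Q z \<Longrightarrow> card (?supp x) \<le> card (?supp z)"
    using ex_has_least_nat[of Q y "\<lambda>x. card (?supp x)"] by blast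
  then obtain \<phi> where xN: "x \<in> N" and \<phi>: "\<And>v w. pol x v w = \<phi> (wt2 v w) * pol y v w" and xnz: "pol x v0 w0 \<noteq> 0"
    unfolding Q_def by blast
  have "wt2 v w = wt2 v0 w0" if vw: "pol x v w \<noteq> 0" for v w
  proof (rule ccontr)
    assume "wt2 v w \<noteq> wt2 v0 w0"
    then obtain f e where f: "f = (\<lambda>p. fst p e) \<or> f = (\<lambda>p. snd p e)" and ne: "f (wt2 v w) \<noteq> (f (wt2 v0 w0) :: nat)"
      using wt2_separating by blast
    have xq: "x \<in> quad (brackets t m n)" using quad_submodule_quad[OF N xN] .
    have "\<exists>g\<in>carrier (GG m n). \<forall>v w. pol (S_act n g x) v w = 2 ^ f (wt2 v w) * pol x v w"
      using f
    proof
      assume f: "f = (\<lambda>p. fst p e)"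
      show ?thesis
        by (rule bexI[of _ "group_elt n (torus_mat m e) (1\<^sub>m n)"])
          (auto simp: f wt2_def pol_torus_mat_V[OF xq] intro!: group_elt_GG torus_mat_GL one_GL)
    next
      assume f: "f = (\<lambda>p. snd p e)"
      show ?thesis
        by (rule bexI[of _ "group_elt n (1\<^sub>m m) (torus_mat n e)"])
          (auto simp: f wt2_def pol_torus_mat_W[OF xq] intro!: group_elt_GG torus_mat_GL one_GL)
    qed
    then obtain g where g: "g \<in> carrier (GG m n)" and pg: "\<And>v w. pol (S_act n g x) v w = 2 ^ f (wt2 v w) * pol x v w"
      by blast
    let ?c = "2 ^ f (wt2 v w) :: 'k"
    \<comment> \<open>This combination kills the weight of (v, w) and keeps the weight of (v0, w0)
      with a nonzero factor.\<close>
    let ?z = "S_act n g x - pm_scale ?c x"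
    have pz: "pol ?z v' w' = (2 ^ f (wt2 v' w') - ?c) * pol x v' w'" for v' w'
      by (simp add: pol_diff pol_scale pg left_diff_distrib)
    have ne': "2 ^ f (wt2 v0 w0) \<noteq> ?c"
    proof
      assume "2 ^ f (wt2 v0 w0) = ?c"
      then have "of_nat (2 ^ f (wt2 v0 w0)) = (of_nat (2 ^ f (wt2 v w)) :: 'k)" by simp
      then have "(2::nat) ^ f (wt2 v0 w0) = 2 ^ f (wt2 v w)" by (simp only: of_nat_eq_iff)
      then show False using ne by simp
    qed
    have "Q ?z" unfolding Q_def
    proof (intro conjI exI[of _ "\<lambda>p. (2 ^ f p - ?c) * \<phi> p"] allI)
      show "?z \<in> N"
        by (intro pm.subspace_diff pm.subspace_scale quad_submodule_subspace[OF N] quad_submodule_act[OF N g xN] xN)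
      show "pol ?z v0 w0 \<noteq> 0" using ne' xnz by (simp add: pz)
    qed (simp add: pz \<phi>)
    then have "card (?supp x) \<le> card (?supp ?z)" by (rule least)
    moreover have "card (?supp ?z) < card (?supp x)"
    proof (rule psubset_card_mono[OF fin], rule psubsetI)
      show "?supp ?z \<subseteq> ?supp x" by (auto simp: pz)
      have "(v, w) \<in> ?supp x" using vw pol_outside[OF xq vw] by simp
      moreover have "(v, w) \<notin> ?supp ?z" by (simp add: pz)
      ultimately show "?supp ?z \<noteq> ?supp x" by blast
    qed
    ultimately show False by linarith
  qed
  then show ?thesis using xN \<phi> xnz by blast
qed

lemma sum_eq_weighted:
  assumes "A \<subseteq> {..<m}" "B \<subseteq> {..<m}"
  shows "\<Sum>A + \<Sum>B = (\<Sum>i<m. i * wt A B i)"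
proof -
  have s: "\<Sum>S = (\<Sum>i<m. i * of_bool (i \<in> S))" if "S \<subseteq> {..<m}" for S :: "nat set"
  proof -
    have "(\<Sum>i<m. i * of_bool (i \<in> S)) = (\<Sum>i\<in>S. i)"
      by (rule sum.mono_neutral_cong_right) (use that in auto)
    then show ?thesis by simp
  qed
  show ?thesis unfolding s[OF assms(1)] s[OF assms(2)] wt_def
    by (simp only: sum.distrib distrib_left)
qed

text \<open>The total index sum is the sum of i times the multiplicity of i in the weight.\<close>

lemma pot_wt2:
  assumes "v \<in> brackets t m n" "w \<in> brackets t m n" "v' \<in> brackets t m n" "w' \<in> brackets t m n" "wt2 v w = wt2 v' w'"
  shows "pot v w = pot v' w'"
proof -
  have *: "pot v w = (\<Sum>i<m. i * fst (wt2 v w) i) + (\<Sum>i<n. i * snd (wt2 v w) i)"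
    if "v \<in> brackets t m n" "w \<in> brackets t m n" for v w
  proof -
    have "fst v \<subseteq> {..<m}" "fst w \<subseteq> {..<m}" "snd v \<subseteq> {..<n}" "snd w \<subseteq> {..<n}"
      using that by (auto simp: brackets_def subsets_of_size_def)
    then show ?thesis
      using sum_eq_weighted[of "fst v" m "fst w"] sum_eq_weighted[of "snd v" n "snd w"]
      by (simp add: pot_def pot1_def wt2_def)
  qed
  show ?thesis unfolding *[OF assms(1,2)] *[OF assms(3,4)] assms(5) ..
qed

lemma pol_nonzero:
  assumes "x \<in> quad (brackets t m n)" "x \<noteq> (0 :: 'k::field_char_0 minor_poly)"
  shows "\<exists>v w. pol x v w \<noteq> 0"
proof (rule ccontr)
  assume "\<not> ?thesis"
  then have "x = 0"
    by (intro pol_inject[OF finite_brackets assms(1)]) (auto simp: pm.subspace_0[OF subspace_quad])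
  then show False using assms(2) by simp
qed

text \<open>Among all weights of \<open>N\<close> one of least total index sum is fixed by the unitriangular group,
  since unitriangular elements change a vector only by terms of smaller index sum.\<close>

lemma exists_f_vec:
  fixes N :: "'k::field_char_0 minor_poly set"
  assumes N: "quad_submodule t m n N" and ne: "N \<noteq> {0}"
  shows "\<exists>q. admissible t m n q \<and> fv t q \<in> N \<and>
    (\<forall>a b. unitriangular m a \<longrightarrow> unitriangular n b \<longrightarrow> S_act n (group_elt n a b) (fv t q) = (fv t q :: 'k minor_poly))"
proof -
  define P where "P k \<longleftrightarrow> (\<exists>x\<in>N. \<exists>v w. pol x v w \<noteq> 0 \<and> pot v w = k)" for k
  obtain x where "x \<in> N" "x \<noteq> 0" using ne pm.subspace_0[OF quad_submodule_subspace[OF N]] by auto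
  then have "\<exists>k. P k" using pol_nonzero[OF quad_submodule_quad[OF N]] unfolding P_def by blast
  define k where "k = (LEAST k. P k)"
  have Pk: "P k" unfolding k_def using \<open>\<exists>k. P k\<close> by (rule LeastI_ex)
  have least: "k \<le> pot v w" if "x \<in> N" "pol x v w \<noteq> 0" for x v w
    unfolding k_def by (rule Least_le) (use that in \<open>unfold P_def, blast\<close>)
  obtain y v0 w0 where y: "y \<in> N" "pol y v0 w0 \<noteq> 0" "pot v0 w0 = k" using Pk unfolding P_def by blast
  obtain z where z: "z \<in> N" "pol z v0 w0 \<noteq> 0" and pure: "\<And>v w. pol z v w \<noteq> 0 \<Longrightarrow> wt2 v w = wt2 v0 w0"
    using weight_component[OF N y(1,2)] by blast
  have zq: "z \<in> quad (brackets t m n)" by (rule quad_submodule_quad[OF N z(1)])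
  have potz: "pot v w = k" if "pol z v w \<noteq> 0" for v w
    using pot_wt2[OF pol_outside[OF zq that] pol_outside[OF zq z(2)] pure[OF that]] y(3) by simp
  have fixed: "S_act n (group_elt n a b) z = z" if ab: "unitriangular m a" "unitriangular n b" for a b
  proof (rule ccontr)
    assume "S_act n (group_elt n a b) z \<noteq> z"
    then have ne: "S_act n (group_elt n a b) z - z \<noteq> 0" by simp
    have mem: "S_act n (group_elt n a b) z - z \<in> N"
      by (intro pm.subspace_diff quad_submodule_subspace[OF N] quad_submodule_act[OF N] z(1) group_elt_GG unitriangular_GL ab)
    obtain v w where vw: "pol (S_act n (group_elt n a b) z - z) v w \<noteq> 0"
      using pol_nonzero[OF quad_submodule_quad[OF N mem] ne] by blast
    obtain v' w' where "pol z v' w' \<noteq> 0" "pot v w < pot v' w'"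
      using unitriangular_lowers_pot[OF ab zq vw] by blast
    then show False using least[OF mem vw] potz[of v' w'] by simp
  qed
  obtain q c where q: "admissible t m n q" "c \<noteq> 0" "z = pm_scale c (fv t q)"
    using highest_weight_vector[OF zq fixed_imp_raised[OF zq fixed] z(2) pure] by blast
  have f: "fv t q = pm_scale (inverse c) z" using q(2,3) by simp
  have "fv t q \<in> N" unfolding f by (rule pm.subspace_scale[OF quad_submodule_subspace[OF N] z(1)])
  moreover have "S_act n (group_elt n a b) (fv t q) = (fv t q :: 'k minor_poly)" if "unitriangular m a" "unitriangular n b" for a b
    unfolding f plin_scale[OF plin_S_act] fixed[OF that] ..
  ultimately show ?thesis using q(1) by blast
qed

text \<open>The two coefficients in a raising equation belong to the same weight and are scaled by
  the same factor.\<close>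

lemma raised_weight_component:
  assumes "raised t m n y" "\<And>v w. y' v w = \<phi> (wt2 v w) * y v w"
  shows "raised t m n y'"
  unfolding raised_def
proof (intro allI ballI conjI impI)
  fix i v w assume vw: "v \<in> brackets t m n" "w \<in> brackets t m n"
  note r = assms(1)[unfolded raised_def, rule_format, OF vw, of i]
  have w: "wt (up i I) J = wt I (up i J)" if "i \<in> I" "Suc i \<notin> I" "i \<in> J" "Suc i \<notin> J" for I J
  proof
    fix k show "wt (up i I) J k = wt I (up i J) k"
      using that by (cases "k = i"; cases "k = Suc i") (simp_all add: wt_def up_def)
  qed
  {
    assume "Suc i < m"
    note r' = conjunct1[OF r, rule_format, OF this]
    show "(if i \<in> fst v \<and> Suc i \<notin> fst v then y' (up i (fst v), snd v) w else 0) +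
       (if i \<in> fst w \<and> Suc i \<notin> fst w then y' v (up i (fst w), snd w) else 0) = 0"
    proof (cases "(i \<in> fst v \<and> Suc i \<notin> fst v) \<and> (i \<in> fst w \<and> Suc i \<notin> fst w)")
      case True
      then have "wt2 (up i (fst v), snd v) w = wt2 v (up i (fst w), snd w)" using w by (simp add: wt2_def)
      then have "y' (up i (fst v), snd v) w + y' v (up i (fst w), snd w)
        = \<phi> (wt2 v (up i (fst w), snd w)) * (y (up i (fst v), snd v) w + y v (up i (fst w), snd w))"
        by (simp add: assms(2) distrib_left)
      also have "\<dots> = 0" using r' True by simp
      finally show ?thesis using True by simp
    next
      case False
      then show ?thesis using r' by (auto simp: assms(2))
    qed
  next
    assume "Suc i < n"
    note r' = conjunct2[OF r, rule_format, OF this]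
    show "(if i \<in> snd v \<and> Suc i \<notin> snd v then y' (fst v, up i (snd v)) w else 0) +
       (if i \<in> snd w \<and> Suc i \<notin> snd w then y' v (fst w, up i (snd w)) else 0) = 0"
    proof (cases "(i \<in> snd v \<and> Suc i \<notin> snd v) \<and> (i \<in> snd w \<and> Suc i \<notin> snd w)")
      case True
      then have "wt2 (fst v, up i (snd v)) w = wt2 v (fst w, up i (snd w))" using w by (simp add: wt2_def)
      then have "y' (fst v, up i (snd v)) w + y' v (fst w, up i (snd w))
        = \<phi> (wt2 v (fst w, up i (snd w))) * (y (fst v, up i (snd v)) w + y v (fst w, up i (snd w)))"
        by (simp add: assms(2) distrib_left)
      also have "\<dots> = 0" using r' True by simp
      finally show ?thesis using True by simp
    next
      case False
      then show ?thesis using r' by (auto simp: assms(2))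
    qed
  }
qed

text \<open>Every weight component of a raised vector in N is again raised and lies in N, hence is a
  multiple of the only available \<open>f_vec\<close>. So there is only one weight, and the vector
  itself is such a multiple.\<close>

lemma raised_unique:
  fixes N :: "'k::field_char_0 minor_poly set"
  assumes N: "quad_submodule t m n N" and only: "\<And>q. admissible t m n q \<Longrightarrow> fv t q \<in> N \<Longrightarrow> q = q0"
    and x: "x \<in> N" "x \<noteq> 0" and r: "raised t m n (pol x)"
  shows "\<exists>c. c \<noteq> 0 \<and> x = pm_scale c (fv t q0)"
proof -
  have xq: "x \<in> quad (brackets t m n)" by (rule quad_submodule_quad[OF N x(1)])
  have mem: "fv t q \<in> N" if "pm_scale c (fv t q) \<in> N" "c \<noteq> 0" for c q
  proof -
    have "pm_scale (inverse c) (pm_scale c (fv t q)) \<in> N"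
      by (rule pm.subspace_scale[OF quad_submodule_subspace[OF N] that(1)])
    then show ?thesis using that(2) by simp
  qed
  have supp: "pol (fv t q0 :: 'k minor_poly) v w \<noteq> 0" "\<And>v' w'. pol (fv t q0 :: 'k minor_poly) v' w' \<noteq> 0 \<Longrightarrow> wt2 v' w' = wt2 v w"
    if nz: "pol x v w \<noteq> 0" for v w
  proof -
    obtain z \<phi> where z: "z \<in> N" "pol z v w \<noteq> 0" and \<phi>: "\<And>v w. pol z v w = \<phi> (wt2 v w) * pol x v w"
      and pure: "\<And>v' w'. pol z v' w' \<noteq> 0 \<Longrightarrow> wt2 v' w' = wt2 v w"
      using weight_component[OF N x(1) nz] by blast
    have zq: "z \<in> quad (brackets t m n)" by (rule quad_submodule_quad[OF N z(1)])
    obtain q c where q: "admissible t m n q" "c \<noteq> 0" "z = pm_scale c (fv t q)"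
      using highest_weight_vector[OF zq raised_weight_component[OF r \<phi>] z(2) pure] by blast
    have "q = q0" using only[OF q(1)] mem[of c q] q z(1) by simp
    then have pz: "pol z v' w' = c * pol (fv t q0) v' w'" for v' w' using q(3) by (simp add: pol_scale)
    show "pol (fv t q0 :: 'k minor_poly) v w \<noteq> 0" using z(2) pz by simp
    show "wt2 v' w' = wt2 v w" if "pol (fv t q0 :: 'k minor_poly) v' w' \<noteq> 0" for v' w'
      using pure[of v' w'] pz q(2) that by simp
  qed
  obtain v0 w0 where nz: "pol x v0 w0 \<noteq> 0" using pol_nonzero[OF xq x(2)] by blast
  have "wt2 v w = wt2 v0 w0" if "pol x v w \<noteq> 0" for v w
    using supp(2)[OF nz supp(1)[OF that]] .
  then obtain q c where q: "admissible t m n q" "c \<noteq> 0" "x = pm_scale c (fv t q)"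
    using highest_weight_vector[OF xq r nz] by blast
  then have "q = q0" using only[OF q(1)] mem[of c q] x(1) by simp
  then show ?thesis using q by blast
qed


section \<open>Orthogonal complements, and the comparison of submodules through their highest weight
  vectors\<close>

section \<open>Complete reducibility\<close>

lemma form_add_left: "form B (x + y) z = form B x z + form B y z"
  and form_scale_left: "form B (pm_scale c x) z = c * form B x z"
  and form_diff_left: "form B (x - y) z = form B x z - form B y z"
  by (simp_all add: form_def pol_add pol_scale pol_diff sum.distrib sum_subtractf sum_distrib_left algebra_simps)

lemma form_sym: "form B x y = form B y x"
  by (simp add: form_def mult.commute)

lemma form_0_left [simp]: "form B 0 x = 0"
  by (simp add: form_def)

lemma subspace_form: "pm.subspace {y. form B x y = 0}"
  by (rule pm.subspaceI) (simp_all add: form_sym[of B x] form_add_left form_scale_left)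

lemma inj_bvec: "inj (bvec :: 'a \<Rightarrow> 'a \<Rightarrow>\<^sub>0 'k::field)"
proof (rule injI)
  fix x y :: 'a assume "bvec x = (bvec y :: 'a \<Rightarrow>\<^sub>0 'k)"
  then have "keys (bvec x :: 'a \<Rightarrow>\<^sub>0 'k) = keys (bvec y :: 'a \<Rightarrow>\<^sub>0 'k)" by simp
  then show "x = y" by (simp add: bvec_def)
qed

text \<open>If the form is nondegenerate on \<open>N\<close>, then pairing with a basis of \<open>N\<close> is an injective map of
  \<open>N\<close> into a space of the same dimension, hence onto.\<close>

lemma orthogonal_projection:
  fixes N :: "('v, 'k::field) mpoly set"
  assumes N: "pm.subspace N" and T: "finite T" "N \<subseteq> pm.span T"
    and nondeg: "\<And>y. y \<in> N \<Longrightarrow> (\<And>z. z \<in> N \<Longrightarrow> form B y z = 0) \<Longrightarrow> y = 0"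
  shows "\<exists>a\<in>N. \<forall>z\<in>N. form B (x - a) z = 0"
proof -
  obtain Bs where Bs: "Bs \<subseteq> N" "pm.independent Bs" "N \<subseteq> pm.span Bs"
    using pm.maximal_independent_subset[of N] by blast
  have fin: "finite Bs" using pm.independent_span_bound[OF T(1) Bs(2)] Bs(1) T(2) by blast
  have span: "pm.span Bs = N" using Bs pm.span_minimal[OF Bs(1) N] by blast
  define L where "L y = (\<Sum>b\<in>Bs. pm_scale (form B y b) (bvec b))" for y
  have L: "plin L" unfolding L_def
    by (rule plinI) (simp_all add: form_add_left form_scale_left pm.scale_left_distrib sum.distrib pm.scale_sum_right)
  have lookup_L: "lookup (L y) b = form B y b" if "b \<in> Bs" for y b
    using that fin by (simp add: L_def lookup_sum bvec_def lookup_single when_def if_distrib cong: if_cong)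
  have eq: "form B y z = 0" if "L y = 0" "z \<in> N" for y z
  proof -
    have "form B y b = 0" if "b \<in> Bs" for b using lookup_L[OF that, of y] \<open>L y = 0\<close> by simp
    then have "pm.span Bs \<subseteq> {z. form B y z = 0}" by (intro pm.span_minimal subspace_form) auto
    then show ?thesis using \<open>z \<in> N\<close> span by blast
  qed
  have inj: "inj_on L N"
  proof (rule inj_onI)
    fix y z assume yz: "y \<in> N" "z \<in> N" "L y = L z"
    then have "L (y - z) = 0" by (simp add: plin_diff[OF L])
    then have "y - z = 0" using eq pm.subspace_diff[OF N yz(1,2)] nondeg by blast
    then show "y = z" by simp
  qed
  interpret vp: vector_space_pair "pm_scale :: 'k \<Rightarrow> ('v, 'k) mpoly \<Rightarrow> _" "pm_scale :: 'k \<Rightarrow> (('v, 'k) mpoly \<Rightarrow>\<^sub>0 'k) \<Rightarrow> _"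
    by unfold_locales
  have lin: "Vector_Spaces.linear pm_scale pm_scale L"
    by unfold_locales (simp_all add: plin_add[OF L] plin_scale[OF L])
  have ind: "pm.independent (L ` Bs)"
    by (rule vp.linear_independent_injective_image[OF lin Bs(2)]) (simp add: span inj)
  have card: "card (L ` Bs) = card Bs" "card (bvec ` Bs :: (('v, 'k) mpoly \<Rightarrow>\<^sub>0 'k) set) = card Bs"
    by (rule card_image[OF inj_on_subset[OF inj Bs(1)]]) (rule card_image[OF inj_on_subset[OF inj_bvec subset_UNIV]])
  have sub: "L y \<in> pm.span (bvec ` Bs)" for y
    unfolding L_def by (intro pm.span_sum pm.span_scale pm.span_base) auto
  have "L x \<in> pm.span (L ` Bs)"
  proof (rule ccontr)
    assume n: "L x \<notin> pm.span (L ` Bs)"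
    then have "pm.independent (insert (L x) (L ` Bs))" using ind by (rule pm.independent_insertI)
    moreover have "insert (L x) (L ` Bs) \<subseteq> pm.span (bvec ` Bs)" using sub by blast
    ultimately have "card (insert (L x) (L ` Bs)) \<le> card (bvec ` Bs :: (('v, 'k) mpoly \<Rightarrow>\<^sub>0 'k) set)"
      using pm.independent_span_bound[OF finite_imageI[OF fin]] by blast
    moreover have "L x \<notin> L ` Bs" using n pm.span_base by blast
    ultimately show False using fin card by simp
  qed
  also have "pm.span (L ` Bs) = L ` N"
    using vp.linear_span_image[OF lin, of Bs] span by simp
  finally obtain a where a: "a \<in> N" "L x = L a" by blast
  then have "L (x - a) = 0" by (simp add: plin_diff[OF L])
  then show ?thesis using eq a(1) by blast
qed

text \<open>The polarised coefficients are 0, 2 or -2, so the value is four times the size of the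
  support.\<close>

lemma form_fv_neq_0:
  assumes "admissible t m n q"
  shows "form (brackets t m n) (fv t q) (fv t q) \<noteq> (0 :: 'k::field_char_0)"
proof -
  obtain u v where q: "q = (u, v)" by (cases q)
  have a: "u \<le> t" "v \<le> t" "t + u \<le> m" "t + v \<le> n" "even (u + v)" using assms by (auto simp: admissible_def q)
  let ?B = "brackets t m n"
  let ?h = "hvec2 t u v :: _ \<Rightarrow> _ \<Rightarrow> 'k"
  have sq: "?h x y * ?h x y = of_nat (of_bool (?h x y \<noteq> 0))" for x y
    by (auto simp: hvec2_def hvec_def minus_one_power_iff)
  have "form ?B (fv t q) (fv t q) = (\<Sum>x\<in>?B. \<Sum>y\<in>?B. 4 * (?h x y * ?h x y))"
    unfolding form_def q fst_conv snd_conv pol_f_vec_even[OF a(1,2,5)]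
    by (intro sum.cong refl) (simp only: mult_ac, simp)
  also have "\<dots> = of_nat (4 * (\<Sum>x\<in>?B. \<Sum>y\<in>?B. of_bool (?h x y \<noteq> 0)))"
    unfolding sq by (simp add: sum_distrib_left mult.commute)
  finally have f: "form ?B (fv t q) (fv t q) = (of_nat (4 * (\<Sum>x\<in>?B. \<Sum>y\<in>?B. of_bool (?h x y \<noteq> 0))) :: 'k)" .
  obtain x y where xy: "x \<in> ?B" "y \<in> ?B" "?h x y \<noteq> 0" using hvec2_neq_0[OF a(1-4)] by blast
  have p: "0 < (\<Sum>y\<in>?B. of_bool (?h x y \<noteq> 0) :: nat)"
    by (rule sum_pos2[OF _ xy(2)]) (use xy(3) in auto)
  have "0 < (\<Sum>x\<in>?B. \<Sum>y\<in>?B. of_bool (?h x y \<noteq> 0) :: nat)"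
    by (rule sum_pos2[OF _ xy(1)]) (rule finite_brackets p le0)+
  then show ?thesis unfolding f of_nat_eq_0_iff by linarith
qed

text \<open>The transpose of g preserves D, so moving g across the form keeps orthogonality to
  D.\<close>

lemma quad_submodule_orthogonal:
  fixes X D :: "'k::field minor_poly set"
  assumes X: "quad_submodule t m n X" and D: "quad_submodule t m n D"
  shows "quad_submodule t m n {x \<in> X. \<forall>d\<in>D. form (brackets t m n) x d = 0}"
  unfolding quad_submodule_def
proof (intro conjI ballI)
  show "pm.subspace {x \<in> X. \<forall>d\<in>D. form (brackets t m n) x d = 0}"
    using quad_submodule_subspace[OF X]
    by (intro pm.subspaceI) (auto simp: form_add_left form_scale_left pm.subspace_0 pm.subspace_add pm.subspace_scale)
  show "{x \<in> X. \<forall>d\<in>D. form (brackets t m n) x d = 0} \<subseteq> quad (brackets t m n)" using quad_submodule_quad[OF X] by blast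
  fix g :: "'k mat \<times> 'k mat" and x
  assume g: "g \<in> carrier (GG m n)" and x: "x \<in> {x \<in> X. \<forall>d\<in>D. form (brackets t m n) x d = 0}"
  have "form (brackets t m n) (S_act n g x) d = 0" if "d \<in> D" for d
    using form_S_act[OF g quad_submodule_quad[OF X] quad_submodule_quad[OF D that]] quad_submodule_act[OF D gtrans_GG[OF g] that] x by simp
  then show "S_act n g x \<in> {x \<in> X. \<forall>d\<in>D. form (brackets t m n) x d = 0}"
    using x quad_submodule_act[OF X g] by simp
qed

lemma quad_submodule_Int: "quad_submodule t m n X \<Longrightarrow> quad_submodule t m n Y \<Longrightarrow> quad_submodule t m n (X \<inter> Y)"
  by (auto simp: quad_submodule_def pm.subspace_inter)

text \<open>The radical of the form on D is a submodule. If it were nonzero it would contain an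
  \<open>f_vec\<close> orthogonal to itself.\<close>

lemma quad_submodule_projection:
  fixes D :: "'k::field_char_0 minor_poly set"
  assumes D: "quad_submodule t m n D"
  shows "\<exists>a\<in>D. \<forall>d\<in>D. form (brackets t m n) (x - a) d = 0"
proof (rule orthogonal_projection[OF quad_submodule_subspace[OF D]])
  let ?T = "(\<lambda>(v, w). Var v * Var w :: 'k minor_poly) ` (brackets t m n \<times> brackets t m n)"
  show "finite ?T" by simp
  have "?T = {Var v * Var w |v w. v \<in> brackets t m n \<and> w \<in> brackets t m n}" by auto
  then show "D \<subseteq> pm.span ?T" using quad_submodule_quad[OF D] by (auto simp: quad_span)
  fix y assume y: "y \<in> D" "\<And>z. z \<in> D \<Longrightarrow> form (brackets t m n) y z = 0"
  let ?R = "{x \<in> D. \<forall>d\<in>D. form (brackets t m n) x d = 0}"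
  have "?R = {0}"
  proof (rule ccontr)
    assume "?R \<noteq> {0}"
    then obtain q where "admissible t m n q" "fv t q \<in> ?R"
      using exists_f_vec[OF quad_submodule_orthogonal[OF D D]] by blast
    then show False using form_fv_neq_0[of t m n q, where ?'k = 'k] by blast
  qed
  then show "y = 0" using y by blast
qed

text \<open>The part of X orthogonal to the intersection is a submodule. An \<open>f_vec\<close> in
  it would lie in Y as well, hence in the intersection, and would be orthogonal to itself. So X is
  the intersection.\<close>

theorem quad_submodule_subset:
  fixes X Y :: "'k::field_char_0 minor_poly set"
  assumes X: "quad_submodule t m n X" and Y: "quad_submodule t m n Y"
    and fv: "\<And>q. admissible t m n q \<Longrightarrow> fv t q \<in> X \<Longrightarrow> fv t q \<in> Y"
  shows "X \<subseteq> Y"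
proof
  fix x assume x: "x \<in> X"
  let ?D = "X \<inter> Y" and ?Z = "{x \<in> X. \<forall>d\<in>X \<inter> Y. form (brackets t m n) x d = 0}"
  have D: "quad_submodule t m n ?D" by (rule quad_submodule_Int[OF X Y])
  have "?Z = {0}"
  proof (rule ccontr)
    assume "?Z \<noteq> {0}"
    then obtain q where "admissible t m n q" "fv t q \<in> ?Z"
      using exists_f_vec[OF quad_submodule_orthogonal[OF X D]] by blast
    then show False using form_fv_neq_0[of t m n q, where ?'k = 'k] fv[of q] by blast
  qed
  obtain a where a: "a \<in> ?D" "\<forall>d\<in>?D. form (brackets t m n) (x - a) d = 0" using quad_submodule_projection[OF D] by blast
  then have "x - a \<in> ?Z" using x pm.subspace_diff[OF quad_submodule_subspace[OF X]] by blast
  then have "x = a" using \<open>?Z = {0}\<close> by auto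
  then show "x \<in> Y" using a(1) by blast
qed

lemma quad_submodule_quad_all: "quad_submodule t m n (quad (brackets t m n))"
  by (auto simp: quad_submodule_def subspace_quad S_act_quad)

lemma quad_submodule_kernel:
  assumes X: "quad_submodule t m n X" and F: "plin F"
    and eq: "\<And>g x. g \<in> carrier (GG m n) \<Longrightarrow> x \<in> X \<Longrightarrow> F x = 0 \<Longrightarrow> F (S_act n g x) = 0"
  shows "quad_submodule t m n {x \<in> X. F x = 0}"
  unfolding quad_submodule_def
proof (intro conjI ballI)
  show "pm.subspace {x \<in> X. F x = 0}"
    using quad_submodule_subspace[OF X]
    by (intro pm.subspaceI)
      (auto simp: plin_0[OF F] plin_add[OF F] plin_scale[OF F] pm.subspace_0 pm.subspace_add pm.subspace_scale)
qed (use quad_submodule_quad[OF X] quad_submodule_act[OF X] eq in auto)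

lemma quad_submodule_J_deg2: "quad_submodule t m n (J_deg2 t m n :: 'k::field minor_poly set)"
  unfolding J_deg2_eq
  by (rule quad_submodule_kernel[OF quad_submodule_quad_all plin_pi_map]) (simp add: pi_map_S_act plin_0[OF plin_act_X])

lemma quad_submodule_ker_schur_proj:
  assumes "quad_submodule t m n X"
  shows "quad_submodule t m n {x \<in> X. schur_proj t m n u v x = (0 :: _ \<Rightarrow>\<^sub>0 'k::field)}"
  by (rule quad_submodule_kernel[OF assms plin_schur_proj])
    (simp add: schur_proj_S_act[OF _ quad_submodule_quad[OF assms]] plin_0[OF plin_schur_tensor_act])

lemma schur_proj_fv:
  assumes "admissible t m n q" "fst p \<le> t" "snd p \<le> t"
  shows "schur_proj t m n (fst p) (snd p) (fv t q :: 'k::field_char_0 minor_poly) = 0 \<longleftrightarrow> p \<noteq> q"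
  using assms schur_proj_f_vec[of "fst q" t "snd q" m n "fst p" "snd p", where ?'k = 'k]
  by (auto simp: admissible_def prod_eq_iff)

lemma fv_J_deg2:
  assumes "admissible t m n q"
  shows "(fv t q :: 'k::field_char_0 minor_poly) \<in> J_deg2 t m n \<longleftrightarrow> fst q \<noteq> snd q"
  using assms f_vec_J_deg2[of "fst q" t "snd q" m n, where ?'k = 'k] by (auto simp: admissible_def)

text \<open>A preimage is corrected to lie in the orthogonal complement of the kernel of the
  projection. That complement can contain no \<open>f_vec\<close> other than the one of type p, so
  by \<open>quad_submodule_subset\<close> it lies in the relations and in the kernels of all other
  projections.\<close>

theorem schur_proj_component:
  fixes l :: "_ \<Rightarrow>\<^sub>0 'k::field_char_0"
  assumes p: "admissible t m n p" "fst p \<noteq> snd p"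
    and l: "l \<in> schur_tensor m n (tau t (fst p)) (tau t (snd p))"
  shows "\<exists>b\<in>J_deg2 t m n. schur_proj t m n (fst p) (snd p) b = l \<and>
    (\<forall>q. fst q \<le> t \<and> snd q \<le> t \<and> q \<noteq> p \<longrightarrow> schur_proj t m n (fst q) (snd q) b = 0)"
proof -
  let ?B = "brackets t m n"
  let ?K = "{x \<in> quad ?B. schur_proj t m n (fst p) (snd p) x = (0 :: _ \<Rightarrow>\<^sub>0 'k)}"
  have K: "quad_submodule t m n ?K" by (rule quad_submodule_ker_schur_proj[OF quad_submodule_quad_all])
  let ?C = "{x \<in> quad ?B. \<forall>d\<in>?K. form ?B x d = 0}"
  have C: "quad_submodule t m n ?C" by (rule quad_submodule_orthogonal[OF quad_submodule_quad_all K])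
  have pt: "fst p \<le> t" "snd p \<le> t" "even (fst p + snd p)" using p(1) by (auto simp: admissible_def)
  obtain y where y: "y \<in> quad ?B" "schur_proj t m n (fst p) (snd p) y = l"
    using l unfolding schur_proj_image[OF pt, symmetric] by blast
  obtain a where a: "a \<in> ?K" "\<forall>d\<in>?K. form ?B (y - a) d = 0" using quad_submodule_projection[OF K] by blast
  have b: "y - a \<in> ?C" using a y pm.subspace_diff[OF subspace_quad] by blast
  have only: "q = p" if q: "admissible t m n q" "fv t q \<in> ?C" for q
  proof (rule ccontr)
    assume "q \<noteq> p"
    then have "fv t q \<in> ?K" using schur_proj_fv[OF q(1) pt(1,2), where ?'k = 'k] fv_quad[OF q(1)] by auto
    then show False using q(2) form_fv_neq_0[OF q(1), where ?'k = 'k] by blast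
  qed
  have "?C \<subseteq> J_deg2 t m n"
    by (rule quad_submodule_subset[OF C quad_submodule_J_deg2]) (use only fv_J_deg2[OF p(1), where ?'k = 'k] p(2) in blast)
  then have "y - a \<in> J_deg2 t m n" using b by blast
  moreover have "schur_proj t m n (fst p) (snd p) (y - a) = l" using a y by (simp add: plin_diff[OF plin_schur_proj])
  moreover have "schur_proj t m n (fst q) (snd q) (y - a) = 0" if q: "fst q \<le> t" "snd q \<le> t" "q \<noteq> p" for q
  proof -
    have "?C \<subseteq> {x \<in> quad ?B. schur_proj t m n (fst q) (snd q) x = (0 :: _ \<Rightarrow>\<^sub>0 'k)}"
      by (rule quad_submodule_subset[OF C quad_submodule_ker_schur_proj[OF quad_submodule_quad_all]])
        (use only schur_proj_fv[OF p(1) q(1,2), where ?'k = 'k] fv_quad[OF p(1)] q(3) in blast)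
    then show ?thesis using b by blast
  qed
  ultimately show ?thesis by blast
qed

section \<open>The decomposition of the quadratic relations\<close>

section \<open>The decomposition\<close>

text \<open>The module axioms for the target are transported along the equivariant bijection, so the
  actions on Schur modules and direct sums need no separate verification.\<close>

lemma gmodule_iso_image:
  assumes M: "gmodule G \<rho> M" and \<phi>: "plin \<phi>" and inj: "inj_on \<phi> M" and im: "\<phi> ` M = D"
    and eq: "\<And>g x. g \<in> carrier G \<Longrightarrow> x \<in> M \<Longrightarrow> \<phi> (\<rho> g x) = \<sigma> g (\<phi> x)" and G: "monoid G"
  shows "gmodule_iso G \<rho> M \<sigma> D"
proof -
  note M' = M[unfolded gmodule_def]
  have sub: "pm.subspace M" using M' by blast
  have D: "\<exists>x\<in>M. y = \<phi> x" if "y \<in> D" for y using that im by blast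
  have mem: "\<phi> x \<in> D" if "x \<in> M" for x using that im by blast
  have "gmodule G \<sigma> D"
    unfolding gmodule_def
  proof (intro conjI ballI allI)
    show "pm.subspace D" unfolding im[symmetric] by (rule subspace_plin_image[OF \<phi> sub])
  next
    fix g y assume g: "g \<in> carrier G" and y: "y \<in> D"
    then obtain x where x: "x \<in> M" "y = \<phi> x" using D by blast
    have "\<rho> g x \<in> M" using M' g x(1) by blast
    then show "\<sigma> g y \<in> D" using mem eq[OF g x(1)] x(2) by metis
  next
    fix g y z assume g: "g \<in> carrier G" and yz: "y \<in> D" "z \<in> D"
    obtain x x' where x: "x \<in> M" "y = \<phi> x" "x' \<in> M" "z = \<phi> x'" using D yz by blast
    have "\<sigma> g (y + z) = \<phi> (\<rho> g (x + x'))"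
      unfolding x plin_add[OF \<phi>, symmetric] by (rule eq[OF g pm.subspace_add[OF sub x(1,3)], symmetric])
    also have "\<rho> g (x + x') = \<rho> g x + \<rho> g x'" using M' g x by blast
    finally show "\<sigma> g (y + z) = \<sigma> g y + \<sigma> g z" unfolding plin_add[OF \<phi>] eq[OF g x(1)] eq[OF g x(3)] x(2,4) .
  next
    fix g c y assume g: "g \<in> carrier G" and y: "y \<in> D"
    then obtain x where x: "x \<in> M" "y = \<phi> x" using D by blast
    have "\<sigma> g (pm_scale c y) = \<phi> (\<rho> g (pm_scale c x))"
      unfolding x plin_scale[OF \<phi>, symmetric] by (rule eq[OF g pm.subspace_scale[OF sub x(1)], symmetric])
    also have "\<rho> g (pm_scale c x) = pm_scale c (\<rho> g x)" using M' g x by blast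
    finally show "\<sigma> g (pm_scale c y) = pm_scale c (\<sigma> g y)" unfolding plin_scale[OF \<phi>] eq[OF g x(1)] x(2) .
  next
    fix y assume y: "y \<in> D"
    then obtain x where x: "x \<in> M" "y = \<phi> x" using D by blast
    have "\<rho> \<one>\<^bsub>G\<^esub> x = x" using M' x by blast
    then show "\<sigma> \<one>\<^bsub>G\<^esub> y = y" using eq[OF monoid.one_closed[OF G] x(1)] x(2) by simp
  next
    fix g h y assume g: "g \<in> carrier G" and h: "h \<in> carrier G" and y: "y \<in> D"
    then obtain x where x: "x \<in> M" "y = \<phi> x" using D by blast
    have hx: "\<rho> h x \<in> M" using M' h x by blast
    have "\<sigma> (g \<otimes>\<^bsub>G\<^esub> h) y = \<phi> (\<rho> (g \<otimes>\<^bsub>G\<^esub> h) x)"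
      unfolding x by (rule eq[OF monoid.m_closed[OF G g h] x(1), symmetric])
    also have "\<rho> (g \<otimes>\<^bsub>G\<^esub> h) x = \<rho> g (\<rho> h x)" using M' g h x by blast
    finally show "\<sigma> (g \<otimes>\<^bsub>G\<^esub> h) y = \<sigma> g (\<sigma> h y)" unfolding eq[OF g hx] eq[OF h x(1)] x(2) .
  qed
  then show ?thesis
    unfolding gmodule_iso_def using M inj im eq
    by (intro conjI exI[of _ \<phi>]) (auto simp: bij_betw_def plin_add[OF \<phi>] plin_scale[OF \<phi>])
qed

lemma monoid_GG: "monoid (GG m n)"
  using group_GG by (rule group.is_monoid)

lemma quad_submodule_gmodule: "quad_submodule t m n N \<Longrightarrow> gmodule (GG m n) (S_act n) N"
  by (rule gsubmodule_quadI[where t = t]) (auto simp: quad_submodule_def)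

lemma gsubmodule_quad_submodule:
  assumes "gsubmodule (GG m n) (S_act n) N M" "quad_submodule t m n M"
  shows "quad_submodule t m n N"
proof -
  have N: "N \<subseteq> M" "gmodule (GG m n) (S_act n) N"
    using assms(1) unfolding gsubmodule_def by (rule conjunct1, rule conjunct2)
  note N' = N(2)[unfolded gmodule_def]
  show ?thesis
    unfolding quad_submodule_def
  proof (intro conjI ballI)
    show "pm.subspace N" using N' by (rule conjunct1)
    show "N \<subseteq> quad (brackets t m n)" using N(1) quad_submodule_quad[OF assms(2)] by blast
    show "S_act n g x \<in> N" if "g \<in> carrier (GG m n)" "x \<in> N" for g x
      using conjunct1[OF conjunct2[OF N']] that by blast
  qed
qed

lemma lookup_map_key_Pair: "lookup (Poly_Mapping.map_key (Pair i) p) x = lookup p (i, x)"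
  by (subst map_key.rep_eq) (auto simp: inj_on_def)

definition even_pairs :: "nat \<Rightarrow> (nat \<times> nat) set" where
  "even_pairs t = {(u, v). u \<le> t \<and> v \<le> t \<and> even (u + v) \<and> u \<noteq> v}"

lemma finite_even_pairs [simp]: "finite (even_pairs t)"
  by (rule finite_subset[of _ "{..t} \<times> {..t}"]) (auto simp: even_pairs_def)

lemma even_pairs_D: "p \<in> even_pairs t \<Longrightarrow> fst p \<le> t \<and> snd p \<le> t \<and> even (fst p + snd p) \<and> fst p \<noteq> snd p"
  by (auto simp: even_pairs_def)

lemma even_pairs_I: "fst p \<le> t \<Longrightarrow> snd p \<le> t \<Longrightarrow> even (fst p + snd p) \<Longrightarrow> fst p \<noteq> snd p \<Longrightarrow> p \<in> even_pairs t"
  by (auto simp: even_pairs_def)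

abbreviation schur_proj_at where "schur_proj_at t m n p \<equiv> schur_proj t m n (fst p) (snd p)"
abbreviation schur_tensor_at where "schur_tensor_at t m n p \<equiv> schur_tensor m n (tau t (fst p)) (tau t (snd p))"

lemma schur_proj_at_mem:
  assumes "p \<in> even_pairs t" "x \<in> quad (brackets t m n)"
  shows "schur_proj_at t m n p x \<in> (schur_tensor_at t m n p :: (_ \<Rightarrow>\<^sub>0 'k::field_char_0) set)"
  using schur_proj_image[of "fst p" t "snd p" m n, where ?'k = 'k] even_pairs_D[OF assms(1)] assms(2) by blast

lemma admissible_even_pairs: "p \<in> even_pairs t \<Longrightarrow> \<not> (t + fst p > m \<or> t + snd p > n) \<Longrightarrow> admissible t m n p"
  by (auto simp: even_pairs_def admissible_def)

definition total :: "nat \<Rightarrow> nat \<Rightarrow> nat \<Rightarrow> 'k::field minor_poly \<Rightarrow>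
    ((nat \<times> nat) \<times> (((nat \<times> nat) \<Rightarrow>\<^sub>0 nat) \<times> ((nat \<times> nat) \<Rightarrow>\<^sub>0 nat)) \<Rightarrow>\<^sub>0 'k)" where
  "total t m n x = (\<Sum>p\<in>even_pairs t. tensor (bvec p) (schur_proj_at t m n p x))"

lemma plin_total: "plin (total t m n)"
  unfolding total_def by (intro plin_sum_fun plin_comp[OF plin_tensor_right plin_schur_proj])

lemma slice_sum_tensor:
  assumes "finite P"
  shows "Poly_Mapping.map_key (Pair i) (\<Sum>p\<in>P. tensor (bvec p) (f p)) = (if i \<in> P then f i else (0 :: _ \<Rightarrow>\<^sub>0 'k::field))"
proof (rule poly_mapping_eqI)
  fix x
  have "lookup (\<Sum>p\<in>P. tensor (bvec p) (f p)) (i, x) = (\<Sum>p\<in>P. if p = i then lookup (f i) x else 0)"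
    unfolding lookup_sum lookup_tensor by (intro sum.cong refl) (simp add: bvec_def lookup_single when_def)
  then show "lookup (Poly_Mapping.map_key (Pair i) (\<Sum>p\<in>P. tensor (bvec p) (f p))) x = lookup (if i \<in> P then f i else 0) x"
    using assms by (simp add: lookup_map_key_Pair)
qed

lemma total_eq_0_iff: "total t m n x = 0 \<longleftrightarrow> (\<forall>p\<in>even_pairs t. schur_proj_at t m n p x = (0 :: _ \<Rightarrow>\<^sub>0 'k::field))"
proof
  assume 0: "total t m n x = 0"
  show "\<forall>p\<in>even_pairs t. schur_proj_at t m n p x = 0"
  proof
    fix p assume p: "p \<in> even_pairs t"
    have "Poly_Mapping.map_key (Pair p) (total t m n x) = schur_proj_at t m n p x"
      unfolding total_def slice_sum_tensor[OF finite_even_pairs] using p by simp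
    moreover have "Poly_Mapping.map_key (Pair p) (total t m n x) = 0"
      unfolding 0 by (rule poly_mapping_eqI) (simp add: lookup_map_key_Pair)
    ultimately show "schur_proj_at t m n p x = 0" by simp
  qed
qed (simp add: total_def)

lemma direct_sum_expand:
  assumes "d \<in> direct_sum P M" "finite P"
  shows "d = (\<Sum>p\<in>P. tensor (bvec p) (Poly_Mapping.map_key (Pair p) d))"
proof (rule poly_mapping_eqI)
  fix z :: "'a \<times> 'b"
  obtain i x where z: "z = (i, x)" by (cases z)
  have "lookup (\<Sum>p\<in>P. tensor (bvec p) (Poly_Mapping.map_key (Pair p) d)) (i, x)
    = (\<Sum>p\<in>P. if p = i then lookup d (i, x) else 0)"
    unfolding lookup_sum lookup_tensor
    by (intro sum.cong refl) (simp add: bvec_def lookup_single when_def lookup_map_key_Pair)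
  also have "\<dots> = lookup d (i, x)"
  proof (cases "i \<in> P")
    case False
    then have "Poly_Mapping.map_key (Pair i) d = 0" using assms(1) by (auto simp: direct_sum_def)
    then have "lookup d (i, x) = 0" by (metis lookup_map_key_Pair lookup_zero)
    moreover have "(\<Sum>p\<in>P. if p = i then lookup d (i, x) else 0) = 0"
      using False by (intro sum.neutral) auto
    ultimately show ?thesis by simp
  qed (use assms(2) in simp)
  finally show "lookup d z = lookup (\<Sum>p\<in>P. tensor (bvec p) (Poly_Mapping.map_key (Pair p) d)) z"
    by (simp add: z)
qed

lemma plin_direct_sum_map: "plin (direct_sum_map T)"
  unfolding direct_sum_map_def by (rule plin_lin_ext)

lemma direct_sum_map_tensor:
  assumes "plin T"
  shows "direct_sum_map T (tensor (bvec i) r) = tensor (bvec i) (T r)"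
proof (rule plin_eqI[of "\<lambda>r. direct_sum_map T (tensor (bvec i) r)" "\<lambda>r. tensor (bvec i) (T r)"])
  show "plin (\<lambda>r. direct_sum_map T (tensor (bvec i) r))"
    by (rule plin_comp[OF plin_direct_sum_map plin_tensor_right])
  show "plin (\<lambda>r. tensor (bvec i) (T r))" by (rule plin_comp[OF plin_tensor_right assms])
  show "direct_sum_map T (tensor (bvec i) (bvec x)) = tensor (bvec i) (T (bvec x))" for x
    by (simp add: direct_sum_map_def tensor_bvec)
qed

lemma total_S_act:
  assumes "g \<in> carrier (GG m n)" "x \<in> quad (brackets t m n)"
  shows "total t m n (S_act n g x) = direct_sum_map (schur_tensor_act n g) (total t m n (x :: 'k::field minor_poly))"
  unfolding total_def plin_sum[OF plin_direct_sum_map]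
  by (intro sum.cong refl) (simp only: schur_proj_S_act[OF assms] direct_sum_map_tensor[OF plin_schur_tensor_act])

lemma fv_in_J_even_pairs:
  assumes "admissible t m n q" "(fv t q :: 'k::field_char_0 minor_poly) \<in> J_deg2 t m n"
  shows "q \<in> even_pairs t"
  using assms fv_J_deg2[OF assms(1), where ?'k = 'k] by (intro even_pairs_I) (auto simp: admissible_def)

text \<open>An \<open>f_vec\<close> among the relations is detected by the projection of its own
  type, which is one of the summands of \<open>total\<close>.\<close>

lemma total_kernel:
  assumes "x \<in> J_deg2 t m n" "total t m n x = 0"
  shows "x = (0 :: 'k::field_char_0 minor_poly)"
proof -
  let ?Z = "{x \<in> J_deg2 t m n. total t m n x = 0} :: 'k minor_poly set"
  have Z: "quad_submodule t m n ?Z"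
  proof (rule quad_submodule_kernel[OF quad_submodule_J_deg2 plin_total])
    fix g :: "'k mat \<times> 'k mat" and x
    assume g: "g \<in> carrier (GG m n)" and x: "x \<in> (J_deg2 t m n :: 'k minor_poly set)" "total t m n x = 0"
    show "total t m n (S_act n g x) = 0"
      unfolding total_S_act[OF g quad_submodule_quad[OF quad_submodule_J_deg2 x(1)]] x(2) by (rule plin_0[OF plin_direct_sum_map])
  qed
  have "?Z = {0}"
  proof (rule ccontr)
    assume "?Z \<noteq> {0}"
    then obtain q where q: "admissible t m n q" "fv t q \<in> ?Z" using exists_f_vec[OF Z] by blast
    have "q \<in> even_pairs t" using fv_in_J_even_pairs[OF q(1), where ?'k = 'k] q(2) by blast
    then have "schur_proj_at t m n q (fv t q :: 'k minor_poly) = 0" using q(2) total_eq_0_iff by blast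
    then show False using schur_proj_fv[OF q(1), of q, where ?'k = 'k] q(1) by (simp add: admissible_def)
  qed
  then show ?thesis using assms by blast
qed

text \<open>Injectivity is \<open>total_kernel\<close>; surjectivity is checked slice by slice with
  preimages that are invisible to the other projections.\<close>

theorem J_deg2_decomposition:
  "gmodule_iso (GG m n) (S_act n) (J_deg2 t m n :: 'k::field_char_0 minor_poly set)
     (\<lambda>g. direct_sum_map (schur_tensor_act n g))
     (direct_sum (even_pairs t) (\<lambda>(u, v). schur_tensor m n (tau t u) (tau t v)))"
proof (rule gmodule_iso_image[OF quad_submodule_gmodule[OF quad_submodule_J_deg2] plin_total _ _ _ monoid_GG])
  let ?J = "J_deg2 t m n :: 'k minor_poly set"
  let ?M = "\<lambda>(u, v). schur_tensor m n (tau t u) (tau t v) :: (_ \<Rightarrow>\<^sub>0 'k) set"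
  have J: "quad_submodule t m n ?J" by (rule quad_submodule_J_deg2)
  show "inj_on (total t m n) ?J"
  proof (rule inj_onI)
    fix x y assume xy: "x \<in> ?J" "y \<in> ?J" "total t m n x = total t m n y"
    then have "total t m n (x - y) = 0" by (simp add: plin_diff[OF plin_total])
    then have "x - y = 0" using total_kernel[OF pm.subspace_diff[OF quad_submodule_subspace[OF J] xy(1,2)]] by simp
    then show "x = y" by simp
  qed
  show "total t m n ` ?J = direct_sum (even_pairs t) ?M"
  proof (intro equalityI subsetI)
    fix d assume "d \<in> total t m n ` ?J"
    then obtain x where x: "x \<in> ?J" "d = total t m n x" by blast
    show "d \<in> direct_sum (even_pairs t) ?M"
      unfolding direct_sum_def
    proof (intro CollectI allI)
      fix p
      have "Poly_Mapping.map_key (Pair p) d = (if p \<in> even_pairs t then schur_proj_at t m n p x else 0)"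
        unfolding x(2) total_def by (rule slice_sum_tensor[OF finite_even_pairs])
      moreover have "schur_proj_at t m n p x \<in> ?M p" if "p \<in> even_pairs t"
        using schur_proj_at_mem[OF that quad_submodule_quad[OF J x(1)]] by (simp only: case_prod_unfold)
      ultimately show "if p \<in> even_pairs t then Poly_Mapping.map_key (Pair p) d \<in> ?M p
          else Poly_Mapping.map_key (Pair p) d = 0" by simp
    qed
  next
    fix d assume d: "d \<in> direct_sum (even_pairs t) ?M"
    let ?d = "\<lambda>p. Poly_Mapping.map_key (Pair p) d"
    \<comment> \<open>Slices of types that do not fit into m and n are zero and have the preimage
      0.\<close>
    have "\<exists>b\<in>?J. schur_proj_at t m n p b = ?d p \<and> (\<forall>q\<in>even_pairs t. q \<noteq> p \<longrightarrow> schur_proj_at t m n q b = 0)" if p: "p \<in> even_pairs t" for p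
    proof -
      have "if p \<in> even_pairs t then ?d p \<in> ?M p else ?d p = 0" using d unfolding direct_sum_def by blast
      then have dp: "?d p \<in> schur_tensor_at t m n p" unfolding case_prod_unfold using p by (simp only: if_True)
      show ?thesis
      proof (cases "t + fst p > m \<or> t + snd p > n")
        case True
        then have "?d p = 0" using dp schur_tensor_eq_0[OF True, where ?'k = 'k] by blast
        then show ?thesis
          by (intro bexI[of _ 0]) (auto simp: plin_0[OF plin_schur_proj] pm.subspace_0[OF quad_submodule_subspace[OF J]])
      next
        case False
        from schur_proj_component[OF admissible_even_pairs[OF p False] _ dp] even_pairs_D[OF p]
        obtain b where b: "b \<in> ?J" "schur_proj_at t m n p b = ?d p"
          "\<forall>q. fst q \<le> t \<and> snd q \<le> t \<and> q \<noteq> p \<longrightarrow> schur_proj_at t m n q b = 0" by blast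
        then show ?thesis using even_pairs_D by blast
      qed
    qed
    then obtain b where b: "\<And>p. p \<in> even_pairs t \<Longrightarrow> b p \<in> ?J \<and> schur_proj_at t m n p (b p) = ?d p \<and>
        (\<forall>q\<in>even_pairs t. q \<noteq> p \<longrightarrow> schur_proj_at t m n q (b p) = 0)" by metis
    let ?y = "\<Sum>p\<in>even_pairs t. b p"
    have "schur_proj_at t m n q ?y = ?d q" if q: "q \<in> even_pairs t" for q
    proof -
      have "schur_proj_at t m n q ?y = (\<Sum>p\<in>even_pairs t. if p = q then ?d q else 0)"
        unfolding plin_sum[OF plin_schur_proj]
      proof (rule sum.cong[OF refl])
        fix p assume "p \<in> even_pairs t"
        from b[OF this] q show "schur_proj_at t m n q (b p) = (if p = q then ?d q else 0)" by auto
      qed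
      then show ?thesis using q by simp
    qed
    then have "total t m n ?y = d"
      unfolding total_def by (subst direct_sum_expand[OF d finite_even_pairs]) (rule sum.cong, auto)
    moreover have "?y \<in> ?J" using b by (intro pm.subspace_sum quad_submodule_subspace[OF J]) blast
    ultimately show "d \<in> total t m n ` ?J" by blast
  qed
  show "total t m n (S_act n g x) = direct_sum_map (schur_tensor_act n g) (total t m n x)"
    if "g \<in> carrier (GG m n)" "x \<in> ?J" for g x
    using that(1) quad_submodule_quad[OF J that(2)] by (rule total_S_act)
qed


section \<open>The irreducible components\<close>

text \<open>The isotypic part is cut out by the other projections, so that stability under the group
  is immediate.\<close>

definition component :: "nat \<Rightarrow> nat \<Rightarrow> nat \<Rightarrow> nat \<times> nat \<Rightarrow> 'k::field minor_poly set" where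
  "component t m n p = {x \<in> J_deg2 t m n. \<forall>q\<in>even_pairs t. q \<noteq> p \<longrightarrow> schur_proj_at t m n q x = 0}"

lemma quad_submodule_component: "quad_submodule t m n (component t m n p :: 'k::field minor_poly set)"
  unfolding quad_submodule_def
proof (intro conjI ballI)
  have J: "quad_submodule t m n (J_deg2 t m n :: 'k minor_poly set)" by (rule quad_submodule_J_deg2)
  show "pm.subspace (component t m n p :: 'k minor_poly set)"
    using quad_submodule_subspace[OF J] unfolding component_def
    by (intro pm.subspaceI)
      (auto simp: plin_0[OF plin_schur_proj] plin_add[OF plin_schur_proj] plin_scale[OF plin_schur_proj]
        pm.subspace_0 pm.subspace_add pm.subspace_scale)
  show "(component t m n p :: 'k minor_poly set) \<subseteq> quad (brackets t m n)" using quad_submodule_quad[OF J] by (auto simp: component_def)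
  fix g :: "'k mat \<times> 'k mat" and x assume g: "g \<in> carrier (GG m n)" and x: "x \<in> (component t m n p :: 'k minor_poly set)"
  then have xJ: "x \<in> J_deg2 t m n" by (simp add: component_def)
  show "S_act n g x \<in> component t m n p"
    using x quad_submodule_act[OF J g xJ]
    by (simp add: component_def schur_proj_S_act[OF g quad_submodule_quad[OF J xJ]] plin_0[OF plin_schur_tensor_act])
qed

lemma fv_component_unique:
  assumes "admissible t m n q" "(fv t q :: 'k::field_char_0 minor_poly) \<in> component t m n p"
  shows "q = p"
proof (rule ccontr)
  assume ne: "q \<noteq> p"
  have "q \<in> even_pairs t" using fv_in_J_even_pairs[OF assms(1), where ?'k = 'k] assms(2) by (simp add: component_def)
  then have "schur_proj_at t m n q (fv t q :: 'k minor_poly) = 0" using assms(2) ne by (simp add: component_def)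
  then show False using schur_proj_fv[OF assms(1), of q, where ?'k = 'k] assms(1) by (simp add: admissible_def)
qed

lemma fv_component:
  assumes "admissible t m n p" "fst p \<noteq> snd p"
  shows "(fv t p :: 'k::field_char_0 minor_poly) \<in> component t m n p"
proof -
  have "schur_proj_at t m n q (fv t p :: 'k minor_poly) = 0" if "q \<in> even_pairs t" "q \<noteq> p" for q
    using schur_proj_fv[OF assms(1), of q, where ?'k = 'k] even_pairs_D[OF that(1)] that(2) by simp
  then show ?thesis using fv_J_deg2[OF assms(1), where ?'k = 'k] assms(2) by (simp add: component_def)
qed

lemma inj_on_schur_proj_at_component:
  assumes "p \<in> even_pairs t"
  shows "inj_on (schur_proj_at t m n p) (component t m n p :: 'k::field_char_0 minor_poly set)"
proof (rule inj_onI)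
  fix x y assume xy: "x \<in> (component t m n p :: 'k minor_poly set)" "y \<in> component t m n p" "schur_proj_at t m n p x = schur_proj_at t m n p y"
  have "x - y \<in> component t m n p" by (rule pm.subspace_diff[OF quad_submodule_subspace[OF quad_submodule_component] xy(1,2)])
  moreover have "schur_proj_at t m n p (x - y) = 0" using xy(3) by (simp add: plin_diff[OF plin_schur_proj])
  ultimately have "total t m n (x - y) = 0" "x - y \<in> J_deg2 t m n"
    by (auto simp: component_def total_eq_0_iff)
  then show "x = y" using total_kernel[of "x - y"] by simp
qed

lemma component_iso:
  assumes "admissible t m n p" "fst p \<noteq> snd p"
  shows "schur_proj_at t m n p ` component t m n p = (schur_tensor_at t m n p :: (_ \<Rightarrow>\<^sub>0 'k::field_char_0) set)"
    and "gmodule_iso (GG m n) (S_act n) (component t m n p :: 'k minor_poly set) (schur_tensor_act n) (schur_tensor_at t m n p)"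
proof -
  have p: "p \<in> even_pairs t" using assms by (intro even_pairs_I) (auto simp: admissible_def)
  have C: "quad_submodule t m n (component t m n p :: 'k minor_poly set)" by (rule quad_submodule_component)
  show im: "schur_proj_at t m n p ` component t m n p = (schur_tensor_at t m n p :: (_ \<Rightarrow>\<^sub>0 'k) set)"
  proof (intro equalityI subsetI)
    fix l assume "l \<in> schur_proj_at t m n p ` (component t m n p :: 'k minor_poly set)"
    then show "l \<in> schur_tensor_at t m n p" using schur_proj_at_mem[OF p quad_submodule_quad[OF C]] by blast
  next
    fix l assume "l \<in> (schur_tensor_at t m n p :: (_ \<Rightarrow>\<^sub>0 'k) set)"
    from schur_proj_component[OF assms this] obtain b :: "'k minor_poly" where b: "b \<in> J_deg2 t m n" "schur_proj_at t m n p b = l"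
      "\<forall>q. fst q \<le> t \<and> snd q \<le> t \<and> q \<noteq> p \<longrightarrow> schur_proj_at t m n q b = 0" by blast
    then have "b \<in> component t m n p" using even_pairs_D by (auto simp: component_def)
    then show "l \<in> schur_proj_at t m n p ` component t m n p" using b(2) by blast
  qed
  show "gmodule_iso (GG m n) (S_act n) (component t m n p :: 'k minor_poly set) (schur_tensor_act n) (schur_tensor_at t m n p)"
  proof (rule gmodule_iso_image[OF quad_submodule_gmodule[OF C] plin_schur_proj inj_on_schur_proj_at_component[OF p] im _ monoid_GG])
    show "schur_proj_at t m n p (S_act n g x) = schur_tensor_act n g (schur_proj_at t m n p x)"
      if "g \<in> carrier (GG m n)" "x \<in> (component t m n p :: 'k minor_poly set)" for g x
      using that(1) quad_submodule_quad[OF C that(2)] by (rule schur_proj_S_act)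
  qed
qed

text \<open>By \<open>exists_f_vec\<close> the component contains some invariant
  \<open>f_vec\<close>, and by uniqueness this is the one of type p.\<close>

lemma fv_fixed:
  assumes p: "admissible t m n p" "fst p \<noteq> snd p" and ab: "unitriangular m a" "unitriangular n b"
  shows "S_act n (group_elt n a b) (fv t p) = (fv t p :: 'k::field_char_0 minor_poly)"
proof -
  have "(component t m n p :: 'k minor_poly set) \<noteq> {0}" using fv_component[OF p, where ?'k = 'k] fv_neq_0[OF p(1), where ?'k = 'k] by blast
  from exists_f_vec[OF quad_submodule_component this] obtain q where q: "admissible t m n q" "(fv t q :: 'k minor_poly) \<in> component t m n p"
    "S_act n (group_elt n a b) (fv t q) = (fv t q :: 'k minor_poly)" using ab by blast
  have "q = p" by (rule fv_component_unique[OF q(1,2)])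
  then show ?thesis using q(3) by simp
qed

text \<open>A nonzero submodule contains an \<open>f_vec\<close>, necessarily the one of type p; by
  \<open>quad_submodule_subset\<close> it then contains the whole component.\<close>

lemma irreducible_component:
  assumes p: "admissible t m n p" "fst p \<noteq> snd p"
  shows "irreducible_gmodule (GG m n) (S_act n) (component t m n p :: 'k::field_char_0 minor_poly set)"
  unfolding irreducible_gmodule_def
proof (intro conjI allI impI)
  let ?C = "component t m n p :: 'k minor_poly set"
  show "gmodule (GG m n) (S_act n) ?C" by (rule quad_submodule_gmodule[OF quad_submodule_component])
  show "?C \<noteq> {0}" using fv_component[OF p, where ?'k = 'k] fv_neq_0[OF p(1), where ?'k = 'k] by blast
  fix N assume N: "gsubmodule (GG m n) (S_act n) N ?C"
  then have sN: "quad_submodule t m n N" and NC: "N \<subseteq> ?C" using gsubmodule_quad_submodule[OF N quad_submodule_component] by (auto simp: gsubmodule_def)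
  show "N = {0} \<or> N = ?C"
  proof (cases "N = {0}")
    case False
    obtain q where q: "admissible t m n q" "fv t q \<in> N" using exists_f_vec[OF sN False] by blast
    have "q = p" using fv_component_unique[OF q(1), where ?'k = 'k] q(2) NC by blast
    have "?C \<subseteq> N"
    proof (rule quad_submodule_subset[OF quad_submodule_component sN])
      fix r assume "admissible t m n r" "(fv t r :: 'k minor_poly) \<in> ?C"
      then have "r = p" by (rule fv_component_unique)
      then show "fv t r \<in> N" using q(2) \<open>q = p\<close> by simp
    qed
    then show ?thesis using NC by blast
  qed simp
qed

lemma wt_alt: "wt I J i = of_bool (i \<in> I \<inter> J) + of_bool (i \<in> I \<union> J)"
  by (auto simp: wt_def)

lemma fv_torus_mat:
  assumes q: "admissible t m n q"
  shows "S_act n (group_elt n (torus_mat m i) (1\<^sub>m n)) (fv t q) =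
      pm_scale (2 ^ (of_bool (i < t - fst q) + of_bool (i < t + fst q))) (fv t q :: 'k::field_char_0 minor_poly)"
    and "S_act n (group_elt n (1\<^sub>m m) (torus_mat n i)) (fv t q) =
      pm_scale (2 ^ (of_bool (i < t - snd q) + of_bool (i < t + snd q))) (fv t q :: 'k minor_poly)"
proof -
  have f: "(fv t q :: 'k minor_poly) \<in> quad (brackets t m n)" by (rule fv_quad[OF q])
  have a: "fst q \<le> t" "snd q \<le> t" "even (fst q + snd q)" using q by (auto simp: admissible_def)
  have h: "hvec (t - u) (t + u) t I J \<noteq> (0::'k) \<Longrightarrow> wt I J i = of_bool (i < t - u) + of_bool (i < t + u)" for u I J
    unfolding wt_alt by (auto simp: hvec_def split: if_splits)
  have supp: "hvec (t - fst q) (t + fst q) t (fst v) (fst w) \<noteq> (0::'k) \<and> hvec (t - snd q) (t + snd q) t (snd v) (snd w) \<noteq> (0::'k)"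
    if "pol (fv t q :: 'k minor_poly) v w \<noteq> 0" for v w
    using that pol_f_vec_even[OF a, of v w, where ?'k = 'k] by (auto simp: hvec2_def)
  show "S_act n (group_elt n (torus_mat m i) (1\<^sub>m n)) (fv t q) =
      pm_scale (2 ^ (of_bool (i < t - fst q) + of_bool (i < t + fst q))) (fv t q :: 'k minor_poly)"
  proof (rule pol_inject[OF finite_brackets S_act_quad[OF _ f]])
    show "group_elt n (torus_mat m i) (1\<^sub>m n) \<in> carrier (GG m n)" by (intro group_elt_GG torus_mat_GL one_GL)
    show "pm_scale (2 ^ (of_bool (i < t - fst q) + of_bool (i < t + fst q))) (fv t q :: 'k minor_poly) \<in> quad (brackets t m n)"
      by (rule pm.subspace_scale[OF subspace_quad f])
    fix v w
    show "pol (S_act n (group_elt n (torus_mat m i) (1\<^sub>m n)) (fv t q)) v w =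
      pol (pm_scale (2 ^ (of_bool (i < t - fst q) + of_bool (i < t + fst q))) (fv t q :: 'k minor_poly)) v w"
    proof (cases "pol (fv t q :: 'k minor_poly) v w = 0")
      case False
      with supp have "hvec (t - fst q) (t + fst q) t (fst v) (fst w) \<noteq> (0::'k)" by blast
      then show ?thesis unfolding pol_torus_mat_V[OF f] pol_scale by (simp only: h)
    qed (simp add: pol_torus_mat_V[OF f] pol_scale)
  qed
  show "S_act n (group_elt n (1\<^sub>m m) (torus_mat n i)) (fv t q) =
      pm_scale (2 ^ (of_bool (i < t - snd q) + of_bool (i < t + snd q))) (fv t q :: 'k minor_poly)"
  proof (rule pol_inject[OF finite_brackets S_act_quad[OF _ f]])
    show "group_elt n (1\<^sub>m m) (torus_mat n i) \<in> carrier (GG m n)" by (intro group_elt_GG torus_mat_GL one_GL)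
    show "pm_scale (2 ^ (of_bool (i < t - snd q) + of_bool (i < t + snd q))) (fv t q :: 'k minor_poly) \<in> quad (brackets t m n)"
      by (rule pm.subspace_scale[OF subspace_quad f])
    fix v w
    show "pol (S_act n (group_elt n (1\<^sub>m m) (torus_mat n i)) (fv t q)) v w =
      pol (pm_scale (2 ^ (of_bool (i < t - snd q) + of_bool (i < t + snd q))) (fv t q :: 'k minor_poly)) v w"
    proof (cases "pol (fv t q :: 'k minor_poly) v w = 0")
      case False
      with supp have "hvec (t - snd q) (t + snd q) t (snd v) (snd w) \<noteq> (0::'k)" by blast
      then show ?thesis unfolding pol_torus_mat_W[OF f] pol_scale by (simp only: h)
    qed (simp add: pol_torus_mat_W[OF f] pol_scale)
  qed
qed

text \<open>For different u the weights differ at i = t + min(u, u'), where only the smaller one is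
  0.\<close>

lemma weight_determines:
  fixes t u u' :: nat
  assumes "\<And>i. (2 ^ (of_bool (i < t - u) + of_bool (i < t + u)) :: 'k::field_char_0) = 2 ^ (of_bool (i < t - u') + of_bool (i < t + u'))"
  shows "u = u'"
proof -
  have e: "of_bool (i < t - u) + of_bool (i < t + u) = (of_bool (i < t - u') + of_bool (i < t + u') :: nat)" for i
  proof -
    have "of_nat (2 ^ (of_bool (i < t - u) + of_bool (i < t + u))) = (of_nat (2 ^ (of_bool (i < t - u') + of_bool (i < t + u'))) :: 'k)"
      using assms[of i] by simp
    then have "(2::nat) ^ (of_bool (i < t - u) + of_bool (i < t + u)) = 2 ^ (of_bool (i < t - u') + of_bool (i < t + u'))"
      by (simp only: of_nat_eq_iff)
    then show ?thesis by (simp only: power_inject_exp one_less_numeral_iff semiring_norm)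
  qed
  show ?thesis using e[of "t + u"] e[of "t + u'"]
    by (cases u u' rule: linorder_cases) (auto simp: of_bool_def split: if_splits)
qed

text \<open>An abstract isomorphism is composed with the inverse of the projection on the component.
  It carries any \<open>f_vec\<close> of M to a nonzero raised vector of the component with the same
  torus eigenvalues, so the types agree. Then M and the component contain the same
  \<open>f_vec\<close>.\<close>

lemma iso_imp_eq_component:
  fixes M :: "'k::field_char_0 minor_poly set"
  assumes p: "admissible t m n p" "fst p \<noteq> snd p"
    and M: "gsubmodule (GG m n) (S_act n) M (J_deg2 t m n)"
    and iso: "gmodule_iso (GG m n) (S_act n) M (schur_tensor_act n) (schur_tensor_at t m n p)"
  shows "M = component t m n p"
proof -
  let ?C = "component t m n p :: 'k minor_poly set"
  have pP: "p \<in> even_pairs t" using p by (intro even_pairs_I) (auto simp: admissible_def)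
  have sM: "quad_submodule t m n M" and MJ: "M \<subseteq> J_deg2 t m n"
    using gsubmodule_quad_submodule[OF M quad_submodule_J_deg2] M by (auto simp: gsubmodule_def)
  have C: "quad_submodule t m n ?C" by (rule quad_submodule_component)
  obtain \<psi> where bij: "bij_betw \<psi> M (schur_tensor_at t m n p)"
    and add: "\<forall>x\<in>M. \<forall>y\<in>M. \<psi> (x + y) = \<psi> x + \<psi> y"
    and scale: "\<forall>c. \<forall>x\<in>M. \<psi> (pm_scale c x) = pm_scale c (\<psi> x)"
    and eqv: "\<forall>g\<in>carrier (GG m n). \<forall>x\<in>M. \<psi> (S_act n g x) = schur_tensor_act n g (\<psi> x)"
    using iso unfolding gmodule_iso_def by blast
  have inj\<psi>: "inj_on \<psi> M" using bij by (simp add: bij_betw_def)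
  have 0: "0 \<in> M" by (rule pm.subspace_0[OF quad_submodule_subspace[OF sM]])
  have \<psi>0: "\<psi> 0 = 0" using scale[rule_format, OF 0, of 0] by simp
  have injC: "inj_on (schur_proj_at t m n p) ?C" by (rule inj_on_schur_proj_at_component[OF pP])
  have only: "q = p" if q: "admissible t m n q" "fv t q \<in> M" for q
  proof -
    have qne: "fst q \<noteq> snd q" using fv_J_deg2[OF q(1), where ?'k = 'k] q(2) MJ by blast
    have "\<psi> (fv t q) \<in> schur_tensor_at t m n p" using bij q(2) by (auto simp: bij_betw_def)
    then obtain w where w: "w \<in> ?C" "schur_proj_at t m n p w = \<psi> (fv t q)"
      unfolding component_iso(1)[OF p, symmetric] by (metis imageE)
    \<comment> \<open>Eigenvectors of group elements correspond, by equivariance of both maps and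
      injectivity of the projection on the component. It is used with unitriangular and with torus
      elements.\<close>
    have transfer: "S_act n g w = pm_scale c w"
      if g: "g \<in> carrier (GG m n)" and e: "S_act n g (fv t q) = pm_scale c (fv t q :: 'k minor_poly)" for g c
    proof -
      have "schur_proj_at t m n p (S_act n g w) = schur_tensor_act n g (\<psi> (fv t q))"
        using schur_proj_S_act[OF g quad_submodule_quad[OF C w(1)]] w(2) by simp
      also have "\<dots> = \<psi> (S_act n g (fv t q))" using eqv g q(2) by simp
      also have "\<dots> = pm_scale c (\<psi> (fv t q))" unfolding e using scale q(2) by blast
      also have "\<dots> = schur_proj_at t m n p (pm_scale c w)" by (simp add: w(2) plin_scale[OF plin_schur_proj])
      finally have "schur_proj_at t m n p (S_act n g w) = schur_proj_at t m n p (pm_scale c w)" .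
      then show ?thesis
        using inj_onD[OF injC] quad_submodule_act[OF C g w(1)] pm.subspace_scale[OF quad_submodule_subspace[OF C] w(1)] by blast
    qed
    have "w \<noteq> 0"
    proof
      assume "w = 0"
      then have "\<psi> (fv t q) = \<psi> 0" using w(2) \<psi>0 by (simp add: plin_0[OF plin_schur_proj])
      then have "fv t q = (0 :: 'k minor_poly)" using inj_onD[OF inj\<psi>] q(2) 0 by blast
      then show False using fv_neq_0[OF q(1), where ?'k = 'k] by simp
    qed
    have "S_act n (group_elt n a b) w = w" if "unitriangular m a" "unitriangular n b" for a b
      using transfer[of "group_elt n a b" 1] fv_fixed[where ?'k = 'k, OF q(1) qne that] group_elt_GG[OF unitriangular_GL unitriangular_GL, OF that] by simp
    then have r: "raised t m n (pol w)" by (rule fixed_imp_raised[OF quad_submodule_quad[OF C w(1)]])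
    have "\<exists>c. c \<noteq> 0 \<and> w = pm_scale c (fv t p)"
      by (rule raised_unique[OF C _ w(1) \<open>w \<noteq> 0\<close> r]) (rule fv_component_unique)
    then obtain c where c: "c \<noteq> 0" "w = pm_scale c (fv t p)" by blast
    have scal: "d = d'" if "pm_scale d w = pm_scale d' w" for d d'
      using that \<open>w \<noteq> 0\<close> by (simp add: pm.scale_cancel_right)
    \<comment> \<open>The torus eigenvalues on w are computed once as for type q and once as for
      type p.\<close>
    have "fst q = fst p"
    proof (rule weight_determines[where ?'k = 'k])
      fix i
      let ?g = "group_elt n (torus_mat m i) (1\<^sub>m n) :: 'k mat \<times> 'k mat"
      have g: "?g \<in> carrier (GG m n)" by (intro group_elt_GG torus_mat_GL one_GL)
      have e: "S_act n ?g w = pm_scale (2 ^ (of_bool (i < t - fst p) + of_bool (i < t + fst p))) w"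
        unfolding c(2) plin_scale[OF plin_S_act] fv_torus_mat(1)[OF p(1)] pm.scale_scale by (simp only: mult.commute)
      show "2 ^ (of_bool (i < t - fst q) + of_bool (i < t + fst q)) = (2 ^ (of_bool (i < t - fst p) + of_bool (i < t + fst p)) :: 'k)"
        by (rule scal[OF trans[OF transfer[OF g fv_torus_mat(1)[OF q(1)], symmetric] e]])
    qed
    moreover have "snd q = snd p"
    proof (rule weight_determines[where ?'k = 'k])
      fix i
      let ?g = "group_elt n (1\<^sub>m m) (torus_mat n i) :: 'k mat \<times> 'k mat"
      have g: "?g \<in> carrier (GG m n)" by (intro group_elt_GG torus_mat_GL one_GL)
      have e: "S_act n ?g w = pm_scale (2 ^ (of_bool (i < t - snd p) + of_bool (i < t + snd p))) w"
        unfolding c(2) plin_scale[OF plin_S_act] fv_torus_mat(2)[OF p(1)] pm.scale_scale by (simp only: mult.commute)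
      show "2 ^ (of_bool (i < t - snd q) + of_bool (i < t + snd q)) = (2 ^ (of_bool (i < t - snd p) + of_bool (i < t + snd p)) :: 'k)"
        by (rule scal[OF trans[OF transfer[OF g fv_torus_mat(2)[OF q(1)], symmetric] e]])
    qed
    ultimately show ?thesis by (rule prod_eqI)
  qed
  have "M \<noteq> {0}"
  proof
    assume "M = {0}"
    then have "schur_tensor_at t m n p = \<psi> ` {0}" using bij by (simp add: bij_betw_def)
    then have S: "schur_tensor_at t m n p = ({0} :: (_ \<Rightarrow>\<^sub>0 'k) set)" using \<psi>0 by simp
    have "schur_proj_at t m n p (fv t p) \<in> (schur_tensor_at t m n p :: (_ \<Rightarrow>\<^sub>0 'k) set)"
      unfolding component_iso(1)[OF p, symmetric] using fv_component[OF p, where ?'k = 'k] by (rule imageI)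
    then have "schur_proj_at t m n p (fv t p) = (0 :: _ \<Rightarrow>\<^sub>0 'k)" unfolding S by simp
    then show False using schur_proj_fv[OF p(1), of p, where ?'k = 'k] p(1) by (simp add: admissible_def)
  qed
  then obtain q where q: "admissible t m n q" "fv t q \<in> M" using exists_f_vec[OF sM] by blast
  have pM: "fv t p \<in> M" using only[OF q] q(2) by simp
  have "M \<subseteq> ?C"
    by (rule quad_submodule_subset[OF sM C]) (use only fv_component[OF p, where ?'k = 'k] in blast)
  moreover have "?C \<subseteq> M"
  proof (rule quad_submodule_subset[OF C sM])
    fix r assume "admissible t m n r" "(fv t r :: 'k minor_poly) \<in> ?C"
    then have "r = p" by (rule fv_component_unique)
    then show "fv t r \<in> M" using pM by simp
  qed
  ultimately show ?thesis by blast
qed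


section \<open>Unipotent invariants\<close>

lemma span_bvec_lessThan: "p \<in> pm.span (bvec ` {..<i}) \<longleftrightarrow> keys (p :: nat \<Rightarrow>\<^sub>0 'k::field) \<subseteq> {..<i}"
proof
  assume "p \<in> pm.span (bvec ` {..<i})"
  moreover have "pm.span (bvec ` {..<i}) \<subseteq> {p :: nat \<Rightarrow>\<^sub>0 'k. \<forall>k\<ge>i. lookup p k = 0}"
    by (intro pm.span_minimal pm.subspaceI) (auto simp: bvec_def lookup_single lookup_add when_def)
  ultimately have "lookup p k = 0" if "k \<ge> i" for k using that by blast
  then show "keys p \<subseteq> {..<i}" by (metis in_keys_iff lessThan_iff not_le subsetI)
next
  assume k: "keys p \<subseteq> {..<i}"
  have "(\<Sum>x\<in>keys p. pm_scale (lookup p x) (bvec x)) \<in> pm.span (bvec ` {..<i})"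
    by (intro pm.span_sum pm.span_scale pm.span_base) (use k in auto)
  then show "p \<in> pm.span (bvec ` {..<i})" by (simp flip: pm_expand)
qed

lemma unitriangular_iff:
  assumes a: "a \<in> carrier (GL d)"
  shows "unitriangular d a \<longleftrightarrow> (\<forall>i<d. std_act a (bvec i) - bvec i \<in> pm.span (bvec ` {..<i}))"
proof -
  have c: "a \<in> carrier_mat d d" by (rule GL_carrier_mat[OF a])
  have l: "lookup (std_act a (bvec i) - bvec i) k = (if k < d then a $$ (k, i) else 0) - (if i = k then 1 else 0)" for i k
    using c by (simp add: lookup_minus lookup_std_act mat_fun_def) (simp add: bvec_def lookup_single when_def)
  have "(std_act a (bvec i) - bvec i \<in> pm.span (bvec ` {..<i})) \<longleftrightarrow>
      (\<forall>k<d. i < k \<longrightarrow> a $$ (k, i) = 0) \<and> a $$ (i, i) = 1" if "i < d" for i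
  proof -
    have "(std_act a (bvec i) - bvec i \<in> pm.span (bvec ` {..<i})) \<longleftrightarrow>
        (\<forall>k. i \<le> k \<longrightarrow> lookup (std_act a (bvec i) - bvec i) k = 0)"
      unfolding span_bvec_lessThan subset_iff in_keys_iff lessThan_iff by (metis not_le)
    also have "\<dots> \<longleftrightarrow> (\<forall>k<d. i < k \<longrightarrow> a $$ (k, i) = 0) \<and> a $$ (i, i) = 1"
      unfolding l using that by (auto simp: le_less)
    finally show ?thesis .
  qed
  then show ?thesis using a unfolding unitriangular_def by blast
qed

lemma unip_V_iff: "a \<in> unip_V m \<longleftrightarrow> unitriangular m a"
  unfolding unip_V_def using unitriangular_iff unitriangular_GL by blast

lemma unip_W_iff: "b \<in> unip_W n \<longleftrightarrow> b \<in> carrier (GL n) \<and> unitriangular n (contragredient n b)"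
proof -
  have "dual_act n b = std_act (contragredient n b)" by (simp add: dual_act_def contragredient_def fun_eq_iff)
  then show ?thesis unfolding unip_W_def using unitriangular_iff[OF contragredient_GL, of b n] by auto
qed

text \<open>Invariance gives the raising equations, whose solutions in the component are unique up
  to a scalar. The converse is \<open>fv_fixed\<close> together with irreducibility, which is part
  of the notion.\<close>

lemma highest_biweight_vector_component:
  assumes p: "admissible t m n p" "fst p \<noteq> snd p"
  shows "highest_biweight_vector m n (component t m n p) x \<longleftrightarrow>
    (\<exists>c. c \<noteq> 0 \<and> x = pm_scale c (fv t p :: 'k::field_char_0 minor_poly))"
proof
  assume h: "highest_biweight_vector m n (component t m n p) x"
  then have x: "x \<in> component t m n p" "x \<noteq> 0" and inv: "\<And>a b. a \<in> unip_V m \<Longrightarrow> b \<in> unip_W n \<Longrightarrow> S_act n (a, b) x = x"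
    by (auto simp: highest_biweight_vector_def)
  have C: "quad_submodule t m n (component t m n p :: 'k minor_poly set)" by (rule quad_submodule_component)
  have "S_act n (group_elt n a b) x = x" if "unitriangular m a" "unitriangular n b" for a b
    unfolding group_elt_def by (rule inv) (use that in \<open>auto simp: unip_V_iff unip_W_iff contragredient_contragredient contragredient_GL unitriangular_GL\<close>)
  then have r: "raised t m n (pol x)" by (rule fixed_imp_raised[OF quad_submodule_quad[OF C x(1)]])
  show "\<exists>c. c \<noteq> 0 \<and> x = pm_scale c (fv t p)"
    by (rule raised_unique[OF C _ x r]) (rule fv_component_unique)
next
  assume "\<exists>c. c \<noteq> 0 \<and> x = pm_scale c (fv t p :: 'k minor_poly)"
  then obtain c where c: "c \<noteq> 0" "x = pm_scale c (fv t p)" by blast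
  have "x \<in> component t m n p" unfolding c(2)
    by (rule pm.subspace_scale[OF quad_submodule_subspace[OF quad_submodule_component] fv_component[OF p]])
  moreover have "x \<noteq> 0" using c fv_neq_0[OF p(1), where ?'k = 'k] by (simp add: pm.scale_eq_0_iff)
  moreover have "S_act n (a, b) x = x" if a: "a \<in> unip_V m" and b: "b \<in> unip_W n" for a b
  proof -
    have b': "b \<in> carrier (GL n)" "unitriangular n (contragredient n b)" using b by (auto simp: unip_W_iff)
    have "(a, b) = group_elt n a (contragredient n b)" by (simp add: group_elt_def contragredient_contragredient[OF b'(1)])
    then show ?thesis
      using fv_fixed[where ?'k = 'k, OF p, of a "contragredient n b"] a b'(2) by (simp add: c(2) plin_scale[OF plin_S_act] unip_V_iff)
  qed
  ultimately show "highest_biweight_vector m n (component t m n p) x"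
    using irreducible_component[OF p] by (simp add: highest_biweight_vector_def)
qed

theorem mainTheorem1:
  fixes t m n :: nat
  assumes "1 \<le> t" and "t \<le> m" and "m \<le> n"
  shows
    "gmodule_iso (GG m n)
       (S_act n) (J_deg2 t m n :: 'k::field_char_0 minor_poly set)
       (\<lambda>g. direct_sum_map (schur_tensor_act n g))
       (direct_sum {(u, v). u \<le> t \<and> v \<le> t \<and> even (u + v) \<and> u \<noteq> v}
          (\<lambda>(u, v). schur_tensor m n (tau t u) (tau t v)))
     \<and> (\<forall>u v. u \<le> t \<and> v \<le> t \<and> (t + u > m \<or> t + v > n) \<longrightarrow>
          (schur_tensor m n (tau t u) (tau t v) :: (_ \<Rightarrow>\<^sub>0 'k) set) = {0})
     \<and> (\<forall>u v. u \<le> t \<and> v \<le> t \<and> even (u + v) \<and> u \<noteq> v \<and> t + u \<le> m \<and> t + v \<le> n \<longrightarrow>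
          (\<exists>!M :: 'k minor_poly set. gsubmodule (GG m n) (S_act n) M (J_deg2 t m n) \<and>
             gmodule_iso (GG m n) (S_act n) M
               (schur_tensor_act n) (schur_tensor m n (tau t u) (tau t v))) \<and>
          (\<forall>M :: 'k minor_poly set. gsubmodule (GG m n) (S_act n) M (J_deg2 t m n) \<and>
             gmodule_iso (GG m n) (S_act n) M
               (schur_tensor_act n) (schur_tensor m n (tau t u) (tau t v)) \<longrightarrow>
             (\<forall>x. highest_biweight_vector m n M x \<longleftrightarrow>
                (\<exists>c. c \<noteq> 0 \<and> x = pm_scale c (f_vec t u v)))))"
proof (intro conjI allI impI)
  show "gmodule_iso (GG m n) (S_act n) (J_deg2 t m n :: 'k minor_poly set)
       (\<lambda>g. direct_sum_map (schur_tensor_act n g))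
       (direct_sum {(u, v). u \<le> t \<and> v \<le> t \<and> even (u + v) \<and> u \<noteq> v}
          (\<lambda>(u, v). schur_tensor m n (tau t u) (tau t v)))"
    using J_deg2_decomposition[of m n t, where ?'k = 'k] unfolding even_pairs_def .
  show "(schur_tensor m n (tau t u) (tau t v) :: (_ \<Rightarrow>\<^sub>0 'k) set) = {0}"
    if "u \<le> t \<and> v \<le> t \<and> (t + u > m \<or> t + v > n)" for u v
    using that by (intro schur_tensor_eq_0) blast
  fix u v assume uv: "u \<le> t \<and> v \<le> t \<and> even (u + v) \<and> u \<noteq> v \<and> t + u \<le> m \<and> t + v \<le> n"
  then have p: "admissible t m n (u, v)" "fst (u, v) \<noteq> snd (u, v)" by (auto simp: admissible_def)
  have "component t m n (u, v) \<subseteq> (J_deg2 t m n :: 'k minor_poly set)" by (auto simp: component_def)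
  then have sub: "gsubmodule (GG m n) (S_act n) (component t m n (u, v) :: 'k minor_poly set) (J_deg2 t m n)"
    unfolding gsubmodule_def by (intro conjI quad_submodule_gmodule[OF quad_submodule_component])
  note iso = component_iso(2)[OF p, where ?'k = 'k, unfolded fst_conv snd_conv]
  note eq = iso_imp_eq_component[OF p, where ?'k = 'k, unfolded fst_conv snd_conv]
  show "\<exists>!M :: 'k minor_poly set. gsubmodule (GG m n) (S_act n) M (J_deg2 t m n) \<and>
      gmodule_iso (GG m n) (S_act n) M (schur_tensor_act n) (schur_tensor m n (tau t u) (tau t v))"
    by (rule ex1I[where a = "component t m n (u, v)"], rule conjI[OF sub iso], use eq in blast)
  fix M :: "'k minor_poly set" and x
  assume "gsubmodule (GG m n) (S_act n) M (J_deg2 t m n) \<and>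
      gmodule_iso (GG m n) (S_act n) M (schur_tensor_act n) (schur_tensor m n (tau t u) (tau t v))"
  then have "M = component t m n (u, v)" using eq by blast
  then show "highest_biweight_vector m n M x \<longleftrightarrow> (\<exists>c. c \<noteq> 0 \<and> x = pm_scale c (f_vec t u v))"
    using highest_biweight_vector_component[OF p, where ?'k = 'k] by simp
qed

end
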